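(* Let $m_*,m'\in\mathbb S^2$ with $\langle m_*,m'\rangle=0$. Let $0<\xi<1$ and let $Q$ be a closed subset of the interval $(0,\infty)$ such that $T=T_{\infty,Q}^\xi(m_*,m')$ satisfies Hypothesis H1 and $\epsilon_0<\lim_{t\to K^+}\frac1{t-1}$, where $K=\frac{\max_{x\in T}|x|}{\min_{x\in T}|x|}$. Let $\gamma>0$ be such that $\epsilon_0+\gamma<\lim_{t\to K^+}\frac1{t-1}$, and let $\delta_\gamma=\frac1{\epsilon_0+\gamma}$. Let $g\in L^1(\mathbb S^2)$ be nonnegative, rotationally symmetric about the axis defined by the ray of direction $m_*$ originating at $\mathcal O$, and such that $g\equiv0$ outside $D_T^{\delta_\gamma}$. Let $f\in L^1(T)$ be nonnegative and such that for every $d\in Q$ the value $$f\left(\left(d\cos\theta\,\sin(\arccos\xi),\ d\sin\theta\,\sin(\arccos\xi),\ d\xi\right)'\right)$$ is constant for all $\theta\in[0,2\pi)$. Let $F(\omega)=\int_\omega f\,d\lambda$ for Borel $\omega\subseteq T$, and suppose $$F(T)=\mu_g(D_T^{\delta_\gamma}).$$ Then there exist an $\epsilon_M\in\left(\epsilon_0+\gamma,\lim_{t\to K^+}\frac1{t-1}\right)$ and a convex refractor $R\in\mathcal R_{convex}^{\epsilon_M}(T)$, rotationally symmetric about the axis through $\mathcal O$ of direction $m_*$, that is a convex weak solution to the refractor problem, i.e. $F(\omega)=G_{convex}(R;\omega)$ for every Borel set $\omega\subseteq T$.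
   Context: $\mathcal O$ is the origin of $\mathbb R^3$, $\mathbb S^2$ is the unit sphere centered at $\mathcal O$ with its standard measure $\sigma$, and $k_x=x/|x|$ for $x\ne\mathcal O$. Given orthogonal $m_*,m'\in\mathbb S^2$, $(x,y,z)'$ denotes the point with coordinates $x,y,z$ in the Cartesian coordinate system centered at $\mathcal O$ whose $z$-axis has direction $m_*$, $x$-axis direction $m'$ and $y$-axis direction $m_*\times m'$. For $0<\xi<1$ and $Q$ a closed subset of $(0,\infty)$, $$T_{\infty,Q}^\xi(m_*,m')=\left\{\left(d\cos\theta\,\sin(\arccos\xi),\ d\sin\theta\,\sin(\arccos\xi),\ d\xi\right)':\theta\in[0,2\pi),\ d\in Q\right\},$$ a subset of a right circular cone. $\lambda$ is the Lebesgue measure on $T$ (surface area measure of the cone restricted to $T$). The limit $\lim_{t\to K^+}\frac1{t-1}$ equals $\frac1{K-1}$ if $K>1$ and $+\infty$ if $K=1$. For a target set $T\subset\mathbb R^3\setminus\{\mathcal O\}$ put $c=\min_{x,y\in T}\langle k_x,k_y\rangle$, $\ell=\min_{x\in T}|x|$, $L=\max_{x\in T}|x|$. Hypothesis H1: $T$ is a compact subset of $\mathbb R^3$ contained in a half space of $\mathbb R^3$, $\ell>0$, and $2\ell c>L$. Under H1 define $$\epsilon_0=\frac{\ell+\sqrt{\ell^2-2L\ell c+L^2}}{2\ell c-L}.$$ Hyperboloids: for $x\in\mathbb R^3\setminus\{\mathcal O\}$ and $\epsilon>1$ let $D_\epsilon(x)=\{m\in\mathbb S^2:\langle m,k_x\rangle>1/\epsilon\}$,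 let $\mathrm h_{x,\epsilon}(m)=\frac{|x|(1-\epsilon^2)}{2\epsilon(1-\epsilon\langle m,k_x\rangle)}$ for $m\in D_\epsilon(x)$, and let $H_\epsilon(x)=\{m\,\mathrm h_{x,\epsilon}(m):m\in D_\epsilon(x)\}$. This is the branch, with $x$ as its focus, of the two-sheeted hyperboloid of revolution with foci $\mathcal O$ and $x$ and eccentricity $\epsilon$. $\tilde H_\epsilon(x)$ is the (closed) convex body bounded by $H_\epsilon(x)$. $H(x)$ denotes any such hyperboloid $H_\epsilon(x)$, $\epsilon>1$. Aperture: $A_x^\delta=\{m\in\mathbb S^2:\langle m,k_x\rangle\ge\delta\}$ and $D_T^{\delta_\gamma}=\mathrm{Int}\left(\bigcap_{x\in T}A_x^{\delta_\gamma}\right)$ (interior in $\mathbb S^2$). Refractors: for $\epsilon'\ge\epsilon_0+\gamma$, $\mathcal R_{convex}^{\epsilon'}(T)$ is the set of all $R=\partial\left(\bigcap_{x\in T}\tilde H_{\epsilon_x}(x)\right)$ with each $\epsilon_x\ge\epsilon'$; these are called convex refractors. $H(x)$ is supporting to a set $Q'\subset\mathbb R^3$ at $z\in\partial Q'$ if $\tilde H(x)\supseteq Q'$ and $z\in H(x)\cap\partial Q'$. For a refractor $R$ and $\omega\subseteq T$ let $M(\omega)=\{z\in R:$ there is $x\in\omega$ and a hyperboloid $H(x)$ supporting to $R$ at $z\}$. The visibility set $V_{convex}(R;\omega)$ is the intersection of $\overline{D_T^{\delta_\gamma}}$ with the image of $M(\omega)$ under radial projection onto $\mathbb S^2$. For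 measurable $X\subseteq\mathbb S^2$, $\mu_g(X)=\int_X g\,d\sigma$; the energy function is $G_{convex}(R;\omega)=\mu_g(V_{convex}(R;\omega))$ for Borel $\omega\subseteq T$. *)

theory Defs
  imports "HOL-Analysis.Analysis"
begin

text \<open>
  Throughout, \<open>sgn x = x /\<^sub>R norm x\<close> is the direction \<open>k\<^sub>x\<close> of \<open>x \<noteq> 0\<close>, so \<open>sgn\<close> is also the radial
  projection onto the unit sphere \<open>sphere 0 1\<close>.
\<close>

subsection \<open>Measures\<close>

text \<open>
  The standard measure on the unit sphere: the measure of \<open>A\<close> is three times the volume of the solid
  cone \<open>{r *\<^sub>R u | 0 < r \<le> 1, u \<in> A}\<close> (total mass \<open>4 * pi\<close>), on the completed Borel sets.
\<close>
definition sphere_measure :: "(real^3) measure" where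
  "sphere_measure = completion (scale_measure 3
     (distr (restrict_space lborel (cball 0 1 - {0})) (restrict_space borel (sphere 0 1)) sgn))"

text \<open>
  The surface area measure on \<open>p ` U\<close>, for a parametrization \<open>p\<close> that is smooth near \<open>U\<close> and injective
  on \<open>U\<close>: the area element is the norm of the cross product of the two partial derivatives of \<open>p\<close>.
\<close>
definition surface_measure :: "(real \<times> real) set \<Rightarrow> (real \<times> real \<Rightarrow> real^3) \<Rightarrow> (real^3) measure" where
  "surface_measure U p = completion (distr
     (density (restrict_space lborel U)
       (\<lambda>(s, t). ennreal (norm (cross3 (vector_derivative (\<lambda>s. p (s, t)) (at s))
                                       (vector_derivative (\<lambda>t. p (s, t)) (at t))))))
     (restrict_space borel (p ` U)) p)"

subsection \<open>The target on a right circular cone\<close>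

definition frame_point :: "real^3 \<Rightarrow> real^3 \<Rightarrow> real \<Rightarrow> real \<Rightarrow> real \<Rightarrow> real^3" where
  "frame_point m m' x y z = x *\<^sub>R m' + y *\<^sub>R cross3 m m' + z *\<^sub>R m"

definition cone_point :: "real^3 \<Rightarrow> real^3 \<Rightarrow> real \<Rightarrow> real \<times> real \<Rightarrow> real^3" where
  "cone_point m m' \<xi> = (\<lambda>(d, \<theta>).
     frame_point m m' (d * cos \<theta> * sin (arccos \<xi>)) (d * sin \<theta> * sin (arccos \<xi>)) (d * \<xi>))"

definition cone_target :: "real^3 \<Rightarrow> real^3 \<Rightarrow> real \<Rightarrow> real set \<Rightarrow> (real^3) set" where
  "cone_target m m' \<xi> Q = cone_point m m' \<xi> ` (Q \<times> {0..<2 * pi})"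

definition cone_measure :: "real^3 \<Rightarrow> real^3 \<Rightarrow> real \<Rightarrow> real set \<Rightarrow> (real^3) measure" where
  "cone_measure m m' \<xi> Q = surface_measure (Q \<times> {0..<2 * pi}) (cone_point m m' \<xi>)"

definition axial_rotation :: "real^3 \<Rightarrow> real^3^3 \<Rightarrow> bool" where
  "axial_rotation m A \<longleftrightarrow> rotation_matrix A \<and> A *v m = m"

subsection \<open>Admissible targets\<close>

text \<open>
  For nonempty compact \<open>T\<close> not containing \<open>0\<close>, the infima and suprema below are attained.
\<close>
definition min_cos :: "(real^3) set \<Rightarrow> real" where
  "min_cos T = Inf ((\<lambda>(x, y). sgn x \<bullet> sgn y) ` (T \<times> T))"

definition min_dist :: "(real^3) set \<Rightarrow> real" where
  "min_dist T = Inf (norm ` T)"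

definition max_dist :: "(real^3) set \<Rightarrow> real" where
  "max_dist T = Sup (norm ` T)"

definition H1 :: "(real^3) set \<Rightarrow> bool" where
  "H1 T \<longleftrightarrow> T \<noteq> {} \<and> compact T \<and> (\<exists>a b. a \<noteq> 0 \<and> T \<subseteq> {x. a \<bullet> x \<le> b}) \<and>
     min_dist T > 0 \<and> 2 * min_dist T * min_cos T > max_dist T"

definition eps0 :: "(real^3) set \<Rightarrow> real" where
  "eps0 T = (let c = min_cos T; l = min_dist T; L = max_dist T
     in (l + sqrt (l^2 - 2 * L * l * c + L^2)) / (2 * l * c - L))"

definition eps_limit :: "(real^3) set \<Rightarrow> ereal" where
  "eps_limit T = Lim (at_right (max_dist T / min_dist T)) (\<lambda>t. ereal (1 / (t - 1)))"

subsection \<open>Hyperboloids\<close>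

definition hyp_dom :: "real \<Rightarrow> real^3 \<Rightarrow> (real^3) set" where
  "hyp_dom \<epsilon> x = {m \<in> sphere 0 1. m \<bullet> sgn x > 1 / \<epsilon>}"

definition hyp_radius :: "real \<Rightarrow> real^3 \<Rightarrow> real^3 \<Rightarrow> real" where
  "hyp_radius \<epsilon> x m = norm x * (1 - \<epsilon>^2) / (2 * \<epsilon> * (1 - \<epsilon> * (m \<bullet> sgn x)))"

definition hyperboloid :: "real \<Rightarrow> real^3 \<Rightarrow> (real^3) set" where
  "hyperboloid \<epsilon> x = {hyp_radius \<epsilon> x m *\<^sub>R m | m. m \<in> hyp_dom \<epsilon> x}"

definition hyperboloid_body :: "real \<Rightarrow> real^3 \<Rightarrow> (real^3) set" where
  "hyperboloid_body \<epsilon> x = (THE B. closed B \<and> convex B \<and> frontier B = hyperboloid \<epsilon> x)"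

text \<open>
  The description above determines a unique set for \<open>\<epsilon> > 1\<close> and \<open>x \<noteq> 0\<close>; the following lemmas
  prove this and compute the body.
\<close>

lemma hyperboloid_eq:
  assumes "\<epsilon> > 1" "x \<noteq> 0"
  shows "hyperboloid \<epsilon> x = {y. \<epsilon> * (y \<bullet> sgn x) - norm y = norm x * (\<epsilon>^2 - 1) / (2 * \<epsilon>)}"
    (is "_ = {y. ?f y = ?c}")
proof (intro set_eqI iffI)
  have c: "?c > 0" using assms by (simp add: power_gt1_lemma)
  fix y
  {
    assume "y \<in> hyperboloid \<epsilon> x"
    then obtain m where m: "norm m = 1" "m \<bullet> sgn x > 1 / \<epsilon>" and y: "y = hyp_radius \<epsilon> x m *\<^sub>R m"
      by (auto simp: hyperboloid_def hyp_dom_def)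
    let ?s = "\<epsilon> * (m \<bullet> sgn x) - 1"
    have s: "?s > 0" using m(2) assms(1) by (simp add: field_simps)
    have h: "hyp_radius \<epsilon> x m = ?c / ?s"
      using s assms(1) by (simp add: hyp_radius_def divide_simps) (simp add: algebra_simps)
    have "hyp_radius \<epsilon> x m > 0" unfolding h using c s by (rule divide_pos_pos)
    hence "?f y = hyp_radius \<epsilon> x m * ?s" using m(1) by (simp add: y algebra_simps)
    also have "\<dots> = ?c" unfolding h using s by simp
    finally show "y \<in> {y. ?f y = ?c}" by simp
  }
  {
    assume "y \<in> {y. ?f y = ?c}"
    hence fy: "?f y = ?c" by simp
    hence y0: "y \<noteq> 0" using c by auto
    let ?m = "sgn y"
    let ?s = "\<epsilon> * (?m \<bullet> sgn x) - 1"
    have nm: "norm ?m = 1" using y0 by (simp add: norm_sgn)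
    have yy: "y = norm y *\<^sub>R ?m" using y0 by (simp add: sgn_div_norm)
    have "norm y * ?s = ?f y"
      using y0 by (simp add: sgn_div_norm field_simps)
    hence ns: "norm y * ?s = ?c" using fy by simp
    hence s: "?s > 0" using c y0 by (metis norm_ge_zero zero_less_mult_pos zero_less_norm_iff)
    have "hyp_radius \<epsilon> x ?m = ?c / ?s"
      using s assms(1) by (simp add: hyp_radius_def divide_simps) (simp add: algebra_simps)
    also have "\<dots> = norm y" using ns s by (metis less_irrefl nonzero_mult_div_cancel_right)
    finally have "y = hyp_radius \<epsilon> x ?m *\<^sub>R ?m" using yy by simp
    moreover have "?m \<in> hyp_dom \<epsilon> x"
      using nm s assms(1) by (simp add: hyp_dom_def field_simps)
    ultimately show "y \<in> hyperboloid \<epsilon> x" unfolding hyperboloid_def by blast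
  }
qed

lemma hyperboloid_body_eq:
  assumes "\<epsilon> > 1" "x \<noteq> 0"
  defines "S \<equiv> {y. \<epsilon> * (y \<bullet> sgn x) - norm y \<ge> norm x * (\<epsilon>^2 - 1) / (2 * \<epsilon>)}"
  shows "\<exists>!B. closed B \<and> convex B \<and> frontier B = hyperboloid \<epsilon> x"
    and "hyperboloid_body \<epsilon> x = S"
proof -
  define c where "c = norm x * (\<epsilon>^2 - 1) / (2 * \<epsilon>)"
  define f where "f = (\<lambda>y. \<epsilon> * (y \<bullet> sgn x) - norm y)"
  have c: "c > 0" using assms(1,2) by (simp add: c_def power_gt1_lemma)
  have S: "S = {y. f y \<ge> c}" by (simp add: S_def c_def f_def)
  have H: "hyperboloid \<epsilon> x = {y. f y = c}"
    using hyperboloid_eq[OF assms(1,2)] by (simp add: c_def f_def)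
  have cont: "continuous_on A f" for A unfolding f_def by (intro continuous_intros)
  have scale: "f (t *\<^sub>R y) = t * f y" if "t \<ge> 0" for t y
    using that by (simp add: f_def algebra_simps)
  have clS: "closed S"
    unfolding S by (intro closed_Collect_le cont continuous_on_const)
  have cvS: "convex S"
  proof (rule convexI)
    fix u v :: "real^3" and a b :: real
    assume uv: "u \<in> S" "v \<in> S" and ab: "0 \<le> a" "0 \<le> b" "a + b = 1"
    have "norm (a *\<^sub>R u + b *\<^sub>R v) \<le> a * norm u + b * norm v"
      using norm_triangle_ineq[of "a *\<^sub>R u" "b *\<^sub>R v"] ab by simp
    hence "f (a *\<^sub>R u + b *\<^sub>R v) \<ge> a * f u + b * f v"
      by (simp add: f_def inner_add_left algebra_simps)
    moreover have "a * f u \<ge> a * c" "b * f v \<ge> b * c"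
      using uv ab by (auto simp: S intro!: mult_left_mono)
    moreover have "a * c + b * c = c" using ab(3) by (simp flip: distrib_right)
    ultimately show "a *\<^sub>R u + b *\<^sub>R v \<in> S" by (simp add: S)
  qed
  have frS: "frontier S = {y. f y = c}"
  proof (intro equalityI subsetI)
    fix y assume y: "y \<in> frontier S"
    have "open {y. f y > c}"
      by (intro open_Collect_less cont continuous_on_const)
    hence "{y. f y > c} \<subseteq> interior S" by (intro interior_maximal) (auto simp: S)
    hence "\<not> f y > c" using y by (auto simp: frontier_def)
    moreover have "y \<in> S" using y clS frontier_subset_closed by blast
    ultimately show "y \<in> {y. f y = c}" by (simp add: S)
  next
    fix y assume "y \<in> {y. f y = c}"
    hence fy: "f y = c" by simp
    have y0: "y \<noteq> 0" using fy c by (auto simp: f_def)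
    have "y \<notin> interior S"
    proof
      assume "y \<in> interior S"
      then obtain e where e: "e > 0" "ball y e \<subseteq> S" by (auto simp: mem_interior)
      define t where "t = max 0 (1 - e / (2 * norm y))"
      have t: "0 \<le> t" "t < 1" using e y0 by (auto simp: t_def)
      have "y - t *\<^sub>R y = (1 - t) *\<^sub>R y" by (simp add: scaleR_diff_left)
      hence "dist y (t *\<^sub>R y) = (1 - t) * norm y" using t by (simp add: dist_norm)
      also have "\<dots> \<le> e / (2 * norm y) * norm y"
        by (intro mult_right_mono) (auto simp: t_def)
      also have "\<dots> < e" using y0 e by simp
      finally have "t *\<^sub>R y \<in> S" using e by auto
      thus False using t c fy by (simp add: S scale)
    qed
    thus "y \<in> frontier S" using fy clS by (simp add: frontier_def S)
  qed
  have uniq: "B = S" if B: "closed B" "convex B" "frontier B = {y. f y = c}" for B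
  proof
    have HB: "{y. f y = c} \<subseteq> B" using B(1,3) frontier_subset_closed by blast
    show SB: "S \<subseteq> B"
    proof
      fix y assume yS: "y \<in> S"
      obtain v where v: "v \<noteq> 0" "orthogonal (sgn x) v"
        using orthogonal_to_vector_exists[of "sgn x"] by auto
      have ex: "\<exists>s\<ge>0. f (y + s *\<^sub>R w) = c" if w: "w \<noteq> 0" "orthogonal (sgn x) w" for w
      proof -
        define s where "s = (\<bar>\<epsilon> * (y \<bullet> sgn x)\<bar> + norm y) / norm w"
        have s0: "s \<ge> 0" by (simp add: s_def)
        have "w \<bullet> sgn x = 0" using w(2) by (simp add: orthogonal_def inner_commute)
        hence "f (y + s *\<^sub>R w) = \<epsilon> * (y \<bullet> sgn x) - norm (y + s *\<^sub>R w)"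
          by (simp add: f_def inner_add_left)
        moreover have "norm (y + s *\<^sub>R w) \<ge> s * norm w - norm y"
          using norm_diff_ineq[of "s *\<^sub>R w" y] s0 by (simp add: add.commute)
        moreover have "s * norm w = \<bar>\<epsilon> * (y \<bullet> sgn x)\<bar> + norm y" using w(1) by (simp add: s_def)
        ultimately have lo: "f (y + s *\<^sub>R w) \<le> c" using c by linarith
        have "continuous_on {0..s} (\<lambda>r. f (y + r *\<^sub>R w))"
          unfolding f_def by (intro continuous_intros)
        thus ?thesis
          using IVT2'[of "\<lambda>r. f (y + r *\<^sub>R w)" s c 0] lo s0 yS by (auto simp: S)
      qed
      obtain s where s: "s \<ge> 0" "f (y + s *\<^sub>R v) = c" using ex[of v] v by blast
      obtain r where r: "r \<ge> 0" "f (y + r *\<^sub>R (- v)) = c"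
        using ex[of "- v"] v by (auto simp: orthogonal_def)
      show "y \<in> B"
      proof (cases "r + s = 0")
        case True
        hence "s = 0" using s r by linarith
        thus ?thesis using s HB by auto
      next
        case False
        hence rs: "r + s > 0" using s r by linarith
        have mem: "y + s *\<^sub>R v \<in> B" "y + r *\<^sub>R (- v) \<in> B" using s r HB by auto
        define a b where "a = r / (r + s)" and "b = s / (r + s)"
        have ab: "a \<ge> 0" "b \<ge> 0" "a + b = 1" "b * r = a * s"
          using s r rs by (simp_all add: a_def b_def flip: add_divide_distrib)
        have "a *\<^sub>R (y + s *\<^sub>R v) + b *\<^sub>R (y + r *\<^sub>R (- v)) \<in> B"
          by (rule convexD[OF B(2) mem ab(1-3)])
        also have "a *\<^sub>R (y + s *\<^sub>R v) + b *\<^sub>R (y + r *\<^sub>R (- v))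
            = (a + b) *\<^sub>R y + (a * s - b * r) *\<^sub>R v"
          unfolding scaleR_add_right scaleR_add_left scaleR_diff_left scaleR_minus_right
            scaleR_scaleR by simp
        also have "\<dots> = y" by (simp add: ab)
        finally show ?thesis .
      qed
    qed
    show "B \<subseteq> S"
    proof
      fix y assume yB: "y \<in> B"
      show "y \<in> S"
      proof (rule ccontr)
        assume "y \<notin> S"
        hence fy: "f y < c" by (simp add: S)
        define q where "q = (2 * c / (\<epsilon> - 1)) *\<^sub>R sgn x"
        have nx: "norm (sgn x) = 1" using assms(2) by (simp add: norm_sgn)
        have "f (sgn x) = \<epsilon> - 1"
          using nx by (simp add: f_def norm_eq_1)
        hence fq: "f q = 2 * c"
          using scale[of "2 * c / (\<epsilon> - 1)" "sgn x"] c assms(1) by (simp add: q_def)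
        have "open {y. f y > c}" by (intro open_Collect_less cont continuous_on_const)
        hence "{y. f y > c} \<subseteq> interior B"
          by (intro interior_maximal) (use SB in \<open>auto simp: S\<close>)
        hence qi: "q \<in> interior B" using fq c by auto
        define g where "g = (\<lambda>t. f (y + t *\<^sub>R (q - y)))"
        have "continuous_on {0..1} g" unfolding g_def f_def by (intro continuous_intros)
        moreover have "g 0 \<le> c" "c \<le> g 1" using fy fq c by (simp_all add: g_def)
        ultimately obtain t where t: "0 \<le> t" "t \<le> 1" "g t = c"
          using IVT'[of g 0 c 1] zero_le_one by blast
        have "g 0 < c" using fy by (simp add: g_def)
        hence t0: "t > 0" using t by (cases "t = 0") auto
        have "y - t *\<^sub>R (y - q) \<in> interior B"
          using mem_interior_convex_shrink[OF B(2) qi yB, of t] t t0 by simp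
        moreover have "y - t *\<^sub>R (y - q) = y + t *\<^sub>R (q - y)" by (simp add: algebra_simps)
        moreover have "y + t *\<^sub>R (q - y) \<in> frontier B" using t(3) B(3) by (simp add: g_def)
        ultimately show False by (simp add: frontier_def)
      qed
    qed
  qed
  show ex1: "\<exists>!B. closed B \<and> convex B \<and> frontier B = hyperboloid \<epsilon> x"
    unfolding H by (rule ex1I[of _ S]) (use clS cvS frS uniq in blast)+
  show "hyperboloid_body \<epsilon> x = S"
    unfolding hyperboloid_body_def
    by (rule the1_equality[OF ex1]) (use clS cvS frS H in metis)
qed

subsection \<open>Aperture\<close>

definition aperture :: "real \<Rightarrow> (real^3) set \<Rightarrow> (real^3) set" where
  "aperture \<delta> T =
     top_of_set (sphere 0 1) interior_of (\<Inter>x\<in>T. {m \<in> sphere 0 1. m \<bullet> sgn x \<ge> \<delta>})"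

subsection \<open>Convex refractors and the refractor problem\<close>

definition convex_refractors :: "real \<Rightarrow> (real^3) set \<Rightarrow> (real^3) set set" where
  "convex_refractors \<epsilon>' T =
     {frontier (\<Inter>x\<in>T. hyperboloid_body (\<epsilon> x) x) | \<epsilon>. \<forall>x\<in>T. \<epsilon> x \<ge> \<epsilon>'}"

definition supporting :: "real \<Rightarrow> real^3 \<Rightarrow> (real^3) set \<Rightarrow> real^3 \<Rightarrow> bool" where
  "supporting \<epsilon> x S z \<longleftrightarrow> S \<subseteq> hyperboloid_body \<epsilon> x \<and> z \<in> hyperboloid \<epsilon> x \<inter> frontier S"

definition visibility :: "real \<Rightarrow> (real^3) set \<Rightarrow> (real^3) set \<Rightarrow> (real^3) set \<Rightarrow> (real^3) set" where
  "visibility \<delta> T R \<omega> =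
     closure (aperture \<delta> T) \<inter> sgn ` {z \<in> R. \<exists>x\<in>\<omega>. \<exists>\<epsilon>>1. supporting \<epsilon> x R z}"

definition mu :: "(real^3 \<Rightarrow> real) \<Rightarrow> (real^3) set \<Rightarrow> real" where
  "mu g X = (LINT m:X|sphere_measure. g m)"

definition energy :: "(real^3 \<Rightarrow> real) \<Rightarrow> real \<Rightarrow> (real^3) set \<Rightarrow> (real^3) set \<Rightarrow> (real^3) set \<Rightarrow> real" where
  "energy g \<delta> T R \<omega> = mu g (visibility \<delta> T R \<omega>)"

text \<open>
  Measurability of the visibility sets is required explicitly: the integral of a
  non-integrable function is \<open>0\<close> by convention, so the equation alone would not say it.
\<close>
definition weak_solution ::
  "((real^3) set \<Rightarrow> real) \<Rightarrow> (real^3 \<Rightarrow> real) \<Rightarrow> real \<Rightarrow> (real^3) set \<Rightarrow> (real^3) set \<Rightarrow> bool" where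
  "weak_solution F g \<delta> T R \<longleftrightarrow>
     (\<forall>\<omega>\<in>sets borel. \<omega> \<subseteq> T \<longrightarrow>
        visibility \<delta> T R \<omega> \<in> sets sphere_measure \<and> F \<omega> = energy g \<delta> T R \<omega>)"

end

theory Submission
  imports Defs "HOL-Probability.Distribution_Functions"
begin

text \<open>
  The reciprocal polar radius of the hyperboloid with foci \<open>0\<close> and \<open>x\<close> in the direction \<open>v\<close> is affine in
  \<open>s = v \<bullet> sgn x\<close>; for \<open>norm x = d\<close> and eccentricity \<open>\<epsilon>\<close> it is \<open>recip_radius \<epsilon> d s\<close>. When the eccentricity
  depends on \<open>norm x\<close> only, then among all foci on one circle of the cone the one opposite to \<open>v\<close> is the
  binding one, because there \<open>v \<bullet> sgn x\<close> takes its least value \<open>far_cos m \<xi> v\<close>. So a rotationally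
  symmetric refractor is given by one function \<open>p\<close> of \<open>s = far_cos m \<xi> v\<close>, the infimum over \<open>d \<in> Q\<close> of the
  affine functions \<open>recip_radius (e d) d\<close>, and \<open>v\<close> sees the focus at distance \<open>d\<close> whose line touches \<open>p\<close> at \<open>s\<close>.

  Where two such lines cross, the one with the larger \<open>d\<close> has the smaller slope
  (\<open>recip_slope_antimono\<close>). Since \<open>p\<close> is concave, the distance \<open>D s\<close> seen at \<open>s\<close> must increase with \<open>s\<close>, and
  energy balance then forces \<open>D\<close> to be the monotone rearrangement of the distribution of \<open>far_cos\<close> under \<open>g\<close>
  into the distribution of \<open>norm x\<close> under \<open>f\<close> (\<open>monotone_transport\<close>).

  Conversely, any increasing \<open>D\<close> is realised (\<open>envelope_exists\<close>). A line of distance \<open>d\<close> through the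
  point \<open>(s, x)\<close> has slope \<open>recip_slope s x d\<close>, so touching the line of distance \<open>D s\<close> at each \<open>s\<close> means
  \<open>p' = recip_slope s p (D s)\<close>. The right-hand side is Lipschitz in \<open>p\<close>, so a fixed point argument solves the
  integrated equation, and the comparison principle shows that the tangent lines lie above \<open>p\<close>. The
  initial value, at the rim \<open>s = \<delta>\<close> of the aperture, is that of the line with the least distance and the
  prescribed eccentricity \<open>\<epsilon>\<^sub>M\<close>. Comparison gives that no line has a smaller eccentricity, and the bound
  \<open>\<epsilon>\<^sub>M < 1 / (K - 1)\<close> keeps \<open>p\<close> below the lines \<open>2 * s / d\<close> of infinite eccentricity, so that a hyperboloid
  passes through each point of the graph of \<open>p\<close>.

  Supporting hyperboloids are unique wherever \<open>D\<close> is continuous (\<open>visible_iff\<close>). The exceptional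
  directions form countably many level sets of \<open>far_cos\<close>, which are null because the cone over such a set
  lies in the frontier of a convex cone. Thus up to null sets the visibility set of \<open>\<omega>\<close> is the preimage of \<open>\<omega>\<close>
  under \<open>v \<mapsto> D (far_cos m \<xi> v) *\<^sub>R far_ray m \<xi> v\<close>. Averaging over rotations about the axis
  (\<open>rotation_average\<close>) and integrating over the circles of the cone (\<open>cone_distribution\<close>) reduce the energy
  equation for all Borel sets to the equation between distributions of distances that defines \<open>D\<close>.
\<close>

section \<open>Integral equations with Lipschitz right-hand side\<close>

text \<open>
  Existence for \<open>p' = G t p\<close>, \<open>p a = p0\<close>, in integrated form, since \<open>G\<close> may jump in \<open>t\<close>. The iteration acts on
  \<open>q t = exp (- 2 * L * t) * p t\<close>: this weight makes it a contraction with factor \<open>1/2\<close> on the whole interval.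
\<close>
lemma integral_equation_solvable:
  fixes G :: "real \<Rightarrow> real \<Rightarrow> real"
  assumes "a \<le> b" and "L > 0"
    and int: "\<And>u. continuous_on {a..b} u \<Longrightarrow> (\<lambda>t. G t (u t)) integrable_on {a..b}"
    and lip: "\<And>t x y. t \<in> {a..b} \<Longrightarrow> \<bar>G t x - G t y\<bar> \<le> L * \<bar>x - y\<bar>"
  obtains p where "continuous_on {a..b} p"
    and "\<And>s. s \<in> {a..b} \<Longrightarrow> p s = p0 + integral {a..s} (\<lambda>t. G t (p t))"
proof -
  \<comment> \<open>Functions on the interval are extended by constants, to live among the bounded continuous functions on the line.\<close>
  define cl where "cl = (\<lambda>s. max a (min b s))"
  have cl: "cl s \<in> {a..b}" for s using assms(1) by (auto simp: cl_def)
  have cl_id: "cl s = s" if "s \<in> {a..b}" for s using that by (auto simp: cl_def)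
  define P where "P = (\<lambda>q (s::real). p0 + integral {a..s} (\<lambda>t. G t (exp (2 * L * t) * apply_bcontfun q t)))"
  define F where "F = (\<lambda>q s. exp (- (2 * L * cl s)) * P q (cl s))"
  have int': "(\<lambda>t. G t (exp (2 * L * t) * apply_bcontfun q t)) integrable_on {a..b}" for q
    by (intro int continuous_intros continuous_on_apply_bcontfun)
  have intI: "(\<lambda>t. G t (exp (2 * L * t) * apply_bcontfun q t)) integrable_on {a..s}" if "s \<in> {a..b}" for q s
    using int'[of q] integrable_on_subinterval that by fastforce
  have Pc: "continuous_on {a..b} (P q)" for q
    unfolding P_def by (intro continuous_intros indefinite_integral_continuous_1 int')
  have Fb: "F q \<in> bcontfun" for q
  proof -
    have c: "continuous_on {a..b} (\<lambda>s. exp (- (2 * L * s)) * P q s)"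
      by (intro continuous_intros Pc)
    have ccl: "continuous_on UNIV cl" unfolding cl_def by (intro continuous_intros)
    have "continuous_on UNIV ((\<lambda>s. exp (- (2 * L * s)) * P q s) \<circ> cl)"
      by (rule continuous_on_compose[OF ccl]) (rule continuous_on_subset[OF c], use cl in auto)
    moreover have "bounded ((\<lambda>s. exp (- (2 * L * s)) * P q s) ` {a..b})"
      by (intro compact_imp_bounded compact_continuous_image c) simp
    then obtain B where "\<forall>s\<in>{a..b}. norm (exp (- (2 * L * s)) * P q s) \<le> B"
      unfolding bounded_iff by blast
    ultimately show ?thesis
      by (intro bcontfun_normI[of _ B]) (use cl in \<open>auto simp: F_def o_def\<close>)
  qed
  define FF where "FF = (\<lambda>q. Bcontfun (F q))"
  have FF: "apply_bcontfun (FF q) = F q" for q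
    unfolding FF_def by (rule Bcontfun_inverse[OF Fb])
  have contr: "dist (FF q) (FF r) \<le> 1/2 * dist q r" for q r
  proof (rule dist_bound)
    fix s
    define s' where "s' = cl s"
    have s': "s' \<in> {a..b}" using cl by (simp add: s'_def)
    let ?g = "\<lambda>q t. G t (exp (2 * L * t) * apply_bcontfun q t)"
    have ftc: "((\<lambda>t. L * exp (2 * L * t) * dist q r) has_integral
          (exp (2 * L * s') / 2 * dist q r - exp (2 * L * a) / 2 * dist q r)) {a..s'}"
      using s' by (intro fundamental_theorem_of_calculus)
        (auto intro!: derivative_eq_intros simp flip: has_real_derivative_iff_has_vector_derivative simp: field_simps)
    have "P q s' - P r s' = integral {a..s'} (\<lambda>t. ?g q t - ?g r t)"
      unfolding P_def using intI[OF s'] by (simp add: integral_diff)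
    also have "norm \<dots> \<le> integral {a..s'} (\<lambda>t. L * exp (2 * L * t) * dist q r)"
    proof (rule integral_norm_bound_integral)
      fix t assume t: "t \<in> {a..s'}"
      have "\<bar>?g q t - ?g r t\<bar> \<le> L * \<bar>exp (2 * L * t) * apply_bcontfun q t - exp (2 * L * t) * apply_bcontfun r t\<bar>"
        by (rule lip) (use t s' in auto)
      also have "\<dots> = L * (exp (2 * L * t) * dist (apply_bcontfun q t) (apply_bcontfun r t))"
        by (simp add: dist_real_def abs_mult flip: right_diff_distrib)
      also have "\<dots> \<le> L * (exp (2 * L * t) * dist q r)"
        using assms(2) by (intro mult_left_mono dist_bounded) auto
      finally show "norm (?g q t - ?g r t) \<le> L * exp (2 * L * t) * dist q r" by (simp add: mult.assoc)
    qed (use intI[OF s'] ftc in \<open>auto intro!: integrable_diff\<close>)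
    also have "\<dots> = exp (2 * L * s') / 2 * dist q r - exp (2 * L * a) / 2 * dist q r"
      using ftc by (rule integral_unique)
    also have "\<dots> \<le> exp (2 * L * s') / 2 * dist q r" by simp
    finally have PP: "\<bar>P q s' - P r s'\<bar> \<le> exp (2 * L * s') / 2 * dist q r" by simp
    have "dist (apply_bcontfun (FF q) s) (apply_bcontfun (FF r) s) = exp (- (2 * L * s')) * \<bar>P q s' - P r s'\<bar>"
      by (simp add: FF F_def dist_real_def abs_mult s'_def flip: right_diff_distrib)
    also have "\<dots> \<le> exp (- (2 * L * s')) * (exp (2 * L * s') / 2 * dist q r)"
      by (intro mult_left_mono PP) simp
    also have "\<dots> = 1/2 * dist q r" by (simp add: exp_minus)
    finally show "dist (apply_bcontfun (FF q) s) (apply_bcontfun (FF r) s) \<le> 1/2 * dist q r" .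
  qed
  obtain q where q: "FF q = q" 
    using banach_fix_type[of "1/2" FF] contr by auto
  define p where "p = (\<lambda>s. exp (2 * L * s) * apply_bcontfun q s)"
  have "p s = p0 + integral {a..s} (\<lambda>t. G t (p t))" if s: "s \<in> {a..b}" for s
  proof -
    have "p s = exp (2 * L * s) * F q s" unfolding p_def by (subst q[symmetric]) (simp add: FF)
    also have "\<dots> = P q s" using s by (simp add: F_def cl_id exp_minus)
    finally show ?thesis by (simp add: P_def p_def)
  qed
  moreover have "continuous_on {a..b} p" unfolding p_def
    by (intro continuous_intros continuous_on_apply_bcontfun)
  ultimately show ?thesis using that by blast
qed

text \<open>
  A positive \<open>v\<close> would have a last zero \<open>z\<close> before \<open>b\<close>. On an interval of length \<open>1 / (2 * L)\<close> after \<open>z\<close> the bound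
  says that the maximum of \<open>v\<close> is at most half of itself.
\<close>
lemma gronwall_nonpos:
  fixes v :: "real \<Rightarrow> real"
  assumes ab: "a \<le> b" and L: "L > 0" and cont: "continuous_on {a..b} v" and va: "v a \<le> 0"
    and step: "\<And>z s. a \<le> z \<Longrightarrow> z \<le> s \<Longrightarrow> s \<le> b \<Longrightarrow> (\<And>t. t \<in> {z..s} \<Longrightarrow> v t \<ge> 0) \<Longrightarrow>
                 v s - v z \<le> L * integral {z..s} v"
  shows "v b \<le> 0"
proof (rule ccontr)
  assume "\<not> v b \<le> 0"
  hence vb: "v b > 0" by simp
  define Z where "Z = {t \<in> {a..b}. v t \<le> 0}"
  have "closed ({a..b} \<inter> v -` {..0})" by (rule continuous_closed_preimage[OF cont]) auto
  moreover have "{a..b} \<inter> v -` {..0} = Z" by (auto simp: Z_def)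
  ultimately have clZ: "closed Z" by simp
  have Zb: "bdd_above Z" by (rule bdd_aboveI[of _ b]) (auto simp: Z_def)
  have Zne: "Z \<noteq> {}" using ab va by (auto simp: Z_def)
  define z where "z = Sup Z"
  have zZ: "z \<in> Z" unfolding z_def by (rule closed_contains_Sup[OF Zne Zb clZ])
  have pos: "v t > 0" if "z < t" "t \<le> b" for t
  proof (rule ccontr)
    assume "\<not> v t > 0"
    hence "t \<in> Z" using that zZ by (auto simp: Z_def)
    hence "t \<le> z" unfolding z_def by (rule cSup_upper[OF _ Zb])
    thus False using that by simp
  qed
  have z: "a \<le> z" "z < b" using zZ vb by (auto simp: Z_def intro: order.not_eq_order_implies_strict)
  have vz: "v z \<ge> 0"
  proof -
    have "continuous_on (closure {z<..b}) v"
      by (rule continuous_on_subset[OF cont]) (use z in auto)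
    thus ?thesis
      by (rule continuous_ge_on_closure[where a=0]) (use z pos in \<open>auto intro: less_imp_le\<close>)
  qed
  hence nn: "v t \<ge> 0" if "t \<in> {z..b}" for t using pos[of t] that by (cases "t = z") auto
  define w where "w = min b (z + 1 / (2 * L))"
  have w: "z < w" "w \<le> b" "w - z \<le> 1 / (2 * L)" using z L by (auto simp: w_def)
  have cw: "continuous_on {z..w} v" by (rule continuous_on_subset[OF cont]) (use z w in auto)
  obtain t where t: "t \<in> {z..w}" "\<And>r. r \<in> {z..w} \<Longrightarrow> v r \<le> v t"
    using continuous_attains_sup[OF compact_Icc _ cw] w by fastforce
  have vt: "v t > 0" using t(2)[of w] pos[of w] w by simp
  have "v t \<le> v t - v z" using zZ by (simp add: Z_def)
  also have "\<dots> \<le> L * integral {z..t} v"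
    by (rule step) (use t z w nn in auto)
  also have "\<dots> \<le> L * (v t * (t - z))"
  proof (intro mult_left_mono)
    have "continuous_on {z..t} v" by (rule continuous_on_subset[OF cw]) (use t in auto)
    hence "integral {z..t} v \<le> integral {z..t} (\<lambda>_. v t)"
      by (intro integral_le integrable_continuous_real) (use t in auto)
    thus "integral {z..t} v \<le> v t * (t - z)" using t by (simp add: mult.commute)
  qed (use L in simp)
  also have "\<dots> \<le> L * (v t * (1 / (2 * L)))"
    using t w L vt by (intro mult_left_mono) auto
  also have "\<dots> = v t / 2" using L by simp
  finally show False using vt by simp
qed

text \<open>
  The one-sided bound on \<open>G t x - H t y\<close> follows if \<open>G \<le> H\<close> pointwise and either of the two is Lipschitz. It is
  only required inside the interval: at a jump of the coefficients nothing is known.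
\<close>
lemma integral_equation_comparison:
  fixes p u :: "real \<Rightarrow> real" and G H :: "real \<Rightarrow> real \<Rightarrow> real"
  assumes "a \<le> b" "L > 0"
    and "continuous_on {a..b} p" "continuous_on {a..b} u"
    and intG: "(\<lambda>t. G t (p t)) integrable_on {a..b}" and intH: "(\<lambda>t. H t (u t)) integrable_on {a..b}"
    and p: "\<And>z s. a \<le> z \<Longrightarrow> z \<le> s \<Longrightarrow> s \<le> b \<Longrightarrow> p s - p z = integral {z..s} (\<lambda>t. G t (p t))"
    and u: "\<And>z s. a \<le> z \<Longrightarrow> z \<le> s \<Longrightarrow> s \<le> b \<Longrightarrow> u s - u z = integral {z..s} (\<lambda>t. H t (u t))"
    and GH: "\<And>t x y. t \<in> {a<..<b} \<Longrightarrow> x \<ge> y \<Longrightarrow> G t x - H t y \<le> L * (x - y)"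
    and "p a \<le> u a"
  shows "p b \<le> u b"
proof -
  have "p b - u b \<le> 0"
  proof (rule gronwall_nonpos[where v="\<lambda>t. p t - u t"])
    fix z s assume zs: "a \<le> z" "z \<le> s" "s \<le> b" and nn: "\<And>t. t \<in> {z..s} \<Longrightarrow> 0 \<le> p t - u t"
    have c: "continuous_on {z..s} (\<lambda>t. p t - u t)"
      by (rule continuous_on_subset[where s="{a..b}"]) (use zs assms in \<open>auto intro!: continuous_intros\<close>)
    have iG: "(\<lambda>t. G t (p t)) integrable_on {z..s}" 
      by (rule integrable_on_subinterval[OF intG]) (use zs in auto)
    have iH: "(\<lambda>t. H t (u t)) integrable_on {z..s}" 
      by (rule integrable_on_subinterval[OF intH]) (use zs in auto)
    have "(p s - u s) - (p z - u z) = integral {z..s} (\<lambda>t. G t (p t) - H t (u t))"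
      using p[OF zs] u[OF zs] iG iH by (simp add: integral_diff)
    also have "\<dots> = integral {z<..<s} (\<lambda>t. G t (p t) - H t (u t))"
      by (rule integral_open_interval_real)
    also have "\<dots> \<le> integral {z<..<s} (\<lambda>t. L * (p t - u t))"
    proof (rule integral_le)
      note ee = integrable_on_open_interval_real
      show "(\<lambda>t. G t (p t) - H t (u t)) integrable_on {z<..<s}"
        using iG iH by (simp add: ee integrable_diff)
      show "(\<lambda>t. L * (p t - u t)) integrable_on {z<..<s}"
        unfolding ee by (intro integrable_continuous_real continuous_intros c)
    qed (use GH zs nn in auto)
    also have "\<dots> = integral {z..s} (\<lambda>t. L * (p t - u t))"
      by (rule integral_open_interval_real[symmetric])
    finally show "(p s - u s) - (p z - u z) \<le> L * integral {z..s} (\<lambda>t. p t - u t)" by simp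
  qed (use assms in \<open>auto intro!: continuous_intros\<close>)
  thus ?thesis by simp
qed

section \<open>Hyperboloids in polar coordinates\<close>

text \<open>
  The reciprocal of \<open>hyp_radius \<epsilon> x v\<close> for \<open>norm x = d\<close> and \<open>v \<bullet> sgn x = s\<close>.
\<close>
definition recip_radius :: "real \<Rightarrow> real \<Rightarrow> real \<Rightarrow> real" where
  "recip_radius \<epsilon> d s = 2 * \<epsilon> * (\<epsilon> * s - 1) / (d * (\<epsilon>\<^sup>2 - 1))"

text \<open>
  A hyperboloid line has slope \<open>a = 2 * \<epsilon>\<^sup>2 / (d * (\<epsilon>\<^sup>2 - 1))\<close> and value \<open>a * s - b\<close> with \<open>b\<^sup>2 = a\<^sup>2 - 2 * a / d\<close>.
  Eliminating \<open>b\<close> at the point \<open>(s, x)\<close> leaves a quadratic equation for \<open>a\<close> that involves \<open>\<epsilon>\<close> no longer; this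
  is its positive root.
\<close>
definition recip_slope :: "real \<Rightarrow> real \<Rightarrow> real \<Rightarrow> real" where
  "recip_slope s x d = ((1 / d - s * x) + sqrt ((1 / d - s * x)\<^sup>2 + x\<^sup>2 * (1 - s\<^sup>2))) / (1 - s\<^sup>2)"

lemma recip_radius_affine:
  "recip_radius \<epsilon> d t - recip_radius \<epsilon> d s = 2 * \<epsilon>\<^sup>2 / (d * (\<epsilon>\<^sup>2 - 1)) * (t - s)"
  by (simp add: recip_radius_def algebra_simps power2_eq_square flip: diff_divide_distrib)

lemma recip_slope_recip_radius:
  assumes "d > 0" "\<epsilon> > 1" "\<bar>t\<bar> < 1"
  shows "recip_slope t (recip_radius \<epsilon> d t) d = 2 * \<epsilon>\<^sup>2 / (d * (\<epsilon>\<^sup>2 - 1))"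
proof -
  define a where "a = 2 * \<epsilon>\<^sup>2 / (d * (\<epsilon>\<^sup>2 - 1))"
  define x where "x = recip_radius \<epsilon> d t"
  define w where "w = 1 / d - t * x"
  have e2: "\<epsilon>\<^sup>2 > 1" using assms(2) by simp
  have t2: "t\<^sup>2 < 1" using assms(3) abs_square_less_1 by blast
  have a0: "a > 0" using assms e2 by (simp add: a_def)
  have xb: "a * t - x = a / \<epsilon>" using assms(2) e2 assms(1)
    by (simp add: x_def a_def recip_radius_def divide_simps) (simp add: algebra_simps power2_eq_square)
  have "(a / \<epsilon>)\<^sup>2 = a\<^sup>2 - 2 * a / d"
  proof -
    have "a * d * (\<epsilon>\<^sup>2 - 1) = 2 * \<epsilon>\<^sup>2" using assms(1) e2 by (simp add: a_def)
    hence "a * (a * d * (\<epsilon>\<^sup>2 - 1)) = a * (2 * \<epsilon>\<^sup>2)" by simp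
    thus ?thesis using assms(1,2) by (simp add: power_divide field_simps power2_eq_square)
  qed
  hence "(a * t - x)\<^sup>2 = a\<^sup>2 - 2 * a / d" by (simp add: xb)
  hence q: "(1 - t\<^sup>2) * a\<^sup>2 - 2 * w * a = x\<^sup>2"
    by (simp add: w_def power2_eq_square algebra_simps)
  define r where "r = (1 - t\<^sup>2) * a - w"
  have "r\<^sup>2 = (1 - t\<^sup>2) * ((1 - t\<^sup>2) * a\<^sup>2 - 2 * w * a) + w\<^sup>2"
    by (simp add: r_def power2_eq_square algebra_simps)
  hence r2: "r\<^sup>2 = w\<^sup>2 + x\<^sup>2 * (1 - t\<^sup>2)" by (simp add: q)
  have "r \<ge> 0"
  proof (rule ccontr)
    assume "\<not> r \<ge> 0"
    hence "r < 0" by simp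
    moreover have "r + w > 0" using a0 t2 by (simp add: r_def)
    ultimately have "(-r)\<^sup>2 < w\<^sup>2" by (intro power_strict_mono) auto
    moreover have "x\<^sup>2 * (1 - t\<^sup>2) \<ge> 0" using t2 by simp
    ultimately show False using r2 by simp
  qed
  hence "sqrt (w\<^sup>2 + x\<^sup>2 * (1 - t\<^sup>2)) = r" by (simp flip: r2)
  hence "recip_slope t x d = (w + r) / (1 - t\<^sup>2)" by (simp add: recip_slope_def w_def)
  also have "\<dots> = a" using t2 by (simp add: r_def)
  finally show ?thesis by (simp add: a_def x_def)
qed

text \<open>
  The line \<open>2 * s / d\<close> is the limit \<open>\<epsilon> \<rightarrow> \<infinity>\<close>, the perpendicular bisector of \<open>0\<close> and \<open>x\<close>. Below it, the candidate slope
  \<open>a\<close> exceeds \<open>2 / d\<close>, which makes the intercept \<open>b\<close> positive and \<open>\<epsilon> = a / b\<close> larger than \<open>1\<close>.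
\<close>
lemma recip_radius_surj:
  assumes "d > 0" "0 < s" "s < 1" "0 < x" "x < 2 * s / d"
  obtains \<epsilon> where "\<epsilon> > 1" "recip_radius \<epsilon> d s = x"
proof -
  define w where "w = 1 / d - s * x"
  define r where "r = sqrt (w\<^sup>2 + x\<^sup>2 * (1 - s\<^sup>2))"
  define a where "a = (w + r) / (1 - s\<^sup>2)"
  have s2: "s\<^sup>2 < 1" using assms abs_square_less_1[of s] by simp
  have r2: "r\<^sup>2 = w\<^sup>2 + x\<^sup>2 * (1 - s\<^sup>2)" using s2 by (simp add: r_def)
  have q: "(a * s - x)\<^sup>2 = a\<^sup>2 - 2 * a / d"
  proof -
    have "r\<^sup>2 = ((1 - s\<^sup>2) * a - w)\<^sup>2" using s2 by (simp add: a_def)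
    hence "(1 - s\<^sup>2) * ((1 - s\<^sup>2) * a\<^sup>2 - 2 * w * a) = (1 - s\<^sup>2) * x\<^sup>2"
      using r2 by (simp add: power2_eq_square algebra_simps)
    hence "(1 - s\<^sup>2) * a\<^sup>2 - 2 * w * a = x\<^sup>2" using s2 by simp
    thus ?thesis by (simp add: w_def power2_eq_square algebra_simps)
  qed
  have a2: "a > 2 / d"
  proof -
    have "((1 - s\<^sup>2) * (2 / d) - w)\<^sup>2 = r\<^sup>2 - (1 - s\<^sup>2) * (2 * s / d - x)\<^sup>2"
      unfolding r2 w_def by (simp add: power2_eq_square algebra_simps add_divide_distrib diff_divide_distrib)
    also have "\<dots> < r\<^sup>2" using s2 assms(5) by simp
    finally have "(1 - s\<^sup>2) * (2 / d) - w < r" using power2_less_imp_less[of _ r] r_def s2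
      by (metis (no_types, lifting) real_sqrt_ge_zero r2 zero_le_power2)
    thus ?thesis using s2 by (simp add: a_def field_simps)
  qed
  have a0: "a > 0" using a2 assms(1) by (smt (verit) divide_pos_pos)
  define b where "b = a * s - x"
  have "a * s > 2 / d * s" using a2 assms(2) by (intro mult_strict_right_mono)
  hence b0: "b > 0" using assms(5) by (simp add: b_def)
  have b2: "b\<^sup>2 = a\<^sup>2 - 2 * a / d" using q by (simp add: b_def)
  have "b\<^sup>2 < a\<^sup>2" using b2 a0 assms(1) by simp
  hence ba: "b < a" using a0 by (simp add: power2_less_imp_less)
  define \<epsilon> where "\<epsilon> = a / b"
  have e: "\<epsilon> > 1" using ba b0 by (simp add: \<epsilon>_def)
  have "d * (\<epsilon>\<^sup>2 - 1) = 2 * a / b\<^sup>2"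
    using b0 assms(1) by (simp add: \<epsilon>_def power_divide divide_simps) (simp add: b2 algebra_simps)
  hence "recip_radius \<epsilon> d s = 2 * \<epsilon> * (\<epsilon> * s - 1) * (b\<^sup>2 / (2 * a))" by (simp add: recip_radius_def)
  also have "\<dots> = a * s - b" using a0 b0 by (simp add: \<epsilon>_def divide_simps power2_eq_square)
  finally show ?thesis using that[OF e] by (simp add: b_def)
qed

lemma recip_radius_strict_mono:
  assumes "d > 0" "1 < \<epsilon>" "\<epsilon> < \<epsilon>'" "t \<le> 1"
  shows "recip_radius \<epsilon> d t < recip_radius \<epsilon>' d t"
proof -
  have e: "\<epsilon>\<^sup>2 > 1" "\<epsilon>'\<^sup>2 > 1" using assms by auto
  have "t * (\<epsilon> + \<epsilon>') \<le> 1 * (\<epsilon> + \<epsilon>')" using assms by (intro mult_right_mono) auto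
  moreover have "(\<epsilon> - 1) * (\<epsilon>' - 1) > 0" using assms by simp
  ultimately have "\<epsilon> * \<epsilon>' + 1 - t * (\<epsilon> + \<epsilon>') > 0" by (simp add: algebra_simps)
  hence "(\<epsilon>' - \<epsilon>) * (\<epsilon> * \<epsilon>' + 1 - t * (\<epsilon> + \<epsilon>')) > 0" using assms by simp
  hence "\<epsilon> * (\<epsilon> * t - 1) * (\<epsilon>'\<^sup>2 - 1) < \<epsilon>' * (\<epsilon>' * t - 1) * (\<epsilon>\<^sup>2 - 1)"
    by (simp add: algebra_simps power2_eq_square)
  hence "\<epsilon> * (\<epsilon> * t - 1) / (\<epsilon>\<^sup>2 - 1) < \<epsilon>' * (\<epsilon>' * t - 1) / (\<epsilon>'\<^sup>2 - 1)"
    using e by (simp add: divide_simps)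
  hence "2 / d * (\<epsilon> * (\<epsilon> * t - 1) / (\<epsilon>\<^sup>2 - 1)) < 2 / d * (\<epsilon>' * (\<epsilon>' * t - 1) / (\<epsilon>'\<^sup>2 - 1))"
    using assms(1) by (intro mult_strict_left_mono) auto
  thus ?thesis by (simp add: recip_radius_def)
qed

text \<open>
  The square root is the norm of a vector that depends affinely on \<open>x\<close>, with unit linear part.
\<close>
lemma recip_slope_lipschitz:
  assumes "\<bar>t\<bar> < 1"
  shows "\<bar>recip_slope t x d - recip_slope t y d\<bar> \<le> 2 / (1 - t\<^sup>2) * \<bar>x - y\<bar>"
proof -
  have t2: "t\<^sup>2 < 1" using assms abs_square_less_1 by blast
  define k where "k = sqrt (1 - t\<^sup>2)"
  have k2: "k\<^sup>2 = 1 - t\<^sup>2" using t2 by (simp add: k_def)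
  define v where "v = (\<lambda>x. (1 / d - t * x, k * x))"
  have nv: "sqrt ((1 / d - t * x)\<^sup>2 + x\<^sup>2 * (1 - t\<^sup>2)) = norm (v x)" for x
    by (simp add: v_def norm_Pair power_mult_distrib k2 mult.commute)
  have "norm (v x - v y) = sqrt ((t\<^sup>2 + k\<^sup>2) * (x - y)\<^sup>2)"
    by (simp add: v_def norm_Pair) (simp add: power2_eq_square algebra_simps)
  also have "\<dots> = \<bar>x - y\<bar>" by (simp add: k2)
  finally have "\<bar>norm (v x) - norm (v y)\<bar> \<le> \<bar>x - y\<bar>"
    by (metis norm_triangle_ineq3)
  moreover have "\<bar>t * (x - y)\<bar> \<le> 1 * \<bar>x - y\<bar>"
    unfolding abs_mult using assms by (intro mult_right_mono) auto
  moreover have "recip_slope t x d - recip_slope t y d = (norm (v x) - norm (v y) - t * (x - y)) / (1 - t\<^sup>2)"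
    unfolding recip_slope_def nv by (simp add: algebra_simps flip: diff_divide_distrib)
  moreover from calculation(1,2) have "\<bar>norm (v x) - norm (v y) - t * (x - y)\<bar> \<le> 2 * \<bar>x - y\<bar>"
    using abs_triangle_ineq4[of "norm (v x) - norm (v y)" "t * (x - y)"] by argo
  ultimately have "\<bar>recip_slope t x d - recip_slope t y d\<bar> \<le> (2 * \<bar>x - y\<bar>) / (1 - t\<^sup>2)"
    using t2 by (simp add: abs_divide divide_right_mono)
  thus ?thesis by simp
qed

text \<open>
  The twist condition that decides the direction of the rearrangement: through a common point, a focus
  farther away gives a flatter line.
\<close>
lemma recip_slope_antimono:
  assumes "\<bar>t\<bar> < 1" "0 < d" "d \<le> d'"
  shows "recip_slope t x d' \<le> recip_slope t x d"
proof -
  have t2: "t\<^sup>2 < 1" using assms abs_square_less_1 by blast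
  define k where "k = sqrt (1 - t\<^sup>2) * x"
  have k2: "x\<^sup>2 * (1 - t\<^sup>2) = k\<^sup>2" using t2 by (simp add: k_def power_mult_distrib)
  define w where "w = (\<lambda>d. 1 / d - t * x)"
  have "1 / d' \<le> 1 / d" using assms by (simp add: frac_le)
  hence ww: "w d' \<le> w d" by (simp add: w_def)
  have "norm (w d', k) - norm (w d, k) \<le> norm ((w d', k) - (w d, k))" by (rule norm_triangle_ineq2)
  also have "\<dots> = w d - w d'" using ww by (simp add: norm_Pair)
  finally have "w d' + norm (w d', k) \<le> w d + norm (w d, k)" by simp
  thus ?thesis using t2 unfolding recip_slope_def k2 by (simp add: w_def norm_Pair divide_right_mono)
qed

lemma recip_slope_inject:
  assumes "\<bar>t\<bar> < 1" "x \<noteq> 0" "d \<noteq> 0" "d' \<noteq> 0" "recip_slope t x d = recip_slope t x d'"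
  shows "d = d'"
proof -
  have t2: "t\<^sup>2 < 1" using assms abs_square_less_1 by blast
  define k where "k = x\<^sup>2 * (1 - t\<^sup>2)"
  have k: "k > 0" using t2 assms(2) by (simp add: k_def)
  have inv: "w = (a\<^sup>2 - k) / (2 * a)" if a: "a = w + sqrt (w\<^sup>2 + k)" for a w
  proof -
    have "sqrt (w\<^sup>2 + k) > sqrt (w\<^sup>2)" using k by (intro real_sqrt_less_mono) simp
    hence "a > 0" using a by simp
    moreover have "(a - w)\<^sup>2 = w\<^sup>2 + k" using a k by simp
    hence "a\<^sup>2 - k = w * (2 * a)" by (simp add: power2_eq_square algebra_simps)
    ultimately show ?thesis by simp
  qed
  have "(1 / d - t * x) + sqrt ((1 / d - t * x)\<^sup>2 + k) = (1 / d' - t * x) + sqrt ((1 / d' - t * x)\<^sup>2 + k)"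
    using assms(5) t2 by (simp add: recip_slope_def k_def)
  hence "1 / d - t * x = 1 / d' - t * x" using inv[OF refl] by metis
  thus ?thesis using assms by simp
qed

section \<open>Concave envelopes with prescribed contact\<close>

text \<open>
  The core of the construction. Here \<open>[s0, s1]\<close> is the range of \<open>far_cos\<close> over the aperture, \<open>D s\<close> is the
  distance to be seen at \<open>s\<close>, and \<open>e d\<close> is the eccentricity given to distance \<open>d\<close>. Every line lies above \<open>p\<close>,
  the line of distance \<open>D s\<close> touches it at \<open>s\<close>, and the last clause says that where \<open>D\<close> is continuous no other
  distance can touch, whatever its eccentricity: \<open>p\<close> is differentiable there and the slope of a touching line
  determines its distance.

  Only comparison forward in \<open>s\<close> is used. To the left of the contact point of the line of distance \<open>d\<close> one
  argues by contradiction: if \<open>p\<close> were above the line at \<open>s\<close>, the line of the same distance through \<open>(s, p s)\<close>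
  would have a larger eccentricity, hence stay strictly above the first line, while comparison keeps it
  below \<open>p\<close> up to the contact point.
\<close>
lemma envelope_exists:
  fixes D :: "real \<Rightarrow> real"
  assumes s01: "0 < s0" "s0 < s1" "s1 < 1" and l: "0 < l"
    and D: "mono D" "\<And>s. l \<le> D s" "\<And>s. D s \<le> Lm"
    and eM: "1 < eM" "1 < eM * s0" "eM * (Lm / l - 1) < 1"
  obtains p :: "real \<Rightarrow> real" and e :: "real \<Rightarrow> real"
  where "\<And>d. l \<le> d \<Longrightarrow> d \<le> Lm \<Longrightarrow> eM \<le> e d"
    and "\<And>s. s \<in> {s0..s1} \<Longrightarrow> p s > 0"
    and "\<And>d s. l \<le> d \<Longrightarrow> d \<le> Lm \<Longrightarrow> s \<in> {s0..s1} \<Longrightarrow> p s \<le> recip_radius (e d) d s"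
    and "\<And>s. s \<in> {s0..s1} \<Longrightarrow> p s = recip_radius (e (D s)) (D s) s"
    and "\<And>s d c. s \<in> {s0<..<s1} \<Longrightarrow> isCont D s \<Longrightarrow> 0 < d \<Longrightarrow> 1 < c \<Longrightarrow>
           (\<And>t. t \<in> {s0..s1} \<Longrightarrow> p t \<le> recip_radius c d t) \<Longrightarrow> p s = recip_radius c d s \<Longrightarrow> d = D s"
proof -
  define G where "G = (\<lambda>t x. recip_slope t x (D t))"
  define L where "L = 2 / (1 - s1\<^sup>2)"
  have s12: "s1\<^sup>2 < 1" using s01 abs_square_less_1[of s1] by simp
  have L: "L > 0" using s12 by (simp add: L_def)
  have t1: "\<bar>t\<bar> < 1" "t\<^sup>2 \<le> s1\<^sup>2" if "t \<in> {s0..s1}" for t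
    using that s01 by (auto intro: power_mono)
  have lipA: "\<bar>recip_slope t x d - recip_slope t y d\<bar> \<le> L * \<bar>x - y\<bar>" if "t \<in> {s0..s1}" for t x y d
  proof -
    have "2 / (1 - t\<^sup>2) \<le> L" unfolding L_def using t1[OF that] s12 by (intro divide_left_mono) auto
    thus ?thesis using recip_slope_lipschitz[OF t1(1)[OF that], of x d y]
      by (smt (verit, best) abs_ge_zero mult_right_mono)
  qed
  have Dpos: "D t > 0" for t using D(2)[of t] l by linarith
  have Dm: "D \<in> borel_measurable borel" by (rule borel_measurable_mono[OF D(1)])
  have int: "(\<lambda>t. G t (u t)) integrable_on {s0..s1}" if u: "continuous_on {s0..s1} u" for u
  proof -
    have "bounded (u ` {s0..s1})" by (intro compact_imp_bounded compact_continuous_image u) simp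
    then obtain B where B': "\<forall>s\<in>{s0..s1}. \<bar>u s\<bar> \<le> B" by (auto simp: bounded_iff)
    have B: "\<bar>u s\<bar> \<le> B" if "s \<in> {s0..s1}" for s using B' that by blast
    have um: "u \<in> borel_measurable (lebesgue_on {s0..s1})"
      by (rule continuous_imp_measurable_on_sets_lebesgue[OF u]) simp
    have Dm': "D \<in> borel_measurable (lebesgue_on {s0..s1})"
      by (intro measurable_restrict_space1 measurable_completion) (use Dm in simp)
    have idm: "(\<lambda>t. t) \<in> borel_measurable (lebesgue_on {s0..s1})"
      by (intro measurable_restrict_space1 measurable_completion) simp
    have meas: "(\<lambda>t. G t (u t)) \<in> borel_measurable (lebesgue_on {s0..s1})"
      unfolding G_def recip_slope_def
      by (intro borel_measurable_divide borel_measurable_add borel_measurable_diff borel_measurable_times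
            borel_measurable_const um Dm' idm borel_measurable_power
            measurable_compose[OF _ borel_measurable_sqrt])
    have bnd: "norm (G t (u t)) \<le> ((1 / l + B) + ((1 / l + B) + B)) / (1 - s1\<^sup>2)" if t: "t \<in> {s0..s1}" for t
    proof -
      define w where "w = 1 / D t - t * u t"
      have "1 / D t \<le> 1 / l" "1 / D t > 0" using D(2)[of t] l Dpos[of t] by (auto intro: divide_left_mono)
      moreover have "\<bar>t * u t\<bar> \<le> 1 * B" unfolding abs_mult using B[OF t] t1(1)[OF t] by (intro mult_mono) auto
      ultimately have w: "\<bar>w\<bar> \<le> 1 / l + B" unfolding w_def by linarith
      have t2: "t\<^sup>2 \<ge> 0" "t\<^sup>2 < 1" using t1(2)[OF t] s12 by auto
      have "(u t)\<^sup>2 * (1 - t\<^sup>2) \<le> (u t)\<^sup>2 * 1" using t2 by (intro mult_left_mono) auto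
      hence "sqrt (w\<^sup>2 + (u t)\<^sup>2 * (1 - t\<^sup>2)) \<le> sqrt (w\<^sup>2 + (u t)\<^sup>2)" by simp
      also have "\<dots> \<le> \<bar>w\<bar> + \<bar>u t\<bar>" by (rule sqrt_sum_squares_le_sum_abs)
      finally have "sqrt (w\<^sup>2 + (u t)\<^sup>2 * (1 - t\<^sup>2)) \<le> (1 / l + B) + B" using w B[OF t] by linarith
      moreover have "sqrt (w\<^sup>2 + (u t)\<^sup>2 * (1 - t\<^sup>2)) \<ge> 0" using t2 by simp
      ultimately have "\<bar>w + sqrt (w\<^sup>2 + (u t)\<^sup>2 * (1 - t\<^sup>2))\<bar> \<le> (1 / l + B) + ((1 / l + B) + B)"
        using w by linarith
      moreover have "(1 / l + B) + ((1 / l + B) + B) \<ge> 0" using calculation abs_ge_zero order_trans by blast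
      ultimately have "\<bar>w + sqrt (w\<^sup>2 + (u t)\<^sup>2 * (1 - t\<^sup>2))\<bar> / (1 - t\<^sup>2) \<le> ((1 / l + B) + ((1 / l + B) + B)) / (1 - s1\<^sup>2)"
        using t1(2)[OF t] s12 t2 by (intro frac_le) auto
      thus ?thesis using t2 by (simp add: G_def recip_slope_def w_def abs_divide)
    qed
    show ?thesis
      by (rule measurable_bounded_by_integrable_imp_integrable[OF meas integrable_const_ivl bnd]) simp_all
  qed
  have lipG: "\<bar>G t x - G t y\<bar> \<le> L * \<bar>x - y\<bar>" if "t \<in> {s0..s1}" for t x y
    unfolding G_def by (rule lipA[OF that])
  obtain p where pc: "continuous_on {s0..s1} p"
    and p: "\<And>s. s \<in> {s0..s1} \<Longrightarrow> p s = recip_radius eM l s0 + integral {s0..s} (\<lambda>t. G t (p t))"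
    using integral_equation_solvable[OF less_imp_le[OF s01(2)] L int lipG] by blast
  have pint: "(\<lambda>t. G t (p t)) integrable_on {s0..s1}" by (rule int[OF pc])
  have pstep: "p s - p z = integral {z..s} (\<lambda>t. G t (p t))" if "s0 \<le> z" "z \<le> s" "s \<le> s1" for z s
  proof -
    have "(\<lambda>t. G t (p t)) integrable_on {s0..s}"
      by (rule integrable_on_subinterval[OF pint]) (use that in auto)
    from Henstock_Kurzweil_Integration.integral_combine[OF that(1,2) this] show ?thesis using p[of s] p[of z] that by auto
  qed
  have p0: "p s0 = recip_radius eM l s0" using p[of s0] s01 by simp
  have rc: "continuous_on A (recip_radius c d)" for A c d unfolding recip_radius_def divide_inverse by (intro continuous_intros)
  have slope: "recip_slope t (recip_radius c d t) d = 2 * c\<^sup>2 / (d * (c\<^sup>2 - 1))"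
    if "0 < d" "1 < c" "t \<in> {s0..s1}" for t c d using recip_slope_recip_radius[OF that(1,2) t1(1)[OF that(3)]] .
  have rint: "(\<lambda>t. recip_slope t (recip_radius c d t) d) integrable_on {a..b}"
    if "0 < d" "1 < c" "s0 \<le> a" "b \<le> s1" for a b c d
    by (rule integrable_eq[of "\<lambda>_. 2 * c\<^sup>2 / (d * (c\<^sup>2 - 1))"]) (use slope that in auto)
  have rstep: "recip_radius c d s - recip_radius c d z = integral {z..s} (\<lambda>t. recip_slope t (recip_radius c d t) d)"
    if "0 < d" "1 < c" "s0 \<le> z" "z \<le> s" "s \<le> s1" for z s c d
  proof -
    have "integral {z..s} (\<lambda>t. recip_slope t (recip_radius c d t) d) = integral {z..s} (\<lambda>_. 2 * c\<^sup>2 / (d * (c\<^sup>2 - 1)))"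
      by (rule integral_cong) (use slope that in auto)
    thus ?thesis using that by (simp add: recip_radius_affine mult.commute)
  qed
  have sub: "continuous_on {a..b} p" "(\<lambda>t. G t (p t)) integrable_on {a..b}" if "s0 \<le> a" "b \<le> s1" for a b
    using that by (auto intro: continuous_on_subset[OF pc] integrable_on_subinterval[OF pint])
  have cmp_le: "p b \<le> recip_radius c d b"
    if ab: "s0 \<le> a" "a \<le> b" "b \<le> s1" and dc: "0 < d" "1 < c"
      and DD: "\<And>t. t \<in> {a<..<b} \<Longrightarrow> d \<le> D t" and start: "p a \<le> recip_radius c d a" for a b c d
  proof (rule integral_equation_comparison[where G=G and H="\<lambda>t x. recip_slope t x d" and L=L and a=a and p=p])
    fix t x y :: real assume t: "t \<in> {a<..<b}" and xy: "y \<le> x"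
    have t': "t \<in> {s0..s1}" using t ab by auto
    have "G t x \<le> recip_slope t x d" unfolding G_def by (rule recip_slope_antimono[OF t1(1)[OF t'] dc(1) DD[OF t]])
    thus "G t x - recip_slope t y d \<le> L * (x - y)" using lipA[OF t', of x d y] xy by linarith
  next
    fix z s assume "a \<le> z" "z \<le> s" "s \<le> b"
    thus "p s - p z = integral {z..s} (\<lambda>t. G t (p t))" using ab by (intro pstep) auto
  next
    fix z s assume "a \<le> z" "z \<le> s" "s \<le> b"
    thus "recip_radius c d s - recip_radius c d z = integral {z..s} (\<lambda>t. recip_slope t (recip_radius c d t) d)"
      using ab by (intro rstep dc) auto
  qed (use ab dc sub rint rc L start in auto)
  have cmp_ge: "recip_radius c d b \<le> p b"
    if ab: "s0 \<le> a" "a \<le> b" "b \<le> s1" and dc: "0 < d" "1 < c"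
      and DD: "\<And>t. t \<in> {a<..<b} \<Longrightarrow> D t \<le> d" and start: "recip_radius c d a \<le> p a" for a b c d
  proof (rule integral_equation_comparison[where H=G and G="\<lambda>t x. recip_slope t x d" and L=L and a=a and u=p])
    fix t x y :: real assume t: "t \<in> {a<..<b}" and xy: "y \<le> x"
    have t': "t \<in> {s0..s1}" using t ab by auto
    have "recip_slope t y d \<le> G t y" unfolding G_def by (rule recip_slope_antimono[OF t1(1)[OF t'] Dpos DD[OF t]])
    thus "recip_slope t x d - G t y \<le> L * (x - y)" using lipA[OF t', of x d y] xy by linarith
  next
    fix z s assume "a \<le> z" "z \<le> s" "s \<le> b"
    thus "p s - p z = integral {z..s} (\<lambda>t. G t (p t))" using ab by (intro pstep) auto
  next
    fix z s assume "a \<le> z" "z \<le> s" "s \<le> b"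
    thus "recip_radius c d s - recip_radius c d z = integral {z..s} (\<lambda>t. recip_slope t (recip_radius c d t) d)"
      using ab by (intro rstep dc) auto
  qed (use ab dc sub rint rc L start in auto)
  have eM2: "eM\<^sup>2 > 1" using eM by simp
  have eMs: "eM * s > 1" if "s \<in> {s0..s1}" for s
  proof -
    have "eM * s0 \<le> eM * s" using that eM by (intro mult_left_mono) auto
    thus ?thesis using eM by linarith
  qed
  \<comment> \<open>This is where the upper bound on the eccentricity \<open>eM\<close> enters: the line of the least distance, which lies
    above \<open>p\<close>, is still below the bisector line of the largest distance.\<close>
  have up: "p s < 2 * s / d" if s: "s \<in> {s0..s1}" and d: "0 < d" "d \<le> Lm" for s d
  proof -
    have "p s \<le> recip_radius eM l s"
      by (rule cmp_le[of s0]) (use s s01 l eM D p0 in auto)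
    also have "\<dots> < 2 * s / Lm"
    proof -
      have es: "eM * s - 1 > 0" using eMs[OF s] by simp
      have "l \<le> Lm" using D(2,3) order_trans by blast
      hence Lm: "Lm > 0" using l by simp
      define K where "K = Lm / l"
      have "(eM * s - 1) * (eM * (K - 1)) < (eM * s - 1) * 1"
        unfolding K_def by (rule mult_strict_left_mono[OF eM(3) es])
      hence "K * (eM * (eM * s - 1)) < (eM + 1) * (eM * s - 1)" by (simp add: algebra_simps)
      also have "\<dots> \<le> (eM + 1) * (eM * s - s)" using s s01 eM by (intro mult_left_mono) auto
      also have "\<dots> = s * (eM\<^sup>2 - 1)" by (simp add: algebra_simps power2_eq_square)
      finally have "l * (K * (eM * (eM * s - 1))) < l * (s * (eM\<^sup>2 - 1))" using l by simp
      hence "Lm * (eM * (eM * s - 1)) < l * (s * (eM\<^sup>2 - 1))" using l by (simp add: K_def)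
      thus ?thesis using l Lm eM2 by (simp add: recip_radius_def divide_simps algebra_simps)
    qed
    also have "\<dots> \<le> 2 * s / d" using d s s01 by (intro divide_left_mono) auto
    finally show ?thesis .
  qed
  have lo: "recip_radius eM d s \<le> p s"
    if s: "s \<in> {s0..s1}" and d: "l \<le> d" and DD: "\<And>t. t \<in> {s0<..<s} \<Longrightarrow> D t \<le> d" for s d
  proof (rule cmp_ge[of s0])
    have "recip_radius eM d s0 \<le> recip_radius eM l s0"
      unfolding recip_radius_def using d l eM eM2 by (intro divide_left_mono mult_right_mono) auto
    thus "recip_radius eM d s0 \<le> p s0" by (simp add: p0)
  qed (use s d l eM DD in auto)
  have ppos: "p s > 0" if s: "s \<in> {s0..s1}" for s
  proof -
    have "recip_radius eM (D s) s \<le> p s"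
      by (rule lo[OF s D(2)]) (use D(1) in \<open>auto simp: mono_def\<close>)
    moreover have "recip_radius eM (D s) s > 0"
      unfolding recip_radius_def
      by (intro divide_pos_pos mult_pos_pos) (use eM eM2 Dpos eMs[OF s] in auto)
    ultimately show ?thesis by linarith
  qed
  \<comment> \<open>The contact point of distance \<open>d\<close>: where \<open>D\<close> reaches or jumps over \<open>d\<close>. This definition also serves the
    distances that \<open>D\<close> skips. The point \<open>s0\<close> is inserted to keep the set nonempty.\<close>
  define sg where "sg = (\<lambda>d. Sup (insert s0 {s \<in> {s0..s1}. D s < d}))"
  have bdd: "bdd_above (insert s0 {s \<in> {s0..s1}. D s < d})" for d
    using s01 by (intro bdd_aboveI[of _ s1]) auto
  have sg: "sg d \<in> {s0..s1}" for d
    unfolding sg_def using bdd s01 by (auto intro: cSup_upper cSup_least)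
  have sg_le: "D t < d" if "s0 \<le> t" "t < sg d" for t d
  proof -
    have "t < Sup (insert s0 {s \<in> {s0..s1}. D s < d})" using that(2) by (simp add: sg_def)
    from less_cSupD[OF insert_not_empty this]
    obtain r where r: "r \<in> insert s0 {s \<in> {s0..s1}. D s < d}" "t < r" by (rule bexE)
    hence "D r < d" using that by auto
    moreover have "D t \<le> D r" using D(1) r(2) by (auto simp: mono_def)
    ultimately show ?thesis by linarith
  qed
  have sg_ge: "d \<le> D t" if "t \<le> s1" "sg d < t" for t d
  proof (rule ccontr)
    assume "\<not> d \<le> D t"
    hence "t \<in> insert s0 {s \<in> {s0..s1}. D s < d}" using that sg[of d] by auto
    from cSup_upper[OF this bdd] show False using that by (simp add: sg_def)
  qed
  have "\<exists>c>1. recip_radius c d (sg d) = p (sg d)" if "0 < d" "d \<le> Lm" for d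
  proof -
    have "0 < sg d" "sg d < 1" using sg[of d] s01 by auto
    from recip_radius_surj[OF that(1) this ppos[OF sg] up[OF sg that]] show ?thesis by blast
  qed
  then obtain e where e: "\<And>d. 0 < d \<Longrightarrow> d \<le> Lm \<Longrightarrow> e d > 1 \<and> recip_radius (e d) d (sg d) = p (sg d)"
    by metis
  have e_ge: "eM \<le> e d" if d: "l \<le> d" "d \<le> Lm" for d
  proof (rule ccontr)
    assume "\<not> eM \<le> e d"
    hence "recip_radius (e d) d (sg d) < recip_radius eM d (sg d)"
      using e[of d] d l sg[of d] s01 by (intro recip_radius_strict_mono) auto
    moreover have "recip_radius eM d (sg d) \<le> p (sg d)"
      by (rule lo[OF sg d(1)]) (use sg_le in \<open>auto intro: less_imp_le\<close>)
    ultimately show False using e[of d] d l by simp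
  qed
  have e_up: "p s \<le> recip_radius (e d) d s" if d: "l \<le> d" "d \<le> Lm" and s: "s \<in> {s0..s1}" for d s
  proof (cases "sg d \<le> s")
    case True
    show ?thesis
      by (rule cmp_le[of "sg d"]) (use True sg[of d] s d l e[of d] sg_ge in auto)
  next
    case False
    show ?thesis
    proof (rule ccontr)
      assume gt: "\<not> p s \<le> recip_radius (e d) d s"
      obtain c where c: "c > 1" "recip_radius c d s = p s"
        using recip_radius_surj[of d s "p s"] s s01 ppos[OF s] up[OF s, of d] d l by auto
      have "e d < c"
      proof (rule ccontr)
        assume "\<not> e d < c"
        hence "recip_radius c d s \<le> recip_radius (e d) d s"
          using recip_radius_strict_mono[of d c "e d" s] c(1) d l s s01 by (cases "c = e d") auto
        thus False using gt c by simp
      qed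
      hence "recip_radius (e d) d (sg d) < recip_radius c d (sg d)"
        using e[of d] d l sg[of d] s01 by (intro recip_radius_strict_mono) auto
      moreover have "recip_radius c d (sg d) \<le> p (sg d)"
        by (rule cmp_ge[of s]) (use False sg[of d] s d l c sg_le in \<open>auto intro: less_imp_le\<close>)
      ultimately show False using e[of d] d l by simp
    qed
  qed
  have e_eq: "p s = recip_radius (e (D s)) (D s) s" if s: "s \<in> {s0..s1}" for s
  proof (rule antisym)
    have "sg (D s) \<le> s" using sg_le[of s "D s"] s by fastforce
    thus "recip_radius (e (D s)) (D s) s \<le> p s"
      using cmp_ge[of "sg (D s)" s "D s" "e (D s)"] sg[of "D s"] s Dpos e[OF Dpos D(3)] D(1)
      by (auto simp: mono_def)
  qed (use e_up[OF D(2,3) s] in simp)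
  have uniq: "d = D s" if s: "s \<in> {s0<..<s1}" and cont: "isCont D s" and d: "0 < d" and c: "1 < c"
     and above: "\<And>t. t \<in> {s0..s1} \<Longrightarrow> p t \<le> recip_radius c d t" and touch: "p s = recip_radius c d s" for s d c
  proof -
    have s': "s \<in> {s0..s1}" using s by auto
    have ps: "isCont p s"
      using continuous_on_interior[OF pc, of s] s by simp
    have "continuous (at s) (\<lambda>t. G t (p t))"
      unfolding G_def recip_slope_def using cont ps Dpos t1[OF s'] s12
      by (intro continuous_intros) (auto simp: less_imp_neq[OF Dpos, symmetric])
    hence "continuous (at s within ({s0..s1} - {})) (\<lambda>t. G t (p t))"
      by (rule continuous_at_imp_continuous_at_within)
    from integral_has_vector_derivative_continuous_at[OF pint _ _ this] s'
    have "((\<lambda>u. integral {s0..u} (\<lambda>t. G t (p t))) has_real_derivative G s (p s)) (at s within {s0..s1})"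
      by (simp add: has_real_derivative_iff_has_vector_derivative)
    hence "((\<lambda>u. recip_radius eM l s0 + integral {s0..u} (\<lambda>t. G t (p t))) has_real_derivative G s (p s)) (at s within {s0..s1})"
      by (auto intro!: derivative_eq_intros)
    hence "(p has_real_derivative G s (p s)) (at s within {s0..s1})"
      by (rule has_field_derivative_transform_within[where d=1]) (use s' p in auto)
    hence dp: "(p has_real_derivative G s (p s)) (at s)"
      using s at_within_interior[of s "{s0..s1}"] by simp
    define m where "m = 2 * c\<^sup>2 / (d * (c\<^sup>2 - 1))"
    have "recip_radius c d = (\<lambda>t. m * (t - s) + recip_radius c d s)"
    proof
      fix t show "recip_radius c d t = m * (t - s) + recip_radius c d s"
        using recip_radius_affine[of c d t s] unfolding m_def by linarith
    qed
    moreover have "((\<lambda>t. m * (t - s) + recip_radius c d s) has_real_derivative m) (at s)"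
      by (auto intro!: derivative_eq_intros)
    ultimately have "(recip_radius c d has_real_derivative m) (at s)" by simp
    hence "((\<lambda>t. recip_radius c d t - p t) has_real_derivative (m - G s (p s))) (at s)"
      by (intro DERIV_diff dp)
    hence "m - G s (p s) = 0"
    proof (rule DERIV_local_min[where d="min (s - s0) (s1 - s)"])
      show "\<forall>y. \<bar>s - y\<bar> < min (s - s0) (s1 - s) \<longrightarrow> recip_radius c d s - p s \<le> recip_radius c d y - p y"
      proof (intro allI impI)
        fix y assume "\<bar>s - y\<bar> < min (s - s0) (s1 - s)"
        hence "y \<in> {s0..s1}" by auto
        thus "recip_radius c d s - p s \<le> recip_radius c d y - p y" using above[of y] touch by simp
      qed
    qed (use s in auto)
    hence "recip_slope s (p s) (D s) = recip_slope s (p s) d"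
      using slope[OF d c s'] by (simp add: G_def m_def touch)
    thus "d = D s"
      using recip_slope_inject[OF t1(1)[OF s'], of "p s" "D s" d] ppos[OF s'] Dpos[of s] d by auto
  qed
  show ?thesis by (rule that[OF e_ge ppos e_up e_eq uniq]) 
qed

section \<open>Monotone rearrangement on the line\<close>

text \<open>
  The sublevel set is a half line whose end point is a solution of \<open>cdf \<nu> t = h\<close>, unless it is empty (then
  \<open>h = 0\<close>) or everything (then \<open>h\<close> is the total mass).
\<close>
lemma cdf_integral_transform:
  fixes \<nu> :: "real measure"
  assumes fb: "finite_borel_measure \<nu>" and atomless: "\<And>x. measure \<nu> {x} = 0"
    and h: "0 \<le> h" "h \<le> measure \<nu> UNIV"
  shows "{s. cdf \<nu> s \<le> h} \<in> sets borel" and "measure \<nu> {s. cdf \<nu> s \<le> h} = h"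
proof -
  interpret finite_borel_measure \<nu> by fact
  have sp: "space \<nu> = UNIV" by (rule borel_UNIV)
  have cont: "continuous_on UNIV (cdf \<nu>)"
    unfolding continuous_on_eq_continuous_at[OF open_UNIV] using isCont_cdf atomless by blast
  have mono: "mono (cdf \<nu>)" by (intro monoI cdf_nondecreasing)
  define X where "X = {s. cdf \<nu> s \<le> h}"
  have clX: "closed X" unfolding X_def by (intro closed_Collect_le cont continuous_on_const)
  thus "{s. cdf \<nu> s \<le> h} \<in> sets borel" unfolding X_def by (rule borel_closed)
  have down: "r \<in> X" if "s \<in> X" "r \<le> s" for r s
    using that cdf_nondecreasing[of r s] by (auto simp: X_def)
  consider "X = {}" | "X = UNIV" | "X \<noteq> {}" "X \<noteq> UNIV" by blast
  hence "measure \<nu> X = h"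
  proof cases
    case 1
    have "h \<le> 0"
    proof (rule tendsto_lowerbound[OF cdf_lim_at_bot])
      show "\<forall>\<^sub>F s in at_bot. h \<le> cdf \<nu> s" using 1 by (auto simp: X_def not_le intro!: always_eventually less_imp_le)
    qed simp
    thus ?thesis using 1 h by simp
  next
    case 2
    have "measure \<nu> (space \<nu>) \<le> h"
    proof (rule tendsto_upperbound[OF cdf_lim_at_top])
      show "\<forall>\<^sub>F s in at_top. cdf \<nu> s \<le> h" using 2 by (auto simp: X_def intro!: always_eventually)
    qed simp
    thus ?thesis using 2 h sp by simp
  next
    case 3
    then obtain r where r: "r \<notin> X" by blast
    have bX: "bdd_above X" using down r by (intro bdd_aboveI[of _ r]) (meson linear)
    define t where "t = Sup X"
    have tX: "t \<in> X" unfolding t_def by (rule closed_contains_Sup[OF 3(1) bX clX])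
    have X: "X = {..t}" using down[OF tX] cSup_upper[OF _ bX] by (auto simp: t_def)
    have "h \<le> cdf \<nu> t"
    proof (rule tendsto_lowerbound)
      show "(cdf \<nu> \<longlongrightarrow> cdf \<nu> t) (at_right t)"
        using cdf_is_right_cont[of t] by (simp add: continuous_within)
      have "\<forall>s\<in>{t<..}. h \<le> cdf \<nu> s" 
      proof
        fix s assume "s \<in> {t<..}"
        hence "s \<notin> X" by (simp add: X)
        thus "h \<le> cdf \<nu> s" by (simp add: X_def)
      qed
      thus "\<forall>\<^sub>F s in at_right t. h \<le> cdf \<nu> s" by (auto simp: eventually_at_filter)
    qed simp
    moreover have "cdf \<nu> t \<le> h" using tX by (simp add: X_def)
    ultimately show ?thesis by (simp add: X cdf_def)
  qed
  thus "measure \<nu> {s. cdf \<nu> s \<le> h} = h" by (simp add: X_def)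
qed

text \<open>
  The map is the generalised inverse of \<open>cdf \<eta>\<close> applied to \<open>cdf \<nu>\<close>, with the infimum taken within \<open>Q\<close> so that all
  values lie in \<open>Q\<close>, also for points outside the support of \<open>\<nu>\<close>.
\<close>
lemma monotone_transport:
  fixes \<nu> \<eta> :: "real measure"
  assumes \<nu>: "finite_borel_measure \<nu>" and atomless: "\<And>x. measure \<nu> {x} = 0"
    and \<eta>: "finite_borel_measure \<eta>" and Q: "compact Q" "Q \<noteq> {}" "measure \<eta> (- Q) = 0"
    and total: "measure \<nu> UNIV = measure \<eta> UNIV"
  obtains D where "mono D" "\<And>s. D s \<in> Q" "distr \<nu> borel D = \<eta>"
proof -
  interpret \<nu>: finite_borel_measure \<nu> by fact
  interpret \<eta>: finite_borel_measure \<eta> by fact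
  have sp: "space \<nu> = UNIV" "space \<eta> = UNIV" by (rule \<nu>.borel_UNIV \<eta>.borel_UNIV)+
  have clQ: "closed Q" and bQ: "bounded Q" using Q(1) by (auto simp: compact_eq_bounded_closed)
  have bddQ: "bdd_below A" "bdd_above A" if "A \<subseteq> Q" for A
    using bounded_subset[OF bQ that] by (auto intro: bounded_imp_bdd_below bounded_imp_bdd_above)
  have Qs: "Q \<in> sets borel" using clQ by (rule borel_closed)
  have restr: "measure \<eta> A = measure \<eta> (A \<inter> Q)" if "A \<in> sets borel" for A
  proof -
    have "measure \<eta> A = measure \<eta> (A \<inter> Q) + measure \<eta> (A - Q)"
      using that Qs by (subst \<eta>.finite_measure_Diff') auto
    moreover have "measure \<eta> (A - Q) \<le> measure \<eta> (- Q)"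
      using that Qs by (intro \<eta>.finite_measure_mono) auto
    ultimately show ?thesis using Q(3) measure_nonneg[of \<eta> "A - Q"] by linarith
  qed
  define A where "A = (\<lambda>s. {q \<in> Q. cdf \<nu> s \<le> cdf \<eta> q})"
  define D where "D = (\<lambda>s. Inf (A s))"
  have AQ: "A s \<subseteq> Q" for s by (auto simp: A_def)
  have Ane: "A s \<noteq> {}" for s
  proof -
    define b where "b = Sup Q"
    have bQ': "b \<in> Q" unfolding b_def by (rule closed_contains_Sup[OF Q(2) bddQ(2) clQ]) simp
    have "cdf \<nu> s \<le> measure \<eta> UNIV" using \<nu>.cdf_bounded[of s] total sp by simp
    also have "\<dots> = measure \<eta> (UNIV \<inter> Q)" by (rule restr) simp
    also have "\<dots> \<le> cdf \<eta> b" unfolding cdf_def b_def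
      using cSup_upper[OF _ bddQ(2)] by (intro \<eta>.finite_measure_mono) auto
    finally show ?thesis using bQ' by (auto simp: A_def)
  qed
  have DA: "D s \<in> A s" for s
  proof -
    define b where "b = D s"
    have "b \<in> Q" unfolding b_def D_def
      using closed_subset_contains_Inf[OF clQ AQ Ane bddQ(1)[OF AQ]] by blast
    moreover have "cdf \<nu> s \<le> cdf \<eta> b"
    proof (rule tendsto_lowerbound)
      show "(cdf \<eta> \<longlongrightarrow> cdf \<eta> b) (at_right b)"
        using \<eta>.cdf_is_right_cont[of b] by (simp add: continuous_within)
      have "\<forall>r\<in>{b<..}. cdf \<nu> s \<le> cdf \<eta> r"
      proof
        fix r assume "r \<in> {b<..}"
        hence "b < r" by simp
        then obtain q where "q \<in> A s" "q < r"
          unfolding b_def D_def using cInf_less_iff[OF Ane bddQ(1)[OF AQ]] by blast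
        thus "cdf \<nu> s \<le> cdf \<eta> r" using \<eta>.cdf_nondecreasing[of q r] by (auto simp: A_def)
      qed
      thus "\<forall>\<^sub>F r in at_right b. cdf \<nu> s \<le> cdf \<eta> r" by (auto simp: eventually_at_filter)
    qed simp
    ultimately show ?thesis by (simp add: A_def b_def)
  qed
  have D_le: "D s \<le> q \<longleftrightarrow> cdf \<nu> s \<le> cdf \<eta> q" if "q \<in> Q" for s q
  proof
    assume "D s \<le> q"
    hence "cdf \<eta> (D s) \<le> cdf \<eta> q" by (rule \<eta>.cdf_nondecreasing)
    thus "cdf \<nu> s \<le> cdf \<eta> q" using DA[of s] by (simp add: A_def)
  next
    assume "cdf \<nu> s \<le> cdf \<eta> q"
    hence "q \<in> A s" using that by (simp add: A_def)
    thus "D s \<le> q" unfolding D_def by (rule cInf_lower[OF _ bddQ(1)[OF AQ]])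
  qed
  have mono: "mono D"
  proof (rule monoI)
    fix r s :: real assume "r \<le> s"
    hence "cdf \<nu> r \<le> cdf \<nu> s" by (rule \<nu>.cdf_nondecreasing)
    moreover have "D s \<in> Q" "cdf \<nu> s \<le> cdf \<eta> (D s)" using DA[of s] by (auto simp: A_def)
    ultimately show "D r \<le> D s" using D_le[of "D s" r] by linarith
  qed
  have Dm: "D \<in> borel_measurable borel" by (rule borel_measurable_mono[OF mono])
  hence Dm': "D \<in> borel_measurable \<nu>" using \<nu>.M_is_borel by (simp add: measurable_def sp)
  have cdfD: "measure \<nu> (D -` {..x}) = cdf \<eta> x" for x
  proof (cases "Q \<inter> {..x} = {}")
    case True
    have "D s > x" for s using DA[of s] True by (force simp: A_def)
    hence "D -` {..x} = {}" by (auto simp flip: not_less)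
    moreover have "cdf \<eta> x = 0" unfolding cdf_def using restr[of "{..x}"] True by (simp add: Int_commute)
    ultimately show ?thesis by simp
  next
    case False
    define q where "q = Sup (Q \<inter> {..x})"
    have bd: "bdd_above (Q \<inter> {..x})" by (rule bddQ) simp
    have qQ: "q \<in> Q \<inter> {..x}"
      unfolding q_def by (rule closed_contains_Sup[OF False bd]) (use clQ in auto)
    have le_iff: "r \<le> x \<longleftrightarrow> r \<le> q" if "r \<in> Q" for r
      using qQ cSup_upper[OF _ bd, of r] that by (auto simp: q_def)
    have "D -` {..x} = {s. cdf \<nu> s \<le> cdf \<eta> q}"
      using le_iff DA D_le qQ by (auto simp: A_def)
    hence "measure \<nu> (D -` {..x}) = cdf \<eta> q"
      using cdf_integral_transform(2)[OF \<nu> atomless, of "cdf \<eta> q"] \<eta>.cdf_nonneg \<eta>.cdf_bounded[of q] total sp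
      by simp
    also have "{..q} \<inter> Q = {..x} \<inter> Q" using le_iff by auto
    hence "cdf \<eta> q = cdf \<eta> x" unfolding cdf_def using restr[of "{..q}"] restr[of "{..x}"] by simp
    finally show ?thesis .
  qed
  have "finite_borel_measure (distr \<nu> borel D)"
    using \<nu>.finite_measure_distr[OF Dm'] by (simp add: finite_borel_measure_def finite_borel_measure_axioms_def)
  hence "distr \<nu> borel D = \<eta>"
    by (rule cdf_unique'[OF _ \<eta>]) (use Dm' in \<open>simp add: fun_eq_iff cdf_def[of "distr \<nu> borel D"] measure_distr sp cdfD\<close>)
  thus ?thesis using that[OF mono] DA by (auto simp: A_def)
qed

section \<open>Geometry of the cone\<close>

definition axis_dist :: "real^3 \<Rightarrow> real^3 \<Rightarrow> real" where
  "axis_dist m y = sqrt ((norm y)\<^sup>2 - (y \<bullet> m)\<^sup>2)"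

text \<open>
  For the cone with axis \<open>m\<close> and half-angle \<open>arccos \<xi>\<close> and for \<open>norm y = 1\<close> this is the cosine of the angle
  between \<open>y\<close> and the ruling farthest from \<open>y\<close>; \<open>far_ray\<close> below is the direction of that ruling.
\<close>
definition far_cos :: "real^3 \<Rightarrow> real \<Rightarrow> real^3 \<Rightarrow> real" where
  "far_cos m \<xi> y = \<xi> * (y \<bullet> m) - sqrt (1 - \<xi>\<^sup>2) * axis_dist m y"

definition far_ray :: "real^3 \<Rightarrow> real \<Rightarrow> real^3 \<Rightarrow> real^3" where
  "far_ray m \<xi> y = \<xi> *\<^sub>R m - (sqrt (1 - \<xi>\<^sup>2) / axis_dist m y) *\<^sub>R (y - (y \<bullet> m) *\<^sub>R m)"

text \<open>
  Within this locale \<open>u \<theta>\<close> is the unit vector along the ruling with azimuth \<open>\<theta>\<close>, and \<open>m'\<close>, \<open>n\<close>, \<open>m\<close> is the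
  orthonormal frame in which the cone is parametrised.
\<close>
locale cone_frame =
  fixes m m' :: "real^3" and \<xi> :: real
  assumes norm_m: "norm m = 1" and norm_m': "norm m' = 1" and orth: "m \<bullet> m' = 0"
    and xi: "0 < \<xi>" "\<xi> < 1"
begin

definition n :: "real^3" where "n = cross3 m m'"
definition \<kappa> :: real where "\<kappa> = sqrt (1 - \<xi>\<^sup>2)"
definition u :: "real \<Rightarrow> real^3" where "u \<theta> = cone_point m m' \<xi> (1, \<theta>)"

abbreviation "S \<equiv> far_cos m \<xi>"

lemma xi2: "\<xi>\<^sup>2 < 1"
  using xi abs_square_less_1[of \<xi>] by simp

lemma kappa: "0 < \<kappa>" "\<kappa>\<^sup>2 = 1 - \<xi>\<^sup>2" "sin (arccos \<xi>) = \<kappa>"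
  using xi2 xi by (simp_all add: \<kappa>_def sin_arccos)

lemma frame_inner:
  "m \<bullet> m = 1" "m' \<bullet> m' = 1" "n \<bullet> n = 1" "m \<bullet> m' = 0" "m' \<bullet> m = 0"
  "n \<bullet> m = 0" "m \<bullet> n = 0" "n \<bullet> m' = 0" "m' \<bullet> n = 0"
proof -
  show mm: "m \<bullet> m = 1" "m' \<bullet> m' = 1" using norm_m norm_m' by (simp_all add: norm_eq_1)
  show "m \<bullet> m' = 0" "m' \<bullet> m = 0" using orth by (simp_all add: inner_commute)
  have "(norm n)\<^sup>2 = 1" unfolding n_def norm_cross using norm_m norm_m' orth by simp
  thus "n \<bullet> n = 1" by (simp add: power2_norm_eq_inner)
  show "n \<bullet> m = 0" "m \<bullet> n = 0" "n \<bullet> m' = 0" "m' \<bullet> n = 0"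
    unfolding n_def by (simp_all add: dot_cross_self)
qed

text \<open>
  A vector \<open>z\<close> orthogonal to all three frame vectors is zero: it is orthogonal to \<open>n\<close>, and the expansion of
  \<open>z \<times> (m \<times> m')\<close> shows that it is also parallel to \<open>n\<close>.
\<close>
lemma frame_expand: "y = (y \<bullet> m') *\<^sub>R m' + (y \<bullet> n) *\<^sub>R n + (y \<bullet> m) *\<^sub>R m"
proof -
  define z where "z = y - ((y \<bullet> m') *\<^sub>R m' + (y \<bullet> n) *\<^sub>R n + (y \<bullet> m) *\<^sub>R m)"
  have z: "z \<bullet> m = 0" "z \<bullet> m' = 0" "z \<bullet> n = 0"
    by (simp_all add: z_def inner_diff_left inner_add_left frame_inner)
  have "cross3 z n = (z \<bullet> m') *\<^sub>R m - (z \<bullet> m) *\<^sub>R m'"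
    unfolding n_def by (simp add: cross3_simps) (simp add: forall_3 vector_3 algebra_simps)
  hence "cross3 z n = 0" using z by simp
  hence "0 = (norm z)\<^sup>2 * (norm n)\<^sup>2 - (z \<bullet> n)\<^sup>2" using norm_cross[of z n] by simp
  hence "z = 0" using z frame_inner(3) by (simp add: power2_norm_eq_inner)
  thus ?thesis by (simp add: z_def)
qed

lemma frame_norm: "(norm y)\<^sup>2 = (y \<bullet> m')\<^sup>2 + (y \<bullet> n)\<^sup>2 + (y \<bullet> m)\<^sup>2"
proof -
  have "(norm y)\<^sup>2 = y \<bullet> ((y \<bullet> m') *\<^sub>R m' + (y \<bullet> n) *\<^sub>R n + (y \<bullet> m) *\<^sub>R m)"
    using frame_expand[of y] by (simp add: power2_norm_eq_inner)
  thus ?thesis by (simp add: inner_add_right power2_eq_square)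
qed

lemma axis_dist_frame: "axis_dist m y = sqrt ((y \<bullet> m')\<^sup>2 + (y \<bullet> n)\<^sup>2)"
  by (simp add: axis_dist_def frame_norm)

lemma axis_dist_nonneg: "0 \<le> axis_dist m y"
  by (simp add: axis_dist_frame)

lemma axis_dist_sq: "(axis_dist m y)\<^sup>2 = (y \<bullet> m')\<^sup>2 + (y \<bullet> n)\<^sup>2"
  by (simp add: axis_dist_frame)

lemma u_frame: "u \<theta> = (\<kappa> * cos \<theta>) *\<^sub>R m' + (\<kappa> * sin \<theta>) *\<^sub>R n + \<xi> *\<^sub>R m"
  by (simp add: u_def cone_point_def frame_point_def kappa n_def mult.commute)

lemma cone_point_u: "cone_point m m' \<xi> (d, \<theta>) = d *\<^sub>R u \<theta>"
  by (simp add: u_frame cone_point_def frame_point_def kappa n_def scaleR_add_right mult_ac)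

lemma inner_u: "y \<bullet> u \<theta> = \<xi> * (y \<bullet> m) + \<kappa> * ((y \<bullet> m') * cos \<theta> + (y \<bullet> n) * sin \<theta>)"
  by (simp add: u_frame inner_add_right algebra_simps)

lemma norm_u: "norm (u \<theta>) = 1"
proof -
  have "(norm (u \<theta>))\<^sup>2 = \<kappa>\<^sup>2 * ((cos \<theta>)\<^sup>2 + (sin \<theta>)\<^sup>2) + \<xi>\<^sup>2"
  proof -
    have "u \<theta> \<bullet> m' = \<kappa> * cos \<theta>" "u \<theta> \<bullet> n = \<kappa> * sin \<theta>" "u \<theta> \<bullet> m = \<xi>"
      by (simp_all add: u_frame inner_add_left frame_inner)
    thus ?thesis unfolding frame_norm by algebra
  qed
  hence "(norm (u \<theta>))\<^sup>2 = 1\<^sup>2" by (simp add: kappa)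
  thus ?thesis by (simp only: power2_eq_iff_nonneg norm_ge_zero zero_le_one)
qed

lemma S_frame: "S y = \<xi> * (y \<bullet> m) - \<kappa> * axis_dist m y"
  by (simp add: far_cos_def \<kappa>_def)

text \<open>
  For \<open>r \<ge> 0\<close> this yields the Cauchy-Schwarz bound \<open>- r \<le> a * c + b * s\<close> together with its equality case.
\<close>
lemma sum_sq_identity:
  fixes a b c s r :: real
  assumes "c\<^sup>2 + s\<^sup>2 = 1" "r\<^sup>2 = a\<^sup>2 + b\<^sup>2"
  shows "(a + r * c)\<^sup>2 + (b + r * s)\<^sup>2 = 2 * r * (r + (a * c + b * s))"
proof -
  have "(a + r * c)\<^sup>2 + (b + r * s)\<^sup>2 = (a\<^sup>2 + b\<^sup>2) + 2 * r * (a * c + b * s) + r\<^sup>2 * (c\<^sup>2 + s\<^sup>2)"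
    by (simp add: power2_eq_square algebra_simps)
  also have "\<dots> = r\<^sup>2 + 2 * r * (a * c + b * s) + r\<^sup>2"
    using assms by simp
  also have "\<dots> = 2 * r * (r + (a * c + b * s))" by (simp add: power2_eq_square algebra_simps)
  finally show ?thesis .
qed

lemma S_le: "S y \<le> y \<bullet> u \<theta>"
proof -
  define r where "r = axis_dist m y"
  have r: "r \<ge> 0" "r\<^sup>2 = (y \<bullet> m')\<^sup>2 + (y \<bullet> n)\<^sup>2" by (simp_all add: r_def axis_dist_nonneg axis_dist_sq)
  define k where "k = (y \<bullet> m') * cos \<theta> + (y \<bullet> n) * sin \<theta>"
  have "2 * r * (r + k) = (y \<bullet> m' + r * cos \<theta>)\<^sup>2 + (y \<bullet> n + r * sin \<theta>)\<^sup>2"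
    unfolding k_def by (rule sum_sq_identity[symmetric]) (simp_all add: r)
  also have "\<dots> \<ge> 0" by simp
  finally have "2 * r * (r + k) \<ge> 0" .
  have "- r \<le> k"
  proof (cases "r = 0")
    case True
    thus ?thesis using r(2) by (simp add: k_def sum_power2_eq_zero_iff)
  next
    case False
    thus ?thesis using r(1) \<open>2 * r * (r + k) \<ge> 0\<close> by (simp add: zero_le_mult_iff)
  qed
  hence "\<kappa> * (- r) \<le> \<kappa> * k" using kappa(1) by (intro mult_left_mono) auto
  thus ?thesis by (simp add: S_frame inner_u k_def r_def)
qed

lemma far_ray_frame:
  "far_ray m \<xi> y = (- \<kappa> * (y \<bullet> m') / axis_dist m y) *\<^sub>R m' + (- \<kappa> * (y \<bullet> n) / axis_dist m y) *\<^sub>R n + \<xi> *\<^sub>R m"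
proof -
  have "y - (y \<bullet> m) *\<^sub>R m = (y \<bullet> m') *\<^sub>R m' + (y \<bullet> n) *\<^sub>R n"
    using frame_expand[of y] by (simp add: algebra_simps)
  thus ?thesis unfolding far_ray_def by (simp add: \<kappa>_def scaleR_add_right)
qed

lemma u_eq_far_ray:
  assumes "axis_dist m y \<noteq> 0" "y \<bullet> u \<theta> = S y"
  shows "u \<theta> = far_ray m \<xi> y"
proof -
  define r where "r = axis_dist m y"
  have r: "r \<noteq> 0" "r\<^sup>2 = (y \<bullet> m')\<^sup>2 + (y \<bullet> n)\<^sup>2" using assms(1) by (simp_all add: r_def axis_dist_sq)
  define k where "k = (y \<bullet> m') * cos \<theta> + (y \<bullet> n) * sin \<theta>"
  have "\<kappa> * k = \<kappa> * (- r)" using assms(2) by (simp add: S_frame inner_u k_def r_def)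
  hence "k = - r" using kappa(1) by (metis mult_left_cancel less_irrefl)
  moreover have "(y \<bullet> m' + r * cos \<theta>)\<^sup>2 + (y \<bullet> n + r * sin \<theta>)\<^sup>2 = 2 * r * (r + k)"
    unfolding k_def by (rule sum_sq_identity) (simp_all add: r)
  ultimately have "y \<bullet> m' + r * cos \<theta> = 0" "y \<bullet> n + r * sin \<theta> = 0"
    by (simp_all add: sum_power2_eq_zero_iff)
  hence "cos \<theta> = - (y \<bullet> m') / r" "sin \<theta> = - (y \<bullet> n) / r" using r(1) by (auto simp: field_simps)
  thus ?thesis by (simp add: u_frame far_ray_frame r_def)
qed

lemma S_attained:
  obtains \<theta> where "\<theta> \<in> {0..<2*pi}" "y \<bullet> u \<theta> = S y"
proof (cases "axis_dist m y = 0")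
  case True
  hence "(y \<bullet> m')\<^sup>2 + (y \<bullet> n)\<^sup>2 = 0" using axis_dist_sq[of y] by simp
  hence "y \<bullet> m' = 0" "y \<bullet> n = 0" by (simp_all add: sum_power2_eq_zero_iff)
  hence "y \<bullet> u 0 = S y" using True by (simp add: inner_u S_frame)
  thus ?thesis using that[of 0] by simp
next
  case False
  define r where "r = axis_dist m y"
  have r: "r \<noteq> 0" "r\<^sup>2 = (y \<bullet> m')\<^sup>2 + (y \<bullet> n)\<^sup>2" using False by (simp_all add: r_def axis_dist_sq)
  have "(- (y \<bullet> m') / r)\<^sup>2 + (- (y \<bullet> n) / r)\<^sup>2 = 1"
    using r(1) by (simp add: power_divide flip: add_divide_distrib r(2))
  then obtain \<theta> where t: "0 \<le> \<theta>" "\<theta> < 2*pi" "- (y \<bullet> m') / r = cos \<theta>" "- (y \<bullet> n) / r = sin \<theta>"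
    using sincos_total_2pi by metis
  have "(y \<bullet> m') * cos \<theta> + (y \<bullet> n) * sin \<theta> = - ((y \<bullet> m')\<^sup>2 + (y \<bullet> n)\<^sup>2) / r"
    unfolding t(3,4)[symmetric] by (simp add: power2_eq_square add_divide_distrib diff_divide_distrib)
  also have "\<dots> = - r" using r by (simp flip: r(2)) (simp add: power2_eq_square)
  finally have "y \<bullet> u \<theta> = S y" by (simp add: inner_u S_frame r_def)
  thus ?thesis using that[of \<theta>] t by simp
qed

lemma far_ray_cases:
  assumes "axis_dist m y \<noteq> 0"
  obtains \<theta> where "\<theta> \<in> {0..<2*pi}" "far_ray m \<xi> y = u \<theta>" "y \<bullet> u \<theta> = S y"
  using S_attained u_eq_far_ray[OF assms] by metis

lemma S_le_xi: "norm y = 1 \<Longrightarrow> S y \<le> \<xi>"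
proof -
  assume y: "norm y = 1"
  have "y \<bullet> m \<le> 1" using norm_cauchy_schwarz[of y m] y norm_m by simp
  hence "\<xi> * (y \<bullet> m) \<le> \<xi> * 1" using xi by (intro mult_left_mono) auto
  moreover have "0 \<le> \<kappa> * axis_dist m y" using kappa(1) axis_dist_nonneg by simp
  ultimately show ?thesis by (simp add: S_frame)
qed

lemma axis_dist_pos:
  assumes "norm y = 1" "0 < S y" "S y < \<xi>"
  shows "axis_dist m y \<noteq> 0"
proof
  assume 0: "axis_dist m y = 0"
  hence "(norm y)\<^sup>2 = (y \<bullet> m)\<^sup>2" using frame_norm[of y] axis_dist_sq[of y] by simp
  hence "\<bar>y \<bullet> m\<bar> = 1" using assms(1) by (simp add: abs_square_eq_1 power2_eq_1_iff)
  moreover have "S y = \<xi> * (y \<bullet> m)" using 0 by (simp add: S_frame)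
  ultimately show False using assms xi by (auto simp: abs_if split: if_splits)
qed

text \<open>
  A point on the great circle through the axis and \<open>u \<theta>\<close>, on the far side of the axis, so that the ruling
  \<open>u \<theta>\<close> is the farthest one from it.
\<close>
lemma far_point_exists:
  assumes "0 \<le> t" "t \<le> \<xi>"
  obtains v where "norm v = 1" "S v = t" "v \<bullet> u \<theta> = t"
proof -
  define \<alpha> where "\<alpha> = arccos t - arccos \<xi>"
  have a: "0 \<le> \<alpha>" "\<alpha> \<le> pi" unfolding \<alpha>_def
    using assms xi arccos_le_arccos[of t \<xi>] arccos_ubound[of t] arccos_lbound[of \<xi>] by auto
  have sa: "sin \<alpha> \<ge> 0" using a by (intro sin_ge_zero)
  have "cos (\<alpha> + arccos \<xi>) = t" using assms xi by (simp add: \<alpha>_def cos_arccos)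
  hence t: "\<xi> * cos \<alpha> - \<kappa> * sin \<alpha> = t" using xi by (simp add: cos_add kappa cos_arccos mult.commute)
  define v where "v = (- sin \<alpha> * cos \<theta>) *\<^sub>R m' + (- sin \<alpha> * sin \<theta>) *\<^sub>R n + cos \<alpha> *\<^sub>R m"
  have v: "v \<bullet> m' = - sin \<alpha> * cos \<theta>" "v \<bullet> n = - sin \<alpha> * sin \<theta>" "v \<bullet> m = cos \<alpha>"
    by (simp_all add: v_def inner_add_left inner_diff_left frame_inner)
  have sq: "(v \<bullet> m')\<^sup>2 + (v \<bullet> n)\<^sup>2 = (sin \<alpha>)\<^sup>2"
  proof -
    have "(v \<bullet> m')\<^sup>2 + (v \<bullet> n)\<^sup>2 = (sin \<alpha>)\<^sup>2 * ((cos \<theta>)\<^sup>2 + (sin \<theta>)\<^sup>2)"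
      unfolding v by algebra
    thus ?thesis by simp
  qed
  have "(norm v)\<^sup>2 = 1\<^sup>2" by (simp add: frame_norm sq v(3))
  hence "norm v = 1" by (simp only: power2_eq_iff_nonneg norm_ge_zero zero_le_one)
  moreover have "axis_dist m v = sin \<alpha>" unfolding axis_dist_frame sq using sa by simp
  hence "S v = t" using t by (simp add: S_frame v)
  moreover have "v \<bullet> u \<theta> = \<xi> * cos \<alpha> - \<kappa> * sin \<alpha> * ((cos \<theta>)\<^sup>2 + (sin \<theta>)\<^sup>2)"
    unfolding inner_u v by (simp only: power2_eq_square) algebra
  hence "v \<bullet> u \<theta> = t" using t by simp
  ultimately show ?thesis using that by blast
qed

lemma S_scale: "r \<ge> 0 \<Longrightarrow> S (r *\<^sub>R y) = r * S y"
proof -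
  assume r: "r \<ge> 0"
  have "axis_dist m (r *\<^sub>R y) = sqrt (r\<^sup>2 * ((norm y)\<^sup>2 - (y \<bullet> m)\<^sup>2))"
    by (simp add: axis_dist_def power_mult_distrib right_diff_distrib)
  also have "\<dots> = r * axis_dist m y" using r by (simp only: real_sqrt_mult real_sqrt_abs abs_of_nonneg axis_dist_def)
  finally show ?thesis by (simp add: S_frame algebra_simps)
qed

lemma continuous_on_S: "continuous_on A S"
  unfolding far_cos_def axis_dist_def by (intro continuous_intros)

text \<open>
  As a minimum of linear functions \<open>S\<close> is concave, so the set lies on the boundary of the convex cone
  \<open>{y. t * norm y \<le> S y}\<close>.
\<close>
lemma S_level_negligible:
  assumes "t > 0"
  shows "negligible {y. S y = t * norm y}"
proof -
  define K where "K = {y. t * norm y \<le> S y}"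
  have clK: "closed K" unfolding K_def by (intro closed_Collect_le continuous_intros continuous_on_S)
  have "convex K"
  proof (rule convexI)
    fix x y and a b :: real assume xy: "x \<in> K" "y \<in> K" and ab: "0 \<le> a" "0 \<le> b" "a + b = 1"
    obtain \<theta> where th: "(a *\<^sub>R x + b *\<^sub>R y) \<bullet> u \<theta> = S (a *\<^sub>R x + b *\<^sub>R y)" using S_attained by metis
    have "t * norm (a *\<^sub>R x + b *\<^sub>R y) \<le> t * (a * norm x + b * norm y)"
      using norm_triangle_ineq[of "a *\<^sub>R x" "b *\<^sub>R y"] ab assms by (intro mult_left_mono) auto
    also have "\<dots> = a * (t * norm x) + b * (t * norm y)" by (simp add: algebra_simps)
    also have "\<dots> \<le> a * (x \<bullet> u \<theta>) + b * (y \<bullet> u \<theta>)"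
      using xy ab S_le[of x \<theta>] S_le[of y \<theta>] by (intro add_mono mult_left_mono) (auto simp: K_def)
    also have "\<dots> = S (a *\<^sub>R x + b *\<^sub>R y)" unfolding th[symmetric] by (simp add: inner_add_left)
    finally show "a *\<^sub>R x + b *\<^sub>R y \<in> K" by (simp add: K_def)
  qed
  moreover have "{y. S y = t * norm y} \<subseteq> frontier K"
  proof
    fix y assume "y \<in> {y. S y = t * norm y}"
    hence y: "S y = t * norm y" by simp
    \<comment> \<open>Moving orthogonally to the axis and away from it increases the norm and does not increase \<open>S\<close>. The
      sign is chosen so that this also works on the axis and at the origin.\<close>
    define v where "v = (if y \<bullet> m' \<ge> 0 then m' else - m')"
    have v: "v \<bullet> m = 0" "y \<bullet> v \<ge> 0" "v \<bullet> v = 1" by (auto simp: v_def frame_inner)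
    have "y \<notin> interior K"
    proof
      assume "y \<in> interior K"
      then obtain e where e: "e > 0" "ball y e \<subseteq> K" by (auto simp: mem_interior)
      define z where "z = y + (e/2) *\<^sub>R v"
      have "norm v = 1" using v(3) by (simp add: norm_eq_1)
      hence "dist y z < e" using e(1) by (simp add: z_def dist_norm)
      hence "z \<in> K" using e by auto
      moreover have "(norm z)\<^sup>2 = (norm y)\<^sup>2 + e * (y \<bullet> v) + (e/2)\<^sup>2"
        using v(3) by (simp add: z_def power2_norm_eq_inner inner_add_left inner_add_right inner_commute[of v y])
          (simp add: power2_eq_square field_simps)
      hence nz: "(norm z)\<^sup>2 > (norm y)\<^sup>2" using v(2) e(1)
        by (smt (verit, best) mult_nonneg_nonneg zero_less_power half_gt_zero)
      hence nzy: "norm z > norm y" by (rule power2_less_imp_less) simp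
      moreover have zm: "z \<bullet> m = y \<bullet> m" using v(1) by (simp add: z_def inner_add_left)
      have "axis_dist m y \<le> axis_dist m z" unfolding axis_dist_def zm using nzy by (intro real_sqrt_le_mono) simp
      hence "\<kappa> * axis_dist m y \<le> \<kappa> * axis_dist m z" using kappa(1) by (intro mult_left_mono) auto
      hence "S z \<le> S y" unfolding S_frame zm by simp
      ultimately show False using y assms
        using mult_strict_left_mono[OF nzy assms] by (simp add: K_def)
    qed
    moreover have "y \<in> closure K" using y closure_subset[of K] by (auto simp: K_def)
    ultimately show "y \<in> frontier K" by (simp add: frontier_def)
  qed
  ultimately show ?thesis using negligible_convex_frontier negligible_subset by blast
qed

lemma axial_rotation_invariants:
  assumes "axial_rotation m A"
  shows "norm (A *v y) = norm y" "(A *v y) \<bullet> m = y \<bullet> m" "axis_dist m (A *v y) = axis_dist m y" "S (A *v y) = S y"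
proof -
  have o: "orthogonal_transformation ((*v) A)"
    using assms by (simp add: axial_rotation_def rotation_matrix_def orthogonal_transformation_matrix)
  show 1: "norm (A *v y) = norm y" using o by (rule orthogonal_transformation_norm)
  have "(A *v y) \<bullet> (A *v m) = y \<bullet> m" using o by (simp add: orthogonal_transformation_def)
  thus 2: "(A *v y) \<bullet> m = y \<bullet> m" using assms by (simp add: axial_rotation_def)
  show 3: "axis_dist m (A *v y) = axis_dist m y" by (simp add: axis_dist_def 1 2)
  show "S (A *v y) = S y" by (simp add: S_frame 2 3)
qed

end

section \<open>Rotationally symmetric refractors\<close>

lemma interior_frontier_closed:
  fixes C :: "'a::euclidean_space set"
  assumes "closed C"
  shows "interior (frontier C) = {}"
proof -
  have "interior (frontier C) \<subseteq> interior C"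
    using frontier_subset_closed[OF assms] by (rule interior_mono)
  moreover have "interior (frontier C) \<subseteq> frontier C" by (rule interior_subset)
  ultimately show ?thesis by (auto simp: frontier_def)
qed

lemma frontier_frontier_closed:
  fixes C :: "'a::euclidean_space set"
  assumes "closed C"
  shows "frontier (frontier C) = frontier C"
proof -
  have "frontier (frontier C) = closure (frontier C) - interior (frontier C)" by (rule frontier_def)
  thus ?thesis by (simp only: interior_frontier_closed[OF assms] closure_closed[OF frontier_closed] Diff_empty)
qed

text \<open>
  The set bounded by the refractor is met by a ray, if at all, in a half line, so this criterion finds its points
  without any uniformity over the possibly infinite family of hyperboloids.
\<close>
lemma frontier_ray_exit:
  fixes z :: "'a::euclidean_space"
  assumes "z \<in> C" and "\<And>r. 0 < r \<Longrightarrow> r < 1 \<Longrightarrow> r *\<^sub>R z \<notin> C"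
  shows "z \<in> frontier C"
proof -
  have "z \<notin> interior C"
  proof
    assume "z \<in> interior C"
    then obtain e where e: "e > 0" "ball z e \<subseteq> C" by (auto simp: mem_interior)
    define r where "r = max (1/2) (1 - e / (2 * norm z + 1))"
    have k: "2 * norm z + 1 > 0" using norm_ge_zero[of z] by linarith
    have r: "0 < r" "r < 1" using e k by (auto simp: r_def)
    have "z - r *\<^sub>R z = (1 - r) *\<^sub>R z" by (simp add: scaleR_diff_left)
    hence "dist z (r *\<^sub>R z) = (1 - r) * norm z" using r by (simp add: dist_norm)
    also have "\<dots> \<le> e / (2 * norm z + 1) * norm z" by (intro mult_right_mono) (auto simp: r_def)
    also have "\<dots> < e" using e k by (simp add: field_simps) (smt (verit) mult_nonneg_nonneg norm_ge_zero)
    finally have "r *\<^sub>R z \<in> C" using e by auto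
    thus False using assms(2)[OF r] by simp
  qed
  thus ?thesis using assms(1) closure_subset[of C] by (auto simp: frontier_def)
qed

context cone_frame
begin

lemma sgn_cone_point: "d > 0 \<Longrightarrow> sgn (d *\<^sub>R u \<theta>) = u \<theta>"
  using norm_u[of \<theta>] by (simp add: sgn_div_norm)

lemma ray_mem:
  assumes "\<epsilon> > 1" "d > 0" "r > 0" "norm v = 1"
  shows "r *\<^sub>R v \<in> hyperboloid_body \<epsilon> (d *\<^sub>R u \<theta>) \<longleftrightarrow> 1 \<le> r * recip_radius \<epsilon> d (v \<bullet> u \<theta>)"
    and "r *\<^sub>R v \<in> hyperboloid \<epsilon> (d *\<^sub>R u \<theta>) \<longleftrightarrow> 1 = r * recip_radius \<epsilon> d (v \<bullet> u \<theta>)"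
proof -
  have u0: "d *\<^sub>R u \<theta> \<noteq> 0" using norm_u[of \<theta>] assms(2) by auto
  have e2: "\<epsilon>\<^sup>2 - 1 > 0" using assms(1) by simp
  define k where "k = d * (\<epsilon>\<^sup>2 - 1) / (2 * \<epsilon>)"
  have k: "k > 0" unfolding k_def using assms e2 by simp
  have nu: "norm (d *\<^sub>R u \<theta>) * (\<epsilon>\<^sup>2 - 1) / (2 * \<epsilon>) = k" using assms by (simp add: norm_u k_def)
  have f: "\<epsilon> * (r *\<^sub>R v \<bullet> sgn (d *\<^sub>R u \<theta>)) - norm (r *\<^sub>R v) = r * recip_radius \<epsilon> d (v \<bullet> u \<theta>) * k"
  proof -
    have "recip_radius \<epsilon> d (v \<bullet> u \<theta>) * k = \<epsilon> * (v \<bullet> u \<theta>) - 1"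
    proof -
      have "\<epsilon>\<^sup>2 \<noteq> 1" using e2 by linarith
      moreover have "\<epsilon> \<noteq> 0" "d \<noteq> 0" using assms(1,2) by auto
      moreover note e2
      ultimately show ?thesis unfolding k_def recip_radius_def by simp
    qed
    moreover have "\<epsilon> * (r *\<^sub>R v \<bullet> sgn (d *\<^sub>R u \<theta>)) - norm (r *\<^sub>R v) = r * (\<epsilon> * (v \<bullet> u \<theta>) - 1)"
      using assms sgn_cone_point[OF assms(2)] by (simp add: algebra_simps)
    ultimately show ?thesis by (simp add: mult.assoc)
  qed
  show "r *\<^sub>R v \<in> hyperboloid_body \<epsilon> (d *\<^sub>R u \<theta>) \<longleftrightarrow> 1 \<le> r * recip_radius \<epsilon> d (v \<bullet> u \<theta>)"
    unfolding hyperboloid_body_eq(2)[OF assms(1) u0] mem_Collect_eq f nu using k by simp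
  show "r *\<^sub>R v \<in> hyperboloid \<epsilon> (d *\<^sub>R u \<theta>) \<longleftrightarrow> 1 = r * recip_radius \<epsilon> d (v \<bullet> u \<theta>)"
    unfolding hyperboloid_eq[OF assms(1) u0] mem_Collect_eq f nu using k by auto
qed

text \<open>
  All bodies with foci on one circle of the cone impose together a single condition, the one of the focus
  opposite to \<open>y\<close>.
\<close>
lemma body_conv_S:
  assumes "\<epsilon> > 1" "d > 0"
  shows "(\<forall>\<theta>\<in>{0..<2*pi}. y \<in> hyperboloid_body \<epsilon> (d *\<^sub>R u \<theta>)) \<longleftrightarrow>
           d * (\<epsilon>\<^sup>2 - 1) / (2 * \<epsilon>) \<le> \<epsilon> * S y - norm y"
proof -
  have mem: "y \<in> hyperboloid_body \<epsilon> (d *\<^sub>R u \<theta>) \<longleftrightarrow> d * (\<epsilon>\<^sup>2 - 1) / (2 * \<epsilon>) \<le> \<epsilon> * (y \<bullet> u \<theta>) - norm y" for \<theta>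
  proof -
    have u0: "d *\<^sub>R u \<theta> \<noteq> 0" using norm_u[of \<theta>] assms(2) by auto
    show ?thesis unfolding hyperboloid_body_eq(2)[OF assms(1) u0] using assms
      by (simp add: norm_u sgn_cone_point del: sgn_scaleR)
  qed
  obtain \<theta>\<^sub>0 where t0: "\<theta>\<^sub>0 \<in> {0..<2*pi}" "y \<bullet> u \<theta>\<^sub>0 = S y" by (rule S_attained)
  have "\<epsilon> * S y \<le> \<epsilon> * (y \<bullet> u \<theta>)" for \<theta> using S_le[of y \<theta>] assms by (intro mult_left_mono) auto
  thus ?thesis unfolding mem using t0 by (smt (verit, best))
qed

end

text \<open>
  The outcome of \<open>envelope_exists\<close>, with \<open>s0\<close> the bound that defines the aperture and \<open>\<xi>\<close> the value of \<open>far_cos\<close>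
  on the axis.
\<close>
locale cone_refractor = cone_frame +
  fixes Q :: "real set" and D p e :: "real \<Rightarrow> real" and s0 :: real
  assumes Q: "\<And>d. d \<in> Q \<Longrightarrow> 0 < d" and s0: "0 < s0" "s0 < \<xi>"
    and D: "\<And>s. D s \<in> Q"
    and e: "\<And>d. d \<in> Q \<Longrightarrow> 1 < e d"
    and p_pos: "\<And>s. s \<in> {s0..\<xi>} \<Longrightarrow> 0 < p s"
    and p_le: "\<And>d s. d \<in> Q \<Longrightarrow> s \<in> {s0..\<xi>} \<Longrightarrow> p s \<le> recip_radius (e d) d s"
    and p_eq: "\<And>s. s \<in> {s0..\<xi>} \<Longrightarrow> p s = recip_radius (e (D s)) (D s) s"
    and p_unique: "\<And>s d c. s \<in> {s0<..<\<xi>} \<Longrightarrow> isCont D s \<Longrightarrow> 0 < d \<Longrightarrow> 1 < c \<Longrightarrow>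
           (\<And>t. t \<in> {s0..\<xi>} \<Longrightarrow> p t \<le> recip_radius c d t) \<Longrightarrow> p s = recip_radius c d s \<Longrightarrow> d = D s"
begin

abbreviation "T \<equiv> cone_target m m' \<xi> Q"

definition C :: "(real^3) set" where "C = (\<Inter>x\<in>T. hyperboloid_body (e (norm x)) x)"

lemma mem_T: "x \<in> T \<longleftrightarrow> (\<exists>d\<in>Q. \<exists>\<theta>\<in>{0..<2*pi}. x = d *\<^sub>R u \<theta>)"
proof -
  have "x \<in> T \<longleftrightarrow> (\<exists>d\<in>Q. \<exists>\<theta>\<in>{0..<2*pi}. x = cone_point m m' \<xi> (d, \<theta>))"
    unfolding cone_target_def by blast
  thus ?thesis by (simp only: cone_point_u)
qed

lemma mem_C: "y \<in> C \<longleftrightarrow> (\<forall>d\<in>Q. d * ((e d)\<^sup>2 - 1) / (2 * e d) \<le> e d * S y - norm y)"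
proof -
  have "y \<in> C \<longleftrightarrow> (\<forall>d\<in>Q. \<forall>\<theta>\<in>{0..<2*pi}. y \<in> hyperboloid_body (e (norm (d *\<^sub>R u \<theta>))) (d *\<^sub>R u \<theta>))"
    unfolding C_def INT_iff Ball_def[of T] mem_T by blast
  also have "\<dots> \<longleftrightarrow> (\<forall>d\<in>Q. \<forall>\<theta>\<in>{0..<2*pi}. y \<in> hyperboloid_body (e d) (d *\<^sub>R u \<theta>))"
    using Q norm_u by (simp add: less_imp_le)
  also have "\<dots> \<longleftrightarrow> (\<forall>d\<in>Q. d * ((e d)\<^sup>2 - 1) / (2 * e d) \<le> e d * S y - norm y)"
    using body_conv_S Q e by simp
  finally show ?thesis .
qed

lemma C_le_body: "d \<in> Q \<Longrightarrow> \<theta> \<in> {0..<2*pi} \<Longrightarrow> C \<subseteq> hyperboloid_body (e d) (d *\<^sub>R u \<theta>)"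
  using mem_C body_conv_S Q e by blast

lemma closed_C: "closed C"
proof -
  have "C = (\<Inter>d\<in>Q. {y. d * ((e d)\<^sup>2 - 1) / (2 * e d) \<le> e d * S y - norm y})"
    using mem_C by auto
  moreover have "closed {y. d * ((e d)\<^sup>2 - 1) / (2 * e d) \<le> e d * S y - norm y}" for d
    by (intro closed_Collect_le continuous_intros continuous_on_S)
  ultimately show ?thesis by auto
qed

lemma ray_mem_C:
  assumes "r > 0" "norm v = 1" "s0 \<le> S v"
  shows "r *\<^sub>R v \<in> C \<longleftrightarrow> 1 \<le> r * p (S v)"
proof
  have s: "S v \<in> {s0..\<xi>}" using assms S_le_xi by simp
  {
    assume "r *\<^sub>R v \<in> C"
    obtain \<theta> where t: "\<theta> \<in> {0..<2*pi}" "v \<bullet> u \<theta> = S v" by (rule S_attained)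
    have "r *\<^sub>R v \<in> hyperboloid_body (e (D (S v))) (D (S v) *\<^sub>R u \<theta>)"
      using C_le_body[OF D t(1)] \<open>r *\<^sub>R v \<in> C\<close> by blast
    thus "1 \<le> r * p (S v)" 
      unfolding ray_mem(1)[OF e[OF D] Q[OF D] assms(1,2)] t(2) by (simp add: p_eq[OF s])
  }
  {
    assume 1: "1 \<le> r * p (S v)"
    show "r *\<^sub>R v \<in> C"
      unfolding mem_C
    proof
      fix d assume d: "d \<in> Q"
      have "\<forall>\<theta>\<in>{0..<2*pi}. r *\<^sub>R v \<in> hyperboloid_body (e d) (d *\<^sub>R u \<theta>)"
      proof
        fix \<theta>
        have "p (S v) \<le> recip_radius (e d) d (S v)" by (rule p_le[OF d s])
        also have "\<dots> \<le> recip_radius (e d) d (v \<bullet> u \<theta>)"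
        proof -
          have "0 \<le> 2 * (e d)\<^sup>2 / (d * ((e d)\<^sup>2 - 1)) * (v \<bullet> u \<theta> - S v)"
            using S_le[of v \<theta>] e[OF d] Q[OF d] by (intro mult_nonneg_nonneg divide_nonneg_nonneg) auto
          thus ?thesis using recip_radius_affine[of "e d" d "v \<bullet> u \<theta>" "S v"] by linarith
        qed
        finally have "r * p (S v) \<le> r * recip_radius (e d) d (v \<bullet> u \<theta>)"
          using assms(1) by (intro mult_left_mono) auto
        thus "r *\<^sub>R v \<in> hyperboloid_body (e d) (d *\<^sub>R u \<theta>)"
          using 1 ray_mem(1)[OF e[OF d] Q[OF d] assms(1,2)] by simp
      qed
      thus "d * ((e d)\<^sup>2 - 1) / (2 * e d) \<le> e d * S (r *\<^sub>R v) - norm (r *\<^sub>R v)"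
        using body_conv_S[OF e[OF d] Q[OF d]] by blast
    qed
  }
qed

lemma on_refractor:
  assumes "norm v = 1" "s0 \<le> S v"
  shows "(1 / p (S v)) *\<^sub>R v \<in> frontier C"
proof (rule frontier_ray_exit)
  have pp: "p (S v) > 0" using assms S_le_xi by (intro p_pos) simp
  thus "(1 / p (S v)) *\<^sub>R v \<in> C" using ray_mem_C[OF _ assms, of "1 / p (S v)"] by simp
  fix r :: real assume r: "0 < r" "r < 1"
  have "(r / p (S v)) *\<^sub>R v \<notin> C" using ray_mem_C[OF _ assms, of "r / p (S v)"] r pp by simp
  thus "r *\<^sub>R (1 / p (S v)) *\<^sub>R v \<notin> C" by simp
qed

text \<open>
  A supporting hyperboloid may have any eccentricity, so the focus is identified from the geometry alone.
  Suppose that the one with focus \<open>d *\<^sub>R u \<theta>\<close> touches the refractor in the direction \<open>v\<close>. Testing it at the direction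
  with the same \<open>S\<close> but opposite to \<open>u \<theta>\<close> shows \<open>v \<bullet> u \<theta> = S v\<close>, so \<open>u \<theta>\<close> is the farthest ruling. Testing it at all
  directions opposite to \<open>u \<theta>\<close> shows that its line lies above \<open>p\<close>, and it touches \<open>p\<close> at \<open>S v\<close>, so \<open>d = D (S v)\<close>.
\<close>
lemma visible_iff:
  assumes v: "norm v = 1" and s: "S v \<in> {s0<..<\<xi>}" "isCont D (S v)" and \<omega>: "\<omega> \<subseteq> T"
  shows "v \<in> sgn ` {z \<in> frontier C. \<exists>x\<in>\<omega>. \<exists>\<epsilon>>1. supporting \<epsilon> x (frontier C) z} \<longleftrightarrow>
         D (S v) *\<^sub>R far_ray m \<xi> v \<in> \<omega>"
proof
  define R where "R = frontier C"
  define s where "s = S v"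
  have s': "s \<in> {s0..\<xi>}" "s0 \<le> s" using s by (auto simp: s_def)
  have rad: "axis_dist m v \<noteq> 0" using s s0 by (intro axis_dist_pos v) auto
  have ps: "p s > 0" by (rule p_pos[OF s'(1)])
  have RC: "R \<subseteq> C" unfolding R_def by (rule frontier_subset_closed[OF closed_C])
  {
    assume "v \<in> sgn ` {z \<in> frontier C. \<exists>x\<in>\<omega>. \<exists>\<epsilon>>1. supporting \<epsilon> x (frontier C) z}"
    then obtain z where z2: "v = sgn z" and zz: "z \<in> {z \<in> R. \<exists>x\<in>\<omega>. \<exists>\<epsilon>>1. supporting \<epsilon> x R z}"
      unfolding R_def by (rule imageE)
    from zz obtain x \<epsilon> where zR: "z \<in> R" and x: "x \<in> \<omega>" and eps: "\<epsilon> > 1" and sup': "supporting \<epsilon> x R z"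
      by blast
    have sup: "R \<subseteq> hyperboloid_body \<epsilon> x" "z \<in> hyperboloid \<epsilon> x"
      using sup' by (simp_all add: supporting_def)
    note z = zR z2
    obtain d \<theta> where d: "d \<in> Q" "\<theta> \<in> {0..<2*pi}" and xd: "x = d *\<^sub>R u \<theta>" using x \<omega> mem_T by blast
    have d0: "d > 0" by (rule Q[OF d(1)])
    define r where "r = norm z"
    have "z \<noteq> 0" using z(2) v by auto
    hence r: "r > 0" and zr: "z = r *\<^sub>R v" by (auto simp: r_def z(2) sgn_div_norm)
    define \<rho> where "\<rho> = recip_radius \<epsilon> d"
    have touch: "1 = r * \<rho> (v \<bullet> u \<theta>)"
      using sup(2) ray_mem(2)[OF eps d0 r v] by (simp add: zr xd \<rho>_def)
    have above: "p (S w) \<le> \<rho> (w \<bullet> u \<theta>)" if w: "norm w = 1" "s0 \<le> S w" for w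
    proof -
      have pw: "p (S w) > 0" using w S_le_xi by (intro p_pos) simp
      have "(1 / p (S w)) *\<^sub>R w \<in> hyperboloid_body \<epsilon> (d *\<^sub>R u \<theta>)"
        using on_refractor[OF w] sup(1) by (auto simp: R_def xd)
      hence "1 \<le> (1 / p (S w)) * \<rho> (w \<bullet> u \<theta>)"
        using ray_mem(1)[OF eps d0 _ w(1), of "1 / p (S w)"] pw by (simp add: \<rho>_def)
      thus ?thesis using pw by (simp add: field_simps)
    qed
    have "r *\<^sub>R v \<in> C" using z(1) RC unfolding zr by blast
    hence "1 \<le> r * p s" using ray_mem_C[OF r v] s'(2) unfolding s_def by blast
    hence "r * \<rho> (v \<bullet> u \<theta>) \<le> r * p s" using touch by simp
    hence le: "\<rho> (v \<bullet> u \<theta>) \<le> p s" using r by simp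
    have above': "p t \<le> \<rho> t" if "t \<in> {s0..\<xi>}" for t
    proof -
      have "0 \<le> t" "t \<le> \<xi>" using that s0 by auto
      then obtain w where "norm w = 1" "S w = t" "w \<bullet> u \<theta> = t" by (rule far_point_exists)
      thus ?thesis using above[of w] that by simp
    qed
    have slope: "2 * \<epsilon>\<^sup>2 / (d * (\<epsilon>\<^sup>2 - 1)) > 0" using eps d0 by simp
    have aff: "\<rho> (v \<bullet> u \<theta>) - \<rho> s = 2 * \<epsilon>\<^sup>2 / (d * (\<epsilon>\<^sup>2 - 1)) * (v \<bullet> u \<theta> - s)"
      unfolding \<rho>_def by (rule recip_radius_affine)
    have "2 * \<epsilon>\<^sup>2 / (d * (\<epsilon>\<^sup>2 - 1)) * (v \<bullet> u \<theta> - s) \<le> 0"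
      using aff le above'[OF s'(1)] by linarith
    hence "v \<bullet> u \<theta> - s \<le> 0" using slope by (metis mult_le_0_iff less_le_not_le)
    hence "v \<bullet> u \<theta> \<le> s" by simp
    hence vs: "v \<bullet> u \<theta> = s" using S_le[of v \<theta>] by (simp add: s_def)
    hence "u \<theta> = far_ray m \<xi> v" by (intro u_eq_far_ray[OF rad]) (simp add: s_def)
    moreover have "d = D s"
    proof (rule p_unique[OF _ _ d0 eps])
      show "s \<in> {s0<..<\<xi>}" "isCont D s" using s by (simp_all add: s_def)
      show "p s = recip_radius \<epsilon> d s" using le above'[OF s'(1)] vs by (simp add: \<rho>_def)
    qed (use above' in \<open>simp add: \<rho>_def\<close>)
    ultimately show "D (S v) *\<^sub>R far_ray m \<xi> v \<in> \<omega>" using x xd by (simp add: s_def)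
  }
  {
    assume \<Phi>: "D (S v) *\<^sub>R far_ray m \<xi> v \<in> \<omega>"
    obtain \<theta> where t: "\<theta> \<in> {0..<2*pi}" "far_ray m \<xi> v = u \<theta>" "v \<bullet> u \<theta> = S v"
      using far_ray_cases[OF rad] by metis
    define x where "x = D s *\<^sub>R u \<theta>"
    define z where "z = (1 / p s) *\<^sub>R v"
    have zR: "z \<in> R" using on_refractor[OF v] s' by (simp add: z_def R_def s_def)
    have "R \<subseteq> hyperboloid_body (e (D s)) x" unfolding x_def using RC C_le_body[OF D t(1)] by blast
    moreover have "z \<in> hyperboloid (e (D s)) x"
      unfolding x_def z_def using ray_mem(2)[OF e[OF D] Q[OF D] _ v, of "1 / p s"] ps t(3) p_eq[OF s'(1)]
      by (simp add: s_def)
    ultimately have "supporting (e (D s)) x R z"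
      using zR unfolding supporting_def R_def by (simp add: frontier_frontier_closed[OF closed_C])
    moreover have "sgn z = v" using v ps by (simp add: z_def sgn_div_norm)
    moreover have "x \<in> \<omega>" using \<Phi> t by (simp add: x_def s_def)
    ultimately show "v \<in> sgn ` {z \<in> frontier C. \<exists>x\<in>\<omega>. \<exists>\<epsilon>>1. supporting \<epsilon> x (frontier C) z}"
      using zR e[OF D] unfolding R_def by blast
  }
qed

lemma refractor_symmetric:
  assumes A: "axial_rotation m A"
  shows "(*v) A ` frontier C = frontier C"
proof -
  have o: "orthogonal_transformation ((*v) A)"
    using A by (simp add: axial_rotation_def rotation_matrix_def orthogonal_transformation_matrix)
  have lin: "linear ((*v) A)" and inj: "inj ((*v) A)" and bij: "bij ((*v) A)"
    using o orthogonal_transformation_linear orthogonal_transformation_inj orthogonal_transformation_bij by blast+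
  have mem: "A *v y \<in> C \<longleftrightarrow> y \<in> C" for y
    unfolding mem_C using axial_rotation_invariants[OF A] by simp
  have "(*v) A ` C = C"
  proof
    show "(*v) A ` C \<subseteq> C" using mem by auto
    show "C \<subseteq> (*v) A ` C"
    proof
      fix y assume y: "y \<in> C"
      obtain x where "y = A *v x" using bij by (metis bij_pointE)
      thus "y \<in> (*v) A ` C" using y mem by blast
    qed
  qed
  moreover have "(*v) A ` frontier C = (*v) A ` closure C - (*v) A ` interior C"
    unfolding frontier_def using inj by (rule image_set_diff)
  ultimately show ?thesis
    using closure_injective_linear_image[OF lin inj, of C] interior_injective_linear_image[OF lin inj, of C]
    by (simp add: frontier_def)
qed

end

section \<open>The mass distribution on the sphere\<close>

text \<open>
  The surface measure before completion. Invariance and null sets are established here and carried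
  over to \<open>sphere_measure\<close>.
\<close>
definition sphere_borel_measure :: "(real^3) measure" where
  "sphere_borel_measure = scale_measure 3
     (distr (restrict_space lborel (cball 0 1 - {0})) (restrict_space borel (sphere 0 1)) sgn)"

lemma sphere_measure_completion: "sphere_measure = completion sphere_borel_measure"
  by (simp add: sphere_measure_def sphere_borel_measure_def)

lemma space_sphere_borel_measure [simp]: "space sphere_borel_measure = sphere 0 1"
  by (simp add: sphere_borel_measure_def space_restrict_space space_scale_measure)

lemma sets_sphere_borel_measure:
  "sets sphere_borel_measure = sets (restrict_space borel (sphere 0 1))"
  by (simp add: sphere_borel_measure_def)

lemma sets_sphere_borel_measure_iff:
  "X \<in> sets sphere_borel_measure \<longleftrightarrow> X \<subseteq> sphere 0 1 \<and> X \<in> sets borel"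
  unfolding sets_sphere_borel_measure by (subst sets_restrict_space_iff) auto

lemma borel_measurable_sgn_vec [measurable]: "(sgn :: real^3 \<Rightarrow> real^3) \<in> borel_measurable borel"
proof -
  have "(sgn :: real^3 \<Rightarrow> real^3) = (\<lambda>x. inverse (norm x) *\<^sub>R x)"
    by (simp add: sgn_div_norm fun_eq_iff divide_inverse_commute)
  thus ?thesis by simp
qed

lemma sgn_measurable_sphere:
  "(sgn :: real^3 \<Rightarrow> real^3) \<in> restrict_space lborel (cball 0 1 - {0}) \<rightarrow>\<^sub>M restrict_space borel (sphere 0 1)"
  by (intro measurable_restrict_space2 measurable_restrict_space1)
    (auto simp: space_restrict_space norm_sgn)

lemma emeasure_sphere_borel_measure:
  assumes "X \<in> sets sphere_borel_measure"
  shows "emeasure sphere_borel_measure X = 3 * emeasure lborel {y \<in> cball 0 1 - {0}. sgn y \<in> X}"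
proof -
  have X: "X \<in> sets (restrict_space borel (sphere 0 1))" using assms by (simp add: sets_sphere_borel_measure)
  have "sgn -` X \<inter> space (restrict_space lborel (cball 0 1 - {0})) = {y \<in> cball 0 1 - {0::real^3}. sgn y \<in> X}"
    by (auto simp: space_restrict_space)
  thus ?thesis
    unfolding sphere_borel_measure_def emeasure_scale_measure emeasure_distr[OF sgn_measurable_sphere X]
    by (simp add: emeasure_restrict_space subset_iff)
qed

lemma cone_set_measurable:
  assumes "X \<in> sets sphere_borel_measure"
  shows "{y \<in> cball 0 1 - {0}. sgn y \<in> X} \<in> sets (lborel :: (real^3) measure)"
proof -
  have "{y \<in> cball 0 1 - {0::real^3}. sgn y \<in> X} = (sgn -` X \<inter> space borel) \<inter> (cball 0 1 - {0})" by auto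
  thus ?thesis using assms measurable_sets[OF borel_measurable_sgn_vec, of X]
    by (simp add: sets_sphere_borel_measure_iff)
qed

lemma null_sets_sphere_borel_measure:
  assumes "X \<in> sets sphere_borel_measure" "negligible {y. sgn y \<in> X}"
  shows "X \<in> null_sets sphere_borel_measure"
proof -
  have "negligible {y \<in> cball 0 1 - {0}. sgn y \<in> X}"
    by (rule negligible_subset[OF assms(2)]) auto
  hence "{y \<in> cball 0 1 - {0}. sgn y \<in> X} \<in> null_sets lborel"
    using cone_set_measurable[OF assms(1)] by (simp add: negligible_iff_null_sets null_sets_completion_iff)
  thus ?thesis using assms(1) by (simp add: null_sets_def emeasure_sphere_borel_measure)
qed

text \<open>
  Radial projection commutes with orthogonal maps, and these preserve the volume of the solid cone that
  defines the surface measure.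
\<close>
lemma distr_sphere_borel_measure_orthogonal:
  fixes A :: "real^3^3"
  assumes "orthogonal_matrix A"
  shows "(\<lambda>v. A *v v) \<in> sphere_borel_measure \<rightarrow>\<^sub>M sphere_borel_measure"
    and "distr sphere_borel_measure sphere_borel_measure (\<lambda>v. A *v v) = sphere_borel_measure"
proof -
  have o: "orthogonal_transformation (\<lambda>v. A *v v)"
    using assms by (simp add: orthogonal_transformation_matrix)
  have nrm: "norm (A *v v) = norm v" for v using o by (rule orthogonal_transformation_norm)
  have lin: "linear (\<lambda>v. A *v v)" using o by (rule orthogonal_transformation_linear)
  have cont: "(\<lambda>v. A *v v) \<in> borel_measurable borel"
    by (intro borel_measurable_continuous_onI linear_continuous_on linear_conv_bounded_linear[THEN iffD1] lin)
  show m: "(\<lambda>v. A *v v) \<in> sphere_borel_measure \<rightarrow>\<^sub>M sphere_borel_measure"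
    unfolding measurable_cong_sets[OF sets_sphere_borel_measure sets_sphere_borel_measure]
    by (intro measurable_restrict_space2 measurable_restrict_space1 cont)
      (auto simp: space_restrict_space nrm)
  show "distr sphere_borel_measure sphere_borel_measure (\<lambda>v. A *v v) = sphere_borel_measure"
  proof (rule measure_eqI)
    fix X assume "X \<in> sets (distr sphere_borel_measure sphere_borel_measure (\<lambda>v. A *v v))"
    hence X: "X \<in> sets sphere_borel_measure" by simp
    define Y where "Y = (\<lambda>v. A *v v) -` X \<inter> sphere 0 1"
    have Y: "Y \<in> sets sphere_borel_measure" using measurable_sets[OF m X] by (simp add: Y_def)
    define CX where "CX = {y \<in> cball 0 1 - {0}. sgn y \<in> X}"
    define CY where "CY = {y \<in> cball 0 1 - {0}. sgn y \<in> Y}"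
    have sgnA: "sgn (A *v y) = A *v sgn y" for y
      using lin by (simp add: sgn_div_norm nrm linear_cmul matrix_vector_mult_scaleR)
    have A0: "A *v y = 0 \<longleftrightarrow> y = 0" for y using nrm[of y] by (metis norm_eq_zero)
    have img: "(\<lambda>v. A *v v) ` CY = CX"
    proof
      show "(\<lambda>v. A *v v) ` CY \<subseteq> CX" by (auto simp: CX_def CY_def Y_def nrm sgnA A0)
      show "CX \<subseteq> (\<lambda>v. A *v v) ` CY"
      proof
        fix y assume y: "y \<in> CX"
        obtain x where x: "y = A *v x" using orthogonal_transformation_surj[OF o] by (metis surjD)
        have "x \<in> CY" using y unfolding x by (auto simp: CX_def CY_def Y_def nrm sgnA A0 norm_sgn)
        thus "y \<in> (\<lambda>v. A *v v) ` CY" using x by blast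
      qed
    qed
    have lb: "CY \<in> sets lborel" "CX \<in> sets lborel"
      unfolding CX_def CY_def by (rule cone_set_measurable[OF Y], rule cone_set_measurable[OF X])
    have bd: "bounded CY" "bounded CX"
      by (rule bounded_subset[OF bounded_cball[of 0 1]]; auto simp: CX_def CY_def)+
    have lm: "CY \<in> lmeasurable" "CX \<in> lmeasurable"
      by (rule bounded_set_imp_lmeasurable[OF bd(1) sets_completionI_sets[OF lb(1)]],
          rule bounded_set_imp_lmeasurable[OF bd(2) sets_completionI_sets[OF lb(2)]])
    have "measure lebesgue CX = measure lebesgue CY"
      using measure_orthogonal_image[OF o lm(1)] by (simp add: img)
    hence "emeasure lebesgue CX = emeasure lebesgue CY"
      using lm by (simp add: emeasure_eq_measure2 fmeasurableD2)
    hence eq: "emeasure lborel CX = emeasure lborel CY"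
      using lb by simp
    show "emeasure (distr sphere_borel_measure sphere_borel_measure (\<lambda>v. A *v v)) X = emeasure sphere_borel_measure X"
      unfolding emeasure_distr[OF m X] using emeasure_sphere_borel_measure[OF X] emeasure_sphere_borel_measure[OF Y] eq
      by (simp add: Y_def CX_def CY_def)
  qed simp
qed

text \<open>
  The measure with density \<open>g\<close>, as a measure on the Borel sets. The function \<open>g\<close> is measurable for the completion
  only; it is replaced by a Borel version wherever a change of variables is made, which is harmless because
  rotations preserve null sets.
\<close>
lemma mass_distribution:
  assumes g: "integrable sphere_measure g" "\<forall>v\<in>sphere 0 1. g v \<ge> 0"
  obtains N :: "(real^3) measure" where "finite_measure N" "sets N = sets borel"
    and "\<And>X. X \<in> sets borel \<Longrightarrow> emeasure N X = (\<integral>\<^sup>+v. ennreal (g v) * indicator X v \<partial>sphere_borel_measure)"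
    and "\<And>X V. X \<in> sets borel \<Longrightarrow> V \<in> sets sphere_measure \<Longrightarrow>
           (AE v in sphere_borel_measure. v \<in> V \<longleftrightarrow> v \<in> X) \<Longrightarrow> mu g V = measure N X"
    and "\<And>A X. \<forall>v\<in>sphere 0 1. g (A *v v) = g v \<Longrightarrow> orthogonal_matrix A \<Longrightarrow> X \<in> sets borel \<Longrightarrow>
           emeasure N {v. A *v v \<in> X} = emeasure N X"
proof -
  define \<sigma> where "\<sigma> = sphere_borel_measure"
  have sp: "space \<sigma> = sphere 0 1" by (simp add: \<sigma>_def)
  have sm: "sphere_measure = completion \<sigma>" by (simp add: \<sigma>_def sphere_measure_completion)
  have spm: "space sphere_measure = sphere 0 1" by (simp add: sm sp)
  have gm: "g \<in> borel_measurable (completion \<sigma>)" using g(1) by (simp add: sm)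
  have idm0: "(\<lambda>v. v) \<in> \<sigma> \<rightarrow>\<^sub>M borel"
    unfolding \<sigma>_def measurable_cong_sets[OF sets_sphere_borel_measure refl]
    by (intro measurable_restrict_space1) simp
  hence idm: "(\<lambda>v. v) \<in> completion \<sigma> \<rightarrow>\<^sub>M borel" by (rule measurable_completion)
  have egm: "(\<lambda>v. ennreal (g v)) \<in> borel_measurable (completion \<sigma>)" using gm by simp
  define N where "N = distr (density (completion \<sigma>) (\<lambda>v. ennreal (g v))) borel (\<lambda>v. v)"
  have idd: "(\<lambda>v. v) \<in> density (completion \<sigma>) (\<lambda>v. ennreal (g v)) \<rightarrow>\<^sub>M borel"
    using idm by simp
  have emN: "emeasure N X = (\<integral>\<^sup>+v. ennreal (g v) * indicator X v \<partial>\<sigma>)" if X: "X \<in> sets borel" for X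
  proof -
    have s: "X \<inter> sphere 0 1 \<in> sets (completion \<sigma>)" using measurable_sets[OF idm X] by (simp add: sp)
    have "emeasure N X = emeasure (density (completion \<sigma>) (\<lambda>v. ennreal (g v))) (X \<inter> sphere 0 1)"
      unfolding N_def by (subst emeasure_distr[OF idd X]) (simp add: sp)
    also have "\<dots> = (\<integral>\<^sup>+v. ennreal (g v) * indicator (X \<inter> sphere 0 1) v \<partial>completion \<sigma>)"
      by (rule emeasure_density[OF egm s])
    also have "\<dots> = (\<integral>\<^sup>+v. ennreal (g v) * indicator X v \<partial>completion \<sigma>)"
      by (rule nn_integral_cong) (auto simp: sp indicator_def)
    finally show ?thesis by (simp add: nn_integral_completion)
  qed
  have fin: "finite_measure N"
  proof
    have "(\<integral>\<^sup>+v. ennreal (g v) \<partial>completion \<sigma>) < \<infinity>"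
    proof -
      have "(\<integral>\<^sup>+v. ennreal (g v) \<partial>completion \<sigma>) = (\<integral>\<^sup>+v. ennreal (norm (g v)) \<partial>completion \<sigma>)"
        by (rule nn_integral_cong) (use g(2) in \<open>auto simp: sp\<close>)
      thus ?thesis using g(1) by (simp add: sm integrable_iff_bounded)
    qed
    moreover have "emeasure N UNIV = (\<integral>\<^sup>+v. ennreal (g v) \<partial>completion \<sigma>)"
      by (subst emN) (simp_all add: nn_integral_completion)
    moreover have "space N = UNIV" by (simp add: N_def)
    ultimately show "emeasure N (space N) \<noteq> \<infinity>" by simp
  qed
  interpret finite_measure N by (rule fin)
  have muN: "mu g V = measure N X"
    if X: "X \<in> sets borel" and V: "V \<in> sets sphere_measure" and ae: "AE v in sphere_borel_measure. v \<in> V \<longleftrightarrow> v \<in> X" for X V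
  proof -
    have Vm: "V \<in> sets (completion \<sigma>)" using V by (simp add: sm)
    have "mu g V = (LINT v|completion \<sigma>. indicator V v * g v)"
      by (simp add: mu_def set_lebesgue_integral_def sm)
    also have "\<dots> = enn2real (\<integral>\<^sup>+v. ennreal (indicator V v * g v) \<partial>completion \<sigma>)"
      by (intro integral_eq_nn_integral borel_measurable_times borel_measurable_indicator Vm gm AE_I2)
        (use g(2) in \<open>auto simp: sp\<close>)
    also have "(\<integral>\<^sup>+v. ennreal (indicator V v * g v) \<partial>completion \<sigma>) = (\<integral>\<^sup>+v. ennreal (g v) * indicator X v \<partial>completion \<sigma>)"
    proof (rule nn_integral_cong_AE)
      have "AE v in completion \<sigma>. v \<in> V \<longleftrightarrow> v \<in> X" by (rule AE_completion[OF ae[folded \<sigma>_def]])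
      thus "AE v in completion \<sigma>. ennreal (indicator V v * g v) = ennreal (g v) * indicator X v"
        by eventually_elim (auto simp: indicator_def)
    qed
    also have "\<dots> = emeasure N X" using emN[OF X] by (simp add: nn_integral_completion)
    finally show ?thesis by (simp add: measure_def)
  qed
  have inv: "emeasure N {v. A *v v \<in> X} = emeasure N X"
    if gA: "\<forall>v\<in>sphere 0 1. g (A *v v) = g v" and A: "orthogonal_matrix A" and X: "X \<in> sets borel" for A X
  proof -
    note m = distr_sphere_borel_measure_orthogonal(1)[OF A, folded \<sigma>_def]
    note d = distr_sphere_borel_measure_orthogonal(2)[OF A, folded \<sigma>_def]
    have o: "orthogonal_transformation (\<lambda>v. A *v v)"
      using A by (simp add: orthogonal_transformation_matrix)
    have lin: "linear (\<lambda>v. A *v v)" using o by (rule orthogonal_transformation_linear)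
    have cont: "(\<lambda>v. A *v v) \<in> borel_measurable borel"
      by (intro borel_measurable_continuous_onI linear_continuous_on linear_conv_bounded_linear[THEN iffD1] lin)
    have AX: "{v. A *v v \<in> X} \<in> sets borel" using measurable_sets[OF cont X] by (simp add: vimage_def)
    obtain g' where g': "g' \<in> borel_measurable \<sigma>" "AE v in \<sigma>. ennreal (g v) = g' v"
      using completion_ex_borel_measurable[OF egm] by blast
    have AEg: "AE v in \<sigma>. ennreal (g (A *v v)) = g' (A *v v)"
    proof (rule AE_distrD[OF m])
      show "AE v in distr \<sigma> \<sigma> (\<lambda>v. A *v v). ennreal (g v) = g' v" unfolding d by (rule g'(2))
    qed
    have iX: "(indicator X :: _ \<Rightarrow> ennreal) \<in> borel_measurable \<sigma>"
      using measurable_compose[OF idm0 borel_measurable_indicator[OF X]] by simp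
    have "emeasure N {v. A *v v \<in> X} = (\<integral>\<^sup>+v. ennreal (g v) * indicator {v. A *v v \<in> X} v \<partial>\<sigma>)"
      by (rule emN[OF AX])
    also have "\<dots> = (\<integral>\<^sup>+v. ennreal (g (A *v v)) * indicator X (A *v v) \<partial>\<sigma>)"
      by (rule nn_integral_cong) (use gA in \<open>auto simp: sp indicator_def\<close>)
    also have "\<dots> = (\<integral>\<^sup>+v. g' (A *v v) * indicator X (A *v v) \<partial>\<sigma>)"
      by (rule nn_integral_cong_AE) (use AEg in eventually_elim, simp)
    also have "\<dots> = (\<integral>\<^sup>+v. g' v * indicator X v \<partial>distr \<sigma> \<sigma> (\<lambda>v. A *v v))"
      by (rule nn_integral_distr[symmetric, OF m]) (use g'(1) iX in simp)
    also have "\<dots> = (\<integral>\<^sup>+v. ennreal (g v) * indicator X v \<partial>\<sigma>)"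
      unfolding d by (rule nn_integral_cong_AE) (use g'(2) in eventually_elim, simp)
    also have "\<dots> = emeasure N X" by (rule emN[OF X, symmetric])
    finally show ?thesis .
  qed
  show ?thesis
    by (rule that[OF fin _ _ muN inv]) (simp_all add: N_def[symmetric] emN[unfolded \<sigma>_def], simp add: N_def)
qed

section \<open>Averaging over rotations about the axis\<close>

text \<open>
  The two ends that stick out on either side differ by one period and are exchanged.
\<close>
lemma nn_integral_period_shift:
  fixes f :: "real \<Rightarrow> ennreal"
  assumes f[measurable]: "f \<in> borel_measurable borel" and per: "\<And>x. f (x + P) = f x"
    and c: "0 \<le> c" "c \<le> P"
  shows "(\<integral>\<^sup>+x. f (c + x) * indicator {0..<P} x \<partial>lborel) = (\<integral>\<^sup>+x. f x * indicator {0..<P} x \<partial>lborel)"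
proof -
  have "(\<integral>\<^sup>+x. f x * indicator {0..<P} x \<partial>lborel)
      = (\<integral>\<^sup>+x. f x * indicator {0..<c} x + f x * indicator {c..<P} x \<partial>lborel)"
    using c by (intro nn_integral_cong) (auto simp: indicator_def)
  also have "\<dots> = (\<integral>\<^sup>+x. f x * indicator {0..<c} x \<partial>lborel) + (\<integral>\<^sup>+x. f x * indicator {c..<P} x \<partial>lborel)"
    by (rule nn_integral_add) auto
  also have "(\<integral>\<^sup>+x. f x * indicator {0..<c} x \<partial>lborel)
      = (\<integral>\<^sup>+x. f (c - P + 1 * x) * indicator {0..<c} (c - P + 1 * x) \<partial>lborel)"
    using nn_integral_real_affine[of "\<lambda>x. f x * indicator {0..<c} x" 1 "c - P"] by simp
  also have "\<dots> = (\<integral>\<^sup>+x. f (c + x) * indicator {P - c..<P} x \<partial>lborel)"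
  proof (rule nn_integral_cong)
    fix x :: real
    have "f (c - P + 1 * x) = f (c + x)" using per[of "c - P + x"] by (simp add: algebra_simps)
    thus "f (c - P + 1 * x) * indicator {0..<c} (c - P + 1 * x) = f (c + x) * indicator {P - c..<P} x"
      by (auto simp: indicator_def)
  qed
  also have "(\<integral>\<^sup>+x. f x * indicator {c..<P} x \<partial>lborel)
      = (\<integral>\<^sup>+x. f (c + 1 * x) * indicator {c..<P} (c + 1 * x) \<partial>lborel)"
    using nn_integral_real_affine[of "\<lambda>x. f x * indicator {c..<P} x" 1 c] by simp
  also have "\<dots> = (\<integral>\<^sup>+x. f (c + x) * indicator {0..<P - c} x \<partial>lborel)"
    by (rule nn_integral_cong) (auto simp: indicator_def)
  also have "(\<integral>\<^sup>+x. f (c + x) * indicator {P - c..<P} x \<partial>lborel) + (\<integral>\<^sup>+x. f (c + x) * indicator {0..<P - c} x \<partial>lborel)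
     = (\<integral>\<^sup>+x. f (c + x) * indicator {P - c..<P} x + f (c + x) * indicator {0..<P - c} x \<partial>lborel)"
    by (rule nn_integral_add[symmetric]) auto
  also have "\<dots> = (\<integral>\<^sup>+x. f (c + x) * indicator {0..<P} x \<partial>lborel)"
    using c by (intro nn_integral_cong) (auto simp: indicator_def)
  finally show ?thesis by simp
qed

context cone_frame
begin

text \<open>
  The angular measure of the part of \<open>\<omega>\<close> on the circle of the cone at distance \<open>d\<close>.
\<close>
definition circle_mass :: "(real^3) set \<Rightarrow> real \<Rightarrow> ennreal" where
  "circle_mass \<omega> d = (\<integral>\<^sup>+\<theta>. indicator \<omega> (d *\<^sub>R u \<theta>) * indicator {0..<2*pi} \<theta> \<partial>lborel)"

definition axial_rot :: "real \<Rightarrow> real^3 \<Rightarrow> real^3" where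
  "axial_rot \<psi> y = (y \<bullet> m) *\<^sub>R m + ((y \<bullet> m') * cos \<psi> - (y \<bullet> n) * sin \<psi>) *\<^sub>R m'
      + ((y \<bullet> m') * sin \<psi> + (y \<bullet> n) * cos \<psi>) *\<^sub>R n"

lemma axial_rot_inner:
  "axial_rot \<psi> y \<bullet> m = y \<bullet> m"
  "axial_rot \<psi> y \<bullet> m' = (y \<bullet> m') * cos \<psi> - (y \<bullet> n) * sin \<psi>"
  "axial_rot \<psi> y \<bullet> n = (y \<bullet> m') * sin \<psi> + (y \<bullet> n) * cos \<psi>"
  by (simp_all add: axial_rot_def inner_add_left frame_inner)

lemma axial_rot_linear: "linear (axial_rot \<psi>)"
  by (rule linearI) (simp_all add: axial_rot_def inner_add_left algebra_simps)

lemma axial_rot_norm: "norm (axial_rot \<psi> y) = norm y"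
proof -
  define a b c s where "a = y \<bullet> m'" and "b = y \<bullet> n" and "c = cos \<psi>" and "s = sin \<psi>"
  have "c\<^sup>2 + s\<^sup>2 = 1" by (simp add: c_def s_def)
  hence "(a * c - b * s)\<^sup>2 + (a * s + b * c)\<^sup>2 = a\<^sup>2 + b\<^sup>2" by algebra
  hence "(norm (axial_rot \<psi> y))\<^sup>2 = (norm y)\<^sup>2"
    unfolding frame_norm axial_rot_inner by (simp add: a_def b_def c_def s_def)
  thus ?thesis by (simp only: power2_eq_iff_nonneg norm_ge_zero)
qed

lemma frame_eqI: "y \<bullet> m' = z \<bullet> m' \<Longrightarrow> y \<bullet> n = z \<bullet> n \<Longrightarrow> y \<bullet> m = z \<bullet> m \<Longrightarrow> y = z"
  using frame_expand[of y] frame_expand[of z] by simp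

lemma axial_rot_add: "axial_rot \<phi> (axial_rot \<psi> y) = axial_rot (\<phi> + \<psi>) y"
  by (rule frame_eqI) (simp_all add: axial_rot_inner cos_add sin_add algebra_simps)

lemma axial_rot_matrix:
  "matrix (axial_rot \<psi>) *v y = axial_rot \<psi> y" "orthogonal_matrix (matrix (axial_rot \<psi>))"
  "axial_rotation m (matrix (axial_rot \<psi>))"
proof -
  have mv: "matrix (axial_rot \<psi>) *v y = axial_rot \<psi> y" for \<psi> y
    using fun_cong[OF matrix_vector_mul(2)[OF axial_rot_linear]] .
  show "matrix (axial_rot \<psi>) *v y = axial_rot \<psi> y" by (rule mv)
  have "orthogonal_transformation (axial_rot \<psi>)" for \<psi>
    using axial_rot_linear axial_rot_norm by (simp add: orthogonal_transformation)
  hence om: "orthogonal_matrix (matrix (axial_rot \<psi>))" for \<psi>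
    using orthogonal_transformation_matrix by blast
  show "orthogonal_matrix (matrix (axial_rot \<psi>))" by (rule om)
  \<comment> \<open>The determinant is a square, since a rotation is the square of the rotation by half the angle.\<close>
  have "matrix (axial_rot \<psi>) = matrix (axial_rot (\<psi>/2)) ** matrix (axial_rot (\<psi>/2))"
    using matrix_compose[OF axial_rot_linear axial_rot_linear, of "\<psi>/2" "\<psi>/2"]
    by (simp add: o_def axial_rot_add)
  hence "det (matrix (axial_rot \<psi>)) = (det (matrix (axial_rot (\<psi>/2))))\<^sup>2"
    by (simp add: det_mul power2_eq_square)
  hence "det (matrix (axial_rot \<psi>)) = 1"
    using det_orthogonal_matrix[OF om[of "\<psi>/2"]] by (auto simp: power2_eq_1_iff)
  hence "rotation_matrix (matrix (axial_rot \<psi>))" using om by (simp add: rotation_matrix_def)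
  moreover have "axial_rot \<psi> m = m" by (rule frame_eqI) (simp_all add: axial_rot_inner frame_inner)
  ultimately show "axial_rotation m (matrix (axial_rot \<psi>))"
    by (simp add: axial_rotation_def mv)
qed

lemma axial_rot_u: "axial_rot \<psi> (u \<theta>) = u (\<theta> + \<psi>)"
  by (rule frame_eqI)
    (simp_all add: axial_rot_inner u_frame inner_add_left frame_inner cos_add sin_add algebra_simps)

lemma far_ray_axial_rot: "far_ray m \<xi> (axial_rot \<psi> y) = axial_rot \<psi> (far_ray m \<xi> y)"
proof -
  have "axis_dist m (axial_rot \<psi> y) = axis_dist m y"
    by (simp add: axis_dist_def axial_rot_norm axial_rot_inner)
  thus ?thesis
    by (intro frame_eqI)
      (simp_all add: far_ray_frame axial_rot_inner inner_add_left inner_diff_left frame_inner field_simps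
        flip: add_divide_distrib diff_divide_distrib)
qed

lemma S_axial_rot: "S (axial_rot \<psi> y) = S y"
  by (simp add: far_cos_def axis_dist_def axial_rot_norm axial_rot_inner)

lemma continuous_on_u: "continuous_on A u"
  unfolding u_frame[abs_def] by (intro continuous_intros)

lemma u_measurable [measurable]: "u \<in> borel_measurable borel"
  by (intro borel_measurable_continuous_onI continuous_on_u)

lemma S_measurable [measurable]: "S \<in> borel_measurable borel"
  by (intro borel_measurable_continuous_onI continuous_on_S)

lemma axis_dist_measurable [measurable]: "axis_dist m \<in> borel_measurable borel"
  unfolding axis_dist_def by (intro borel_measurable_continuous_onI continuous_intros)

lemma far_ray_measurable [measurable]: "far_ray m \<xi> \<in> borel_measurable borel"
  unfolding far_ray_def by measurable

lemma circle_mass_measurable [measurable]: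
  assumes [measurable]: "\<omega> \<in> sets borel"
  shows "circle_mass \<omega> \<in> borel_measurable borel"
  unfolding circle_mass_def by measurable

lemma circle_mass_full: "(\<And>\<theta>. \<theta> \<in> {0..<2*pi} \<Longrightarrow> d *\<^sub>R u \<theta> \<in> \<omega>) \<Longrightarrow> circle_mass \<omega> d = ennreal (2 * pi)"
proof -
  assume *: "\<And>\<theta>. \<theta> \<in> {0..<2*pi} \<Longrightarrow> d *\<^sub>R u \<theta> \<in> \<omega>"
  have "circle_mass \<omega> d = (\<integral>\<^sup>+\<theta>. indicator {0..<2*pi} \<theta> \<partial>lborel)"
    unfolding circle_mass_def by (rule nn_integral_cong) (use * in \<open>auto simp: indicator_def\<close>)
  thus ?thesis by simp
qed

lemma circle_mass_shift:
  assumes [measurable]: "\<omega> \<in> sets borel" and "\<phi> \<in> {0..<2*pi}"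
  shows "(\<integral>\<^sup>+\<psi>. indicator \<omega> (d *\<^sub>R u (\<phi> + \<psi>)) * indicator {0..<2*pi} \<psi> \<partial>lborel) = circle_mass \<omega> d"
  unfolding circle_mass_def
  by (rule nn_integral_period_shift[where f="\<lambda>\<theta>. indicator \<omega> (d *\<^sub>R u \<theta>)"])
    (use assms(2) in \<open>auto simp: u_frame\<close>)

text \<open>
  A rotation about the axis turns the seen focus along its circle and keeps its distance. The average of the
  left-hand side over all rotations is unchanged by invariance, and by Fubini it is the integral of the
  angular measure \<open>circle_mass\<close>. Directions on the axis have no azimuth and must be null.
\<close>
lemma rotation_average:
  fixes N :: "(real^3) measure"
  assumes fin: "finite_measure N" and sN: "sets N = sets borel"
    and inv: "\<And>\<psi> X. X \<in> sets borel \<Longrightarrow> emeasure N {v. axial_rot \<psi> v \<in> X} = emeasure N X"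
    and null: "emeasure N {v. axis_dist m v = 0} = 0"
    and D[measurable]: "D \<in> borel_measurable borel" and \<omega>[measurable]: "\<omega> \<in> sets borel"
  shows "ennreal (2 * pi) * emeasure N {v. D (S v) *\<^sub>R far_ray m \<xi> v \<in> \<omega>} = (\<integral>\<^sup>+v. circle_mass \<omega> (D (S v)) \<partial>N)"
proof -
  interpret finite_measure N by (rule fin)
  interpret P: pair_sigma_finite lborel N by standard
  note [measurable_cong] = sN
  define \<Phi> where "\<Phi> = (\<lambda>v. D (S v) *\<^sub>R far_ray m \<xi> v)"
  have \<Phi>[measurable]: "\<Phi> \<in> borel_measurable borel" unfolding \<Phi>_def by measurable
  have rot: "(\<lambda>z. axial_rot (fst z) (snd z)) \<in> borel_measurable borel"
    unfolding axial_rot_def by (intro borel_measurable_continuous_onI continuous_intros)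
  have rotp: "(\<lambda>z. axial_rot (fst z) (snd z)) \<in> borel_measurable (borel \<Otimes>\<^sub>M borel)"
    using rot by (simp only: borel_prod)
  have j: "(\<lambda>z. indicator \<omega> (\<Phi> (axial_rot (fst z) (snd z))) * indicator {0..<2*pi} (fst z) :: ennreal)
       \<in> borel_measurable (borel \<Otimes>\<^sub>M borel)"
    using measurable_compose[OF rotp \<Phi>] by measurable
  have rotm[measurable]: "axial_rot \<psi> \<in> borel_measurable borel" for \<psi>
    unfolding axial_rot_def[abs_def] by (intro borel_measurable_continuous_onI continuous_intros)
  have spN: "space N = UNIV" using sets_eq_imp_space_eq[OF sN] by simp
  define X where "X = {v. \<Phi> v \<in> \<omega>}"
  have X[measurable]: "X \<in> sets borel" using measurable_sets[OF \<Phi> \<omega>] by (simp add: X_def vimage_def)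
  have "ennreal (2 * pi) * emeasure N X = (\<integral>\<^sup>+\<psi>. emeasure N X * indicator {0..<2*pi} \<psi> \<partial>lborel)"
    by (simp add: nn_integral_cmult mult.commute)
  also have "\<dots> = (\<integral>\<^sup>+\<psi>. (\<integral>\<^sup>+v. indicator \<omega> (\<Phi> (axial_rot \<psi> v)) * indicator {0..<2*pi} \<psi> \<partial>N) \<partial>lborel)"
  proof (rule nn_integral_cong)
    fix \<psi> :: real
    have mX: "{v. axial_rot \<psi> v \<in> X} \<in> sets N"
      using measurable_sets[OF rotm X, of \<psi>] by (simp add: vimage_def sN)
    have "(\<integral>\<^sup>+v. indicator \<omega> (\<Phi> (axial_rot \<psi> v)) * indicator {0..<2*pi} \<psi> \<partial>N)
        = (\<integral>\<^sup>+v. indicator {v. axial_rot \<psi> v \<in> X} v * indicator {0..<2*pi} \<psi> \<partial>N)"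
      by (rule nn_integral_cong) (auto simp: X_def indicator_def)
    also have "\<dots> = emeasure N {v. axial_rot \<psi> v \<in> X} * indicator {0..<2*pi} \<psi>"
      using mX by (simp add: nn_integral_multc)
    also have "emeasure N {v. axial_rot \<psi> v \<in> X} = emeasure N X" by (rule inv[OF X])
    finally show "emeasure N X * indicator {0..<2*pi} \<psi> = (\<integral>\<^sup>+v. indicator \<omega> (\<Phi> (axial_rot \<psi> v)) * indicator {0..<2*pi} \<psi> \<partial>N)"
      by simp
  qed
  also have "\<dots> = (\<integral>\<^sup>+v. (\<integral>\<^sup>+\<psi>. indicator \<omega> (\<Phi> (axial_rot \<psi> v)) * indicator {0..<2*pi} \<psi> \<partial>lborel) \<partial>N)"
    by (rule P.Fubini'[symmetric]) (use j in \<open>simp add: case_prod_beta' sN cong: measurable_cong_sets sets_pair_measure_cong\<close>)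
  also have "\<dots> = (\<integral>\<^sup>+v. circle_mass \<omega> (D (S v)) \<partial>N)"
  proof (rule nn_integral_cong_AE)
    have a0: "{v. axis_dist m v = 0} \<in> sets N"
      using measurable_sets[OF axis_dist_measurable, of "{0}"] by (simp add: vimage_def sN)
    have "AE v in N. axis_dist m v \<noteq> 0"
      by (rule AE_I'[of "{v. axis_dist m v = 0}"]) (use null a0 in auto)
    thus "AE v in N. (\<integral>\<^sup>+\<psi>. indicator \<omega> (\<Phi> (axial_rot \<psi> v)) * indicator {0..<2*pi} \<psi> \<partial>lborel) = circle_mass \<omega> (D (S v))"
    proof eventually_elim
      fix v assume "axis_dist m v \<noteq> 0"
      then obtain \<phi> where \<phi>: "\<phi> \<in> {0..<2*pi}" "far_ray m \<xi> v = u \<phi>" by (rule far_ray_cases)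
      have "\<Phi> (axial_rot \<psi> v) = D (S v) *\<^sub>R u (\<phi> + \<psi>)" for \<psi>
        by (simp add: \<Phi>_def S_axial_rot far_ray_axial_rot \<phi>(2) axial_rot_u)
      thus "(\<integral>\<^sup>+\<psi>. indicator \<omega> (\<Phi> (axial_rot \<psi> v)) * indicator {0..<2*pi} \<psi> \<partial>lborel) = circle_mass \<omega> (D (S v))"
        using circle_mass_shift[OF \<omega> \<phi>(1)] by simp
    qed
  qed
  finally show ?thesis by (simp add: X_def \<Phi>_def)
qed

end

section \<open>The mass distribution on the cone\<close>

context cone_frame
begin

lemma cone_point_derivatives:
  "vector_derivative (\<lambda>s. cone_point m m' \<xi> (s, t)) (at s) = u t"
  "vector_derivative (\<lambda>t. cone_point m m' \<xi> (s, t)) (at t) =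
     (s * \<kappa>) *\<^sub>R (- sin t *\<^sub>R m' + cos t *\<^sub>R n)"
proof -
  show "vector_derivative (\<lambda>s. cone_point m m' \<xi> (s, t)) (at s) = u t"
    unfolding cone_point_u by (intro vector_derivative_at) (auto intro!: derivative_eq_intros)
  show "vector_derivative (\<lambda>t. cone_point m m' \<xi> (s, t)) (at t) =
     (s * \<kappa>) *\<^sub>R (- sin t *\<^sub>R m' + cos t *\<^sub>R n)"
    unfolding cone_point_u u_frame
    by (intro vector_derivative_at) (auto intro!: derivative_eq_intros simp: algebra_simps)
qed

lemma cone_area_element:
  "norm (cross3 (vector_derivative (\<lambda>s. cone_point m m' \<xi> (s, t)) (at s))
               (vector_derivative (\<lambda>t. cone_point m m' \<xi> (s, t)) (at t))) = \<bar>s\<bar> * \<kappa>"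
proof -
  define w where "w = - sin t *\<^sub>R m' + cos t *\<^sub>R n"
  have w: "w \<bullet> m' = - sin t" "w \<bullet> n = cos t" "w \<bullet> m = 0"
    by (simp_all add: w_def inner_add_left inner_diff_left frame_inner)
  have nw: "(norm w)\<^sup>2 = 1" unfolding frame_norm w by simp
  have uw: "u t \<bullet> w = 0" by (simp add: inner_commute[of "u t"] inner_u w)
  have "(norm (cross3 (u t) w))\<^sup>2 = 1\<^sup>2" unfolding norm_cross uw nw by (simp add: norm_u)
  hence "norm (cross3 (u t) w) = 1" by (simp only: power2_eq_iff_nonneg norm_ge_zero zero_le_one)
  thus ?thesis
    unfolding cone_point_derivatives w_def[symmetric] cross_mult_right using kappa(1) by (simp add: abs_mult)
qed

text \<open>
  The measure \<open>\<eta>\<close> is the distribution of \<open>norm x\<close> under \<open>f\<close>. Constancy of \<open>f\<close> on circles does not pass to a Borel version \<open>f1\<close> of \<open>f\<close>, but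
  by Fubini \<open>f1\<close> is constant almost everywhere on almost every circle, so its integral \<open>\<psi>\<close> over the circle
  is a Borel substitute for \<open>f\<close>.
\<close>
lemma cone_distribution:
  assumes Q: "compact Q" "Q \<subseteq> {0<..}"
    and f: "integrable (cone_measure m m' \<xi> Q) f" "\<forall>x\<in>cone_target m m' \<xi> Q. f x \<ge> 0"
      "\<forall>d\<in>Q. \<exists>c. \<forall>\<theta>\<in>{0..<2 * pi}. f (cone_point m m' \<xi> (d, \<theta>)) = c"
  obtains \<eta> :: "real measure" where "finite_borel_measure \<eta>" "measure \<eta> (- Q) = 0"
    and "\<And>\<omega>. \<omega> \<in> sets borel \<Longrightarrow> \<omega> \<subseteq> cone_target m m' \<xi> Q \<Longrightarrow>
           ennreal (2 * pi) * ennreal (LINT x:\<omega>|cone_measure m m' \<xi> Q. f x) = (\<integral>\<^sup>+d. circle_mass \<omega> d \<partial>\<eta>)"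
proof -
  define T where "T = cone_target m m' \<xi> Q"
  define U where "U = Q \<times> {0..<2*pi}"
  define p where "p = cone_point m m' \<xi>"
  define J where "J = (\<lambda>z::real \<times> real. ennreal (\<bar>fst z\<bar> * \<kappa>))"
  have pu: "p z = fst z *\<^sub>R u (snd z)" for z by (cases z) (simp add: p_def cone_point_u)
  have Tp: "T = p ` U" by (simp add: T_def U_def p_def cone_target_def)
  define \<tau> where "\<tau> = distr (density (restrict_space lborel U) J) (restrict_space borel T) p"
  have Jeq: "(\<lambda>(s, t). ennreal (norm (cross3 (vector_derivative (\<lambda>s. p (s, t)) (at s))
               (vector_derivative (\<lambda>t. p (s, t)) (at t))))) = J"
    unfolding p_def cone_area_element J_def by (simp add: fun_eq_iff)
  have cm: "cone_measure m m' \<xi> Q = completion \<tau>"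
    unfolding cone_measure_def surface_measure_def p_def[symmetric] U_def[symmetric] Jeq \<tau>_def Tp by (rule refl)
  have Qs[measurable]: "Q \<in> sets borel" using Q(1) by (intro borel_closed compact_imp_closed)
  have Us[measurable]: "U \<in> sets (borel \<Otimes>\<^sub>M borel)" unfolding U_def by measurable
  have Us': "U \<in> sets (lborel :: (real \<times> real) measure)" using Us unfolding borel_prod by simp
  have pc: "continuous_on A p" for A
    unfolding pu[abs_def] by (intro continuous_intros continuous_on_compose2[OF continuous_on_u[of UNIV]]) auto
  have pm[measurable]: "p \<in> borel_measurable (borel \<Otimes>\<^sub>M borel)"
    unfolding borel_prod by (intro borel_measurable_continuous_onI pc)
  have Tclosed: "T = p ` (Q \<times> {0..2*pi})"
  proof
    show "T \<subseteq> p ` (Q \<times> {0..2*pi})" unfolding Tp U_def by (rule image_mono) auto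
    show "p ` (Q \<times> {0..2*pi}) \<subseteq> T"
    proof
      fix x assume "x \<in> p ` (Q \<times> {0..2*pi})"
      then obtain d t where x: "x = p (d, t)" "d \<in> Q" "0 \<le> t" "t \<le> 2*pi" by auto
      show "x \<in> T"
      proof (cases "t = 2*pi")
        case True
        hence "x = p (d, 0)" using x(1) by (simp add: pu u_frame)
        thus ?thesis using x(2) by (auto simp: Tp U_def)
      next
        case False
        thus ?thesis using x by (auto simp: Tp U_def)
      qed
    qed
  qed
  have "compact T" unfolding Tclosed by (intro compact_continuous_image pc compact_Times Q compact_Icc)
  hence Ts[measurable]: "T \<in> sets borel" by (intro borel_closed compact_imp_closed)
  have Jm[measurable]: "J \<in> borel_measurable (borel \<Otimes>\<^sub>M borel)" unfolding J_def by measurable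
  have Jr: "J \<in> borel_measurable (restrict_space lborel U)"
    by (intro measurable_restrict_space1) (use Jm in \<open>simp add: borel_prod\<close>)
  have pr: "p \<in> restrict_space lborel U \<rightarrow>\<^sub>M restrict_space borel T"
    by (intro measurable_restrict_space2 measurable_restrict_space1)
      (use pm in \<open>auto simp: borel_prod space_restrict_space Tp\<close>)
  have pd: "p \<in> density (restrict_space lborel U) J \<rightarrow>\<^sub>M restrict_space borel T" using pr by simp
  have nn: "(\<integral>\<^sup>+x. h x \<partial>\<tau>) = (\<integral>\<^sup>+d. ennreal (d * \<kappa>) * indicator Q d * (\<integral>\<^sup>+\<theta>. h (d *\<^sub>R u \<theta>) * indicator {0..<2*pi} \<theta> \<partial>lborel) \<partial>lborel)"
    if h: "h \<in> borel_measurable borel" for h :: "real^3 \<Rightarrow> ennreal"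
  proof -
    have hr: "h \<in> borel_measurable (restrict_space borel T)" using h by (rule measurable_restrict_space1)
    have hp: "(\<lambda>z. h (p z)) \<in> borel_measurable (borel \<Otimes>\<^sub>M borel)" using h by measurable
    have hpr: "(\<lambda>z. h (p z)) \<in> borel_measurable (restrict_space lborel U)"
      by (intro measurable_restrict_space1) (use hp in \<open>simp add: borel_prod\<close>)
    have "(\<integral>\<^sup>+x. h x \<partial>\<tau>) = (\<integral>\<^sup>+z. h (p z) \<partial>density (restrict_space lborel U) J)"
      unfolding \<tau>_def by (rule nn_integral_distr[OF pd]) (use hr in simp)
    also have "\<dots> = (\<integral>\<^sup>+z. J z * h (p z) \<partial>restrict_space lborel U)"
      by (rule nn_integral_density[OF Jr hpr])
    also have "\<dots> = (\<integral>\<^sup>+z. J z * h (p z) * indicator U z \<partial>lborel)"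
      by (rule nn_integral_restrict_space) (use Us' in simp)
    also have "\<dots> = (\<integral>\<^sup>+z. J z * h (p z) * indicator U z \<partial>(lborel \<Otimes>\<^sub>M lborel))"
      by (simp add: lborel_prod)
    also have "\<dots> = (\<integral>\<^sup>+d. (\<integral>\<^sup>+\<theta>. J (d, \<theta>) * h (p (d, \<theta>)) * indicator U (d, \<theta>) \<partial>lborel) \<partial>lborel)"
      by (rule lborel.nn_integral_fst[symmetric]) (use hp in measurable)
    also have "\<dots> = (\<integral>\<^sup>+d. ennreal (d * \<kappa>) * indicator Q d * (\<integral>\<^sup>+\<theta>. h (d *\<^sub>R u \<theta>) * indicator {0..<2*pi} \<theta> \<partial>lborel) \<partial>lborel)"
    proof (rule nn_integral_cong)
      fix d :: real
      have "(\<integral>\<^sup>+\<theta>. J (d, \<theta>) * h (p (d, \<theta>)) * indicator U (d, \<theta>) \<partial>lborel)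
          = (\<integral>\<^sup>+\<theta>. (ennreal (d * \<kappa>) * indicator Q d) * (h (d *\<^sub>R u \<theta>) * indicator {0..<2*pi} \<theta>) \<partial>lborel)"
        by (rule nn_integral_cong) (use Q(2) in \<open>auto simp: J_def pu U_def indicator_def\<close>)
      also have "\<dots> = ennreal (d * \<kappa>) * indicator Q d * (\<integral>\<^sup>+\<theta>. h (d *\<^sub>R u \<theta>) * indicator {0..<2*pi} \<theta> \<partial>lborel)"
        by (rule nn_integral_cmult) (use h in measurable)
      finally show "(\<integral>\<^sup>+\<theta>. J (d, \<theta>) * h (p (d, \<theta>)) * indicator U (d, \<theta>) \<partial>lborel) = \<dots>" .
    qed
    finally show ?thesis .
  qed
  have fm: "(\<lambda>x. ennreal (f x)) \<in> borel_measurable (completion \<tau>)" using f(1) by (simp add: cm)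
  obtain f' where f': "f' \<in> borel_measurable \<tau>" "AE x in \<tau>. ennreal (f x) = f' x"
    using completion_ex_borel_measurable[OF fm] by blast
  define f1 where "f1 = (\<lambda>x. f' x * indicator T x)"
  have "f' \<in> borel_measurable (restrict_space borel T)" using f'(1) by (simp add: \<tau>_def)
  hence f1m[measurable]: "f1 \<in> borel_measurable borel"
    unfolding f1_def by (subst (asm) borel_measurable_restrict_space_iff_ennreal) auto
  have spT: "space \<tau> = T" by (simp add: \<tau>_def space_restrict_space)
  have f1: "AE x in \<tau>. ennreal (f x) = f1 x"
    using f'(2) AE_space by eventually_elim (simp add: f1_def spT)
  define \<phi> where "\<phi> = (\<lambda>d. ennreal (f (p (d, 0))))"
  have f\<phi>: "ennreal (f (d *\<^sub>R u \<theta>)) = \<phi> d" if "d \<in> Q" "\<theta> \<in> {0..<2*pi}" for d \<theta>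
  proof -
    from bspec[OF f(3) that(1)]
    obtain c where c: "\<forall>\<theta>\<in>{0..<2 * pi}. f (cone_point m m' \<xi> (d, \<theta>)) = c" by (rule exE)
    have "f (cone_point m m' \<xi> (d, 0)) = c" by (rule bspec[OF c]) simp
    thus ?thesis using bspec[OF c that(2)] by (simp add: \<phi>_def p_def cone_point_u)
  qed
  have "AE z in density (restrict_space lborel U) J. ennreal (f (p z)) = f1 (p z)"
    by (rule AE_distrD[OF pd f1[unfolded \<tau>_def]])
  hence "AE z in restrict_space lborel U. 0 < J z \<longrightarrow> ennreal (f (p z)) = f1 (p z)"
    by (simp add: AE_density[OF Jr])
  hence "AE z in lborel. z \<in> U \<longrightarrow> 0 < J z \<longrightarrow> ennreal (f (p z)) = f1 (p z)"
    using Us' by (subst (asm) AE_restrict_space_iff) auto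
  hence "AE z in (lborel \<Otimes>\<^sub>M lborel). z \<in> U \<longrightarrow> 0 < J z \<longrightarrow> ennreal (f (p z)) = f1 (p z)"
    unfolding lborel_prod .
  hence "AE d in lborel. AE \<theta> in lborel. (d, \<theta>) \<in> U \<longrightarrow> 0 < J (d, \<theta>) \<longrightarrow> ennreal (f (p (d, \<theta>))) = f1 (p (d, \<theta>))"
    by (rule lborel_pair.AE_pair)
  hence AEf: "AE d in lborel. d \<in> Q \<longrightarrow> (AE \<theta> in lborel. \<theta> \<in> {0..<2*pi} \<longrightarrow> f1 (d *\<^sub>R u \<theta>) = \<phi> d)"
  proof eventually_elim
    fix d assume *: "AE \<theta> in lborel. (d, \<theta>) \<in> U \<longrightarrow> 0 < J (d, \<theta>) \<longrightarrow> ennreal (f (p (d, \<theta>))) = f1 (p (d, \<theta>))"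
    show "d \<in> Q \<longrightarrow> (AE \<theta> in lborel. \<theta> \<in> {0..<2*pi} \<longrightarrow> f1 (d *\<^sub>R u \<theta>) = \<phi> d)"
    proof
      assume d: "d \<in> Q"
      hence "d > 0" using Q(2) by auto
      hence J0: "0 < J (d, \<theta>)" for \<theta> using kappa(1) by (simp add: J_def)
      show "AE \<theta> in lborel. \<theta> \<in> {0..<2*pi} \<longrightarrow> f1 (d *\<^sub>R u \<theta>) = \<phi> d"
        using *
      proof eventually_elim
        fix \<theta> assume **: "(d, \<theta>) \<in> U \<longrightarrow> 0 < J (d, \<theta>) \<longrightarrow> ennreal (f (p (d, \<theta>))) = f1 (p (d, \<theta>))"
        show "\<theta> \<in> {0..<2*pi} \<longrightarrow> f1 (d *\<^sub>R u \<theta>) = \<phi> d"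
        proof
          assume t: "\<theta> \<in> {0..<2*pi}"
          have "ennreal (f (p (d, \<theta>))) = f1 (p (d, \<theta>))" using ** J0 d t by (simp add: U_def)
          thus "f1 (d *\<^sub>R u \<theta>) = \<phi> d" using f\<phi>[OF d t] by (simp add: pu)
        qed
      qed
    qed
  qed
  define \<psi> where "\<psi> = (\<lambda>d. \<integral>\<^sup>+\<theta>. f1 (d *\<^sub>R u \<theta>) * indicator {0..<2*pi} \<theta> \<partial>lborel)"
  have \<psi>m[measurable]: "\<psi> \<in> borel_measurable borel" unfolding \<psi>_def by measurable
  define \<rho> where "\<rho> = (\<lambda>d. ennreal (d * \<kappa>) * indicator Q d * \<psi> d)"
  have \<rho>m[measurable]: "\<rho> \<in> borel_measurable borel" unfolding \<rho>_def by measurable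
  define \<eta> where "\<eta> = density lborel \<rho>"
  have main: "ennreal (2 * pi) * (\<integral>\<^sup>+x. ennreal (f x) * indicator \<omega> x \<partial>\<tau>) = (\<integral>\<^sup>+d. circle_mass \<omega> d \<partial>\<eta>)"
    if \<omega>[measurable]: "\<omega> \<in> sets borel" for \<omega>
  proof -
    have "(\<integral>\<^sup>+x. ennreal (f x) * indicator \<omega> x \<partial>\<tau>) = (\<integral>\<^sup>+x. f1 x * indicator \<omega> x \<partial>\<tau>)"
      by (rule nn_integral_cong_AE) (use f1 in eventually_elim, simp)
    also have "\<dots> = (\<integral>\<^sup>+d. ennreal (d * \<kappa>) * indicator Q d *
        (\<integral>\<^sup>+\<theta>. f1 (d *\<^sub>R u \<theta>) * indicator \<omega> (d *\<^sub>R u \<theta>) * indicator {0..<2*pi} \<theta> \<partial>lborel) \<partial>lborel)"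
      by (rule nn) measurable
    finally have "ennreal (2 * pi) * (\<integral>\<^sup>+x. ennreal (f x) * indicator \<omega> x \<partial>\<tau>) =
        (\<integral>\<^sup>+d. ennreal (2 * pi) * (ennreal (d * \<kappa>) * indicator Q d *
        (\<integral>\<^sup>+\<theta>. f1 (d *\<^sub>R u \<theta>) * indicator \<omega> (d *\<^sub>R u \<theta>) * indicator {0..<2*pi} \<theta> \<partial>lborel)) \<partial>lborel)"
      by (subst nn_integral_cmult) auto
    also have "\<dots> = (\<integral>\<^sup>+d. \<rho> d * circle_mass \<omega> d \<partial>lborel)"
    proof (rule nn_integral_cong_AE)
      show "AE d in lborel. ennreal (2 * pi) * (ennreal (d * \<kappa>) * indicator Q d *
        (\<integral>\<^sup>+\<theta>. f1 (d *\<^sub>R u \<theta>) * indicator \<omega> (d *\<^sub>R u \<theta>) * indicator {0..<2*pi} \<theta> \<partial>lborel)) = \<rho> d * circle_mass \<omega> d"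
        using AEf
      proof eventually_elim
        fix d assume *: "d \<in> Q \<longrightarrow> (AE \<theta> in lborel. \<theta> \<in> {0..<2*pi} \<longrightarrow> f1 (d *\<^sub>R u \<theta>) = \<phi> d)"
        show "ennreal (2 * pi) * (ennreal (d * \<kappa>) * indicator Q d *
          (\<integral>\<^sup>+\<theta>. f1 (d *\<^sub>R u \<theta>) * indicator \<omega> (d *\<^sub>R u \<theta>) * indicator {0..<2*pi} \<theta> \<partial>lborel)) = \<rho> d * circle_mass \<omega> d"
        proof (cases "d \<in> Q")
          case False
          thus ?thesis by (simp add: \<rho>_def)
        next
          case True
          with * have ae: "AE \<theta> in lborel. \<theta> \<in> {0..<2*pi} \<longrightarrow> f1 (d *\<^sub>R u \<theta>) = \<phi> d" by blast
          have 1: "(\<integral>\<^sup>+\<theta>. f1 (d *\<^sub>R u \<theta>) * indicator \<omega> (d *\<^sub>R u \<theta>) * indicator {0..<2*pi} \<theta> \<partial>lborel)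
              = (\<integral>\<^sup>+\<theta>. \<phi> d * (indicator \<omega> (d *\<^sub>R u \<theta>) * indicator {0..<2*pi} \<theta>) \<partial>lborel)"
            by (rule nn_integral_cong_AE) (use ae in eventually_elim, auto simp: indicator_def)
          have 2: "\<psi> d = (\<integral>\<^sup>+\<theta>. \<phi> d * indicator {0..<2*pi} \<theta> \<partial>lborel)"
            unfolding \<psi>_def by (rule nn_integral_cong_AE) (use ae in eventually_elim, auto simp: indicator_def)
          have 3: "\<psi> d = \<phi> d * ennreal (2 * pi)" unfolding 2 by (subst nn_integral_cmult) auto
          have 4: "(\<integral>\<^sup>+\<theta>. f1 (d *\<^sub>R u \<theta>) * indicator \<omega> (d *\<^sub>R u \<theta>) * indicator {0..<2*pi} \<theta> \<partial>lborel) = \<phi> d * circle_mass \<omega> d"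
            unfolding 1 circle_mass_def by (rule nn_integral_cmult) measurable
          show ?thesis unfolding 4 \<rho>_def 3 by (simp only: mult_ac)
        qed
      qed
    qed
    also have "\<dots> = (\<integral>\<^sup>+d. circle_mass \<omega> d \<partial>\<eta>)"
      unfolding \<eta>_def by (rule nn_integral_density[symmetric]) auto
    finally show ?thesis .
  qed
  have \<eta>Q: "emeasure \<eta> (- Q) = 0"
  proof -
    have "emeasure \<eta> (- Q) = (\<integral>\<^sup>+d. \<rho> d * indicator (- Q) d \<partial>lborel)"
      unfolding \<eta>_def by (rule emeasure_density) auto
    also have "\<dots> = (\<integral>\<^sup>+d. 0 \<partial>(lborel :: real measure))" by (rule nn_integral_cong) (auto simp: \<rho>_def indicator_def)
    finally show ?thesis by simp
  qed
  have fin: "(\<integral>\<^sup>+x. ennreal (f x) * indicator T x \<partial>\<tau>) < \<infinity>"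
  proof -
    have "(\<integral>\<^sup>+x. ennreal (f x) * indicator T x \<partial>\<tau>) = (\<integral>\<^sup>+x. ennreal (norm (f x)) \<partial>completion \<tau>)"
      unfolding nn_integral_completion
      by (rule nn_integral_cong) (use f(2) in \<open>auto simp: spT T_def indicator_def\<close>)
    thus ?thesis using f(1) by (simp add: cm integrable_iff_bounded)
  qed
  have cmT: "circle_mass T d = ennreal (2 * pi)" if "d \<in> Q" for d
    by (rule circle_mass_full) (use that in \<open>auto simp: T_def cone_target_def cone_point_u[symmetric]\<close>)
  have "emeasure \<eta> UNIV < \<infinity>"
  proof -
    have "(\<integral>\<^sup>+d. circle_mass T d \<partial>\<eta>) = (\<integral>\<^sup>+d. ennreal (2 * pi) \<partial>\<eta>)"
    proof (rule nn_integral_cong_AE)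
      have "AE d in \<eta>. d \<notin> - Q"
        by (rule AE_not_in) (use \<eta>Q in \<open>auto simp: null_sets_def \<eta>_def\<close>)
      thus "AE d in \<eta>. circle_mass T d = ennreal (2 * pi)" by eventually_elim (use cmT in auto)
    qed
    also have "\<dots> = ennreal (2 * pi) * emeasure \<eta> UNIV" by (simp add: \<eta>_def)
    finally have "ennreal (2 * pi) * emeasure \<eta> UNIV = ennreal (2 * pi) * (\<integral>\<^sup>+x. ennreal (f x) * indicator T x \<partial>\<tau>)"
      using main[OF Ts] by simp
    hence "emeasure \<eta> UNIV = (\<integral>\<^sup>+x. ennreal (f x) * indicator T x \<partial>\<tau>)"
      by (subst (asm) ennreal_mult_cancel_left) auto
    thus ?thesis using fin by simp
  qed
  hence fb: "finite_borel_measure \<eta>"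
    unfolding finite_borel_measure_def finite_borel_measure_axioms_def
    by (auto intro!: finite_measureI simp: \<eta>_def)
  have val: "ennreal (LINT x:\<omega>|cone_measure m m' \<xi> Q. f x) = (\<integral>\<^sup>+x. ennreal (f x) * indicator \<omega> x \<partial>\<tau>)"
    if \<omega>: "\<omega> \<in> sets borel" "\<omega> \<subseteq> T" for \<omega>
  proof -
    have "\<omega> \<in> sets (restrict_space borel T)" using \<omega> Ts by (simp add: sets_restrict_space_iff)
    hence \<omega>c: "\<omega> \<in> sets (completion \<tau>)" by (intro sets_completionI_sets) (simp add: \<tau>_def)
    have int: "integrable (completion \<tau>) (\<lambda>x. indicator \<omega> x *\<^sub>R f x)"
      using f(1) \<omega>c by (intro integrable_mult_indicator) (simp_all add: cm)
    have "ennreal (LINT x:\<omega>|cone_measure m m' \<xi> Q. f x) = ennreal (LINT x|completion \<tau>. indicator \<omega> x *\<^sub>R f x)"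
      by (simp add: set_lebesgue_integral_def cm)
    also have "\<dots> = (\<integral>\<^sup>+x. ennreal (indicator \<omega> x *\<^sub>R f x) \<partial>completion \<tau>)"
      by (rule nn_integral_eq_integral[symmetric, OF int])
        (use f(2) in \<open>auto intro!: AE_I2 simp: spT T_def indicator_def\<close>)
    also have "\<dots> = (\<integral>\<^sup>+x. ennreal (f x) * indicator \<omega> x \<partial>\<tau>)"
      unfolding nn_integral_completion by (rule nn_integral_cong) (auto simp: indicator_def)
    finally show ?thesis .
  qed
  show ?thesis
  proof (rule that[OF fb])
    show "measure \<eta> (- Q) = 0" using \<eta>Q by (simp add: measure_def)
    fix \<omega> assume "\<omega> \<in> sets borel" "\<omega> \<subseteq> cone_target m m' \<xi> Q"
    thus "ennreal (2 * pi) * ennreal (LINT x:\<omega>|cone_measure m m' \<xi> Q. f x) = (\<integral>\<^sup>+d. circle_mass \<omega> d \<partial>\<eta>)"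
      using val[of \<omega>] main[of \<omega>] by (simp add: T_def)
  qed
qed

end

section \<open>Solution of the refractor problem\<close>

lemma less_eps_limit_imp:
  assumes "0 < min_dist T" "min_dist T \<le> max_dist T" "ereal r < eps_limit T"
  shows "r * (max_dist T / min_dist T - 1) < 1"
proof (cases "max_dist T = min_dist T")
  case True
  thus ?thesis using assms(1) by simp
next
  case False
  define K where "K = max_dist T / min_dist T"
  have K: "K > 1" using False assms(1,2) by (simp add: K_def)
  have "((\<lambda>t. ereal (1 / (t - 1))) \<longlongrightarrow> ereal (1 / (K - 1))) (at_right K)"
    using K by (intro tendsto_intros) auto
  hence "Lim (at_right K) (\<lambda>t. ereal (1 / (t - 1))) = ereal (1 / (K - 1))"
    by (intro tendsto_Lim) simp
  hence "r < 1 / (K - 1)" using assms(3) by (simp add: eps_limit_def K_def)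
  thus ?thesis using K by (simp add: K_def[symmetric] field_simps)
qed

text \<open>
  This makes the aperture nondegenerate, \<open>\<delta> < \<xi>\<close>. The square root is at least \<open>L - l * c\<close>, and the bound on \<open>c\<close> comes
  from two opposite rulings of the cone.
\<close>
lemma eps0_formula_lower_bound:
  fixes l L c \<xi> :: real
  assumes "0 < l" "l \<le> L" "L < 2 * l * c" "c \<le> 2 * \<xi>\<^sup>2 - 1" "0 < \<xi>" "\<xi> < 1"
  shows "1 / \<xi> < (l + sqrt (l\<^sup>2 - 2 * L * l * c + L\<^sup>2)) / (2 * l * c - L)"
proof -
  have xi2: "\<xi>\<^sup>2 < 1" using assms(5,6) abs_square_less_1[of \<xi>] by simp
  have c1: "c \<le> 1" using assms(4) xi2 by linarith
  have c0: "c > 0" using assms(1-3) by (smt (verit) mult_nonneg_nonpos)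
  have "(L - l * c)\<^sup>2 = l\<^sup>2 * c\<^sup>2 - 2 * L * l * c + L\<^sup>2"
    by (simp add: power2_eq_square algebra_simps)
  also have "\<dots> \<le> l\<^sup>2 - 2 * L * l * c + L\<^sup>2"
    using mult_left_mono[of "c\<^sup>2" 1 "l\<^sup>2"] c0 c1 by (simp add: power_le_one)
  finally have sq: "L - l * c \<le> sqrt (l\<^sup>2 - 2 * L * l * c + L\<^sup>2)" by (rule real_le_rsqrt)
  have "(4 * \<xi> + 3) * (1 - \<xi>) > 0" using assms(5,6) by simp
  hence "4 * \<xi>\<^sup>2 - 3 < \<xi> * 1" by (simp add: algebra_simps power2_eq_square)
  also have "\<dots> \<le> \<xi> * (2 - c)" using assms(5) c1 by (intro mult_left_mono) auto
  finally have "2 * c - 1 < \<xi> * (2 - c)" using assms(4) by linarith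
  hence "l * (2 * c - 1) < l * (\<xi> * (2 - c))" using assms(1) by simp
  moreover have "\<xi> * (l + l * (1 - c)) \<le> \<xi> * (l + sqrt (l\<^sup>2 - 2 * L * l * c + L\<^sup>2))"
    using assms(2,5) sq by (intro mult_left_mono) (auto simp: algebra_simps)
  ultimately have "2 * l * c - L < \<xi> * (l + sqrt (l\<^sup>2 - 2 * L * l * c + L\<^sup>2))"
    using assms(2) by (simp add: algebra_simps)
  thus ?thesis using assms(3,5) by (simp add: field_simps)
qed

context cone_frame
begin

lemma norm_cone_target:
  assumes "Q \<subseteq> {0<..}"
  shows "norm ` cone_target m m' \<xi> Q = Q"
proof -
  have nrm: "norm (cone_point m m' \<xi> (d, \<theta>)) = d" if "d \<in> Q" for d \<theta>
    using that assms norm_u by (auto simp: cone_point_u)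
  show ?thesis
  proof (intro equalityI subsetI)
    fix d assume "d \<in> norm ` cone_target m m' \<xi> Q"
    then obtain d' \<theta> where "d' \<in> Q" "d = norm (cone_point m m' \<xi> (d', \<theta>))"
      unfolding cone_target_def by blast
    thus "d \<in> Q" using nrm by simp
  next
    fix d assume d: "d \<in> Q"
    hence "cone_point m m' \<xi> (d, 0) \<in> cone_target m m' \<xi> Q" unfolding cone_target_def by (intro imageI) auto
    thus "d \<in> norm ` cone_target m m' \<xi> Q" using nrm[OF d, of 0] by (intro image_eqI) auto
  qed
qed

lemma min_cos_cone_target:
  assumes "Q \<subseteq> {0<..}" "Q \<noteq> {}"
  shows "min_cos (cone_target m m' \<xi> Q) \<le> 2 * \<xi>\<^sup>2 - 1"
proof -
  obtain d where d: "d \<in> Q" using assms(2) by blast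
  hence d0: "d > 0" using assms(1) by auto
  define T where "T = cone_target m m' \<xi> Q"
  have mem: "d *\<^sub>R u 0 \<in> T" "d *\<^sub>R u pi \<in> T"
    using d by (auto simp: T_def cone_target_def cone_point_u[symmetric])
  have "u 0 \<bullet> u pi = 2 * \<xi>\<^sup>2 - 1"
    by (simp add: inner_u) (simp add: u_frame inner_add_left frame_inner kappa(2) flip: power2_eq_square)
  hence "2 * \<xi>\<^sup>2 - 1 \<in> (\<lambda>(x, y). sgn x \<bullet> sgn y) ` (T \<times> T)"
    using mem sgn_cone_point[OF d0] by (intro image_eqI[of _ _ "(d *\<^sub>R u 0, d *\<^sub>R u pi)"]) auto
  moreover have "bdd_below ((\<lambda>(x, y). sgn x \<bullet> sgn y) ` (T \<times> T))"
  proof (rule bdd_belowI[of _ "-1"])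
    fix r assume "r \<in> (\<lambda>(x, y). sgn x \<bullet> sgn y) ` (T \<times> T)"
    then obtain z where "r = (case z of (x, y) \<Rightarrow> sgn x \<bullet> sgn y)" "z \<in> T \<times> T" by (rule imageE)
    hence r: "r = sgn (fst z) \<bullet> sgn (snd z)" by (simp add: case_prod_beta)
    have "\<bar>sgn (fst z) \<bullet> sgn (snd z)\<bar> \<le> norm (sgn (fst z)) * norm (sgn (snd z))" by (rule Cauchy_Schwarz_ineq2)
    also have "\<dots> \<le> 1" by (simp add: norm_sgn)
    finally show "-1 \<le> r" using r by linarith
  qed
  ultimately show ?thesis unfolding min_cos_def T_def[symmetric] by (rule cInf_lower)
qed

text \<open>
  The two bounds differ by a level set of \<open>S\<close>, hence by a null set; they determine the aperture as far as
  integrals are concerned.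
\<close>
lemma aperture_bounds:
  assumes "Q \<subseteq> {0<..}" "Q \<noteq> {}"
  shows "aperture \<delta> (cone_target m m' \<xi> Q) \<subseteq> {v \<in> sphere 0 1. \<delta> \<le> S v}"
    and "{v \<in> sphere 0 1. \<delta> < S v} \<subseteq> aperture \<delta> (cone_target m m' \<xi> Q)"
proof -
  define A where "A = (\<Inter>x\<in>cone_target m m' \<xi> Q. {v \<in> sphere 0 1. v \<bullet> sgn x \<ge> \<delta>})"
  obtain d where d: "d \<in> Q" using assms(2) by blast
  have A: "A = {v \<in> sphere 0 1. \<delta> \<le> S v}"
  proof (intro equalityI subsetI)
    fix v assume v: "v \<in> A"
    obtain \<theta> where t: "\<theta> \<in> {0..<2*pi}" "v \<bullet> u \<theta> = S v" by (rule S_attained)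
    have "cone_point m m' \<xi> (d, \<theta>) \<in> cone_target m m' \<xi> Q" using d t by (auto simp: cone_target_def)
    hence "v \<in> {v \<in> sphere 0 1. v \<bullet> sgn (cone_point m m' \<xi> (d, \<theta>)) \<ge> \<delta>}" using v unfolding A_def by blast
    thus "v \<in> {v \<in> sphere 0 1. \<delta> \<le> S v}"
      using d assms(1) t(2) sgn_cone_point[of d \<theta>] by (auto simp: cone_point_u)
  next
    fix v assume v: "v \<in> {v \<in> sphere 0 1. \<delta> \<le> S v}"
    show "v \<in> A" unfolding A_def
    proof
      fix x assume "x \<in> cone_target m m' \<xi> Q"
      then obtain e \<theta> where "e \<in> Q" "x = cone_point m m' \<xi> (e, \<theta>)" unfolding cone_target_def by blast
      hence x: "e \<in> Q" "x = e *\<^sub>R u \<theta>" by (simp_all add: cone_point_u)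
      hence "sgn x = u \<theta>" using assms(1) sgn_cone_point[of e \<theta>] by auto
      thus "v \<in> {v \<in> sphere 0 1. v \<bullet> sgn x \<ge> \<delta>}" using v S_le[of v \<theta>] by simp
    qed
  qed
  have ap: "aperture \<delta> (cone_target m m' \<xi> Q) = top_of_set (sphere 0 1) interior_of A"
    by (simp add: aperture_def A_def)
  show "aperture \<delta> (cone_target m m' \<xi> Q) \<subseteq> {v \<in> sphere 0 1. \<delta> \<le> S v}"
    unfolding ap A by (rule interior_of_subset)
  show "{v \<in> sphere 0 1. \<delta> < S v} \<subseteq> aperture \<delta> (cone_target m m' \<xi> Q)"
    unfolding ap
  proof (rule interior_of_maximal)
    show "{v \<in> sphere 0 1. \<delta> < S v} \<subseteq> A" unfolding A by auto
    have "{v \<in> sphere 0 1. \<delta> < S v} = sphere 0 1 \<inter> {v. \<delta> < S v}" by auto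
    moreover have "open {v. \<delta> < S v}" by (intro open_Collect_less continuous_on_const continuous_on_S)
    ultimately show "openin (top_of_set (sphere 0 1)) {v \<in> sphere 0 1. \<delta> < S v}"
      by (simp add: openin_open_Int)
  qed
qed

lemma S_level_null:
  assumes "t > 0"
  shows "{v \<in> sphere 0 1. S v = t} \<in> null_sets sphere_borel_measure"
proof (rule null_sets_sphere_borel_measure)
  have "{v \<in> sphere 0 1. S v = t} = sphere 0 1 \<inter> (S -` {t} \<inter> space borel)" by auto
  also have "\<dots> \<in> sets borel" by (intro sets.Int measurable_sets[OF S_measurable]) auto
  finally show "{v \<in> sphere 0 1. S v = t} \<in> sets sphere_borel_measure"
    by (auto simp: sets_sphere_borel_measure_iff)
  show "negligible {y. sgn y \<in> {v \<in> sphere 0 1. S v = t}}"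
  proof (rule negligible_subset[OF S_level_negligible[OF assms]])
    show "{y. sgn y \<in> {v \<in> sphere 0 1. S v = t}} \<subseteq> {y. S y = t * norm y}"
    proof
      fix y assume y: "y \<in> {y. sgn y \<in> {v \<in> sphere 0 1. S v = t}}"
      have "S y = S (norm y *\<^sub>R sgn y)" by (cases "y = 0") (simp_all add: sgn_div_norm)
      also have "\<dots> = norm y * S (sgn y)" by (rule S_scale) simp
      finally show "y \<in> {y. S y = t * norm y}" using y by simp
    qed
  qed
qed

text \<open>
  The choice of the data: \<open>\<nu>\<close> is the distribution of \<open>S\<close> under \<open>g\<close>, without atoms because level sets of \<open>S\<close> are
  null; \<open>\<eta>\<close> is the distribution of distances under \<open>f\<close>; energy balance says that their total masses agree.
\<close>
lemma refractor_problem_solvable: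
  fixes f g :: "real^3 \<Rightarrow> real" and Q :: "real set" and \<gamma> :: real
  defines "T \<equiv> cone_target m m' \<xi> Q"
  defines "\<delta> \<equiv> 1 / (eps0 T + \<gamma>)" and "F \<equiv> \<lambda>\<omega>. LINT x:\<omega>|cone_measure m m' \<xi> Q. f x"
  assumes Qpos: "Q \<subseteq> {0<..}" and H1: "H1 T"
    and gam: "\<gamma> > 0" "ereal (eps0 T + \<gamma>) < eps_limit T"
    and g: "integrable sphere_measure g" "\<forall>v\<in>sphere 0 1. g v \<ge> 0"
      "\<forall>A. axial_rotation m A \<longrightarrow> (\<forall>v\<in>sphere 0 1. g (A *v v) = g v)"
      "\<forall>v\<in>sphere 0 1 - aperture \<delta> T. g v = 0"
    and f: "integrable (cone_measure m m' \<xi> Q) f" "\<forall>x\<in>T. f x \<ge> 0"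
      "\<forall>d\<in>Q. \<exists>c. \<forall>\<theta>\<in>{0..<2 * pi}. f (cone_point m m' \<xi> (d, \<theta>)) = c"
    and balance: "F T = mu g (aperture \<delta> T)"
  shows "\<exists>\<epsilon>\<^sub>M R. eps0 T + \<gamma> < \<epsilon>\<^sub>M \<and> ereal \<epsilon>\<^sub>M < eps_limit T \<and>
           R \<in> convex_refractors \<epsilon>\<^sub>M T \<and>
           (\<forall>A. axial_rotation m A \<longrightarrow> (*v) A ` R = R) \<and>
           weak_solution F g \<delta> T R"
proof -
  define \<sigma> where "\<sigma> = sphere_borel_measure"
  have nT: "norm ` T = Q" unfolding T_def by (rule norm_cone_target[OF Qpos])
  have Tc: "compact T" and Tne: "T \<noteq> {}" using H1 by (auto simp: H1_def)
  have Qc: "compact Q" unfolding nT[symmetric] by (intro compact_continuous_image continuous_intros Tc)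
  have Qne: "Q \<noteq> {}" using Tne nT by blast
  have Ts: "T \<in> sets borel" using Tc by (intro borel_closed compact_imp_closed)
  define l where "l = min_dist T"
  define L where "L = max_dist T"
  have lL: "l = Inf Q" "L = Sup Q" by (simp_all add: l_def L_def min_dist_def max_dist_def nT)
  have bQ: "bdd_below Q" "bdd_above Q"
    using compact_imp_bounded[OF Qc] by (auto intro: bounded_imp_bdd_below bounded_imp_bdd_above)
  have Ql: "l \<le> d" "d \<le> L" if "d \<in> Q" for d
    using that bQ by (auto simp: lL intro: cInf_lower cSup_upper)
  have l0: "0 < l" using H1 by (simp add: H1_def l_def)
  have lleL: "l \<le> L" using Ql Qne by fastforce
  have mc: "min_cos T \<le> 2 * \<xi>\<^sup>2 - 1" unfolding T_def by (rule min_cos_cone_target[OF Qpos Qne])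
  have "1 / \<xi> < eps0 T"
    unfolding eps0_def Let_def using eps0_formula_lower_bound[OF l0 lleL _ mc xi] H1
    by (simp add: H1_def l_def L_def)
  hence eg: "1 / \<xi> < eps0 T + \<gamma>" using gam(1) by linarith
  have xi1: "1 < 1 / \<xi>" using xi by simp
  have eg1: "eps0 T + \<gamma> > 1" using eg xi1 by linarith
  have \<delta>: "0 < \<delta>" "\<delta> < \<xi>" using eg eg1 xi by (simp_all add: \<delta>_def field_simps)
  obtain eM where eM: "eps0 T + \<gamma> < eM" "ereal eM < eps_limit T"
  proof -
    obtain x where x: "ereal (eps0 T + \<gamma>) < x" "x < eps_limit T" using dense[OF gam(2)] by blast
    then obtain r where "x = ereal r" by (cases x) auto
    thus ?thesis using that[of r] x by simp
  qed
  have eM1: "1 < eM" using eM eg1 by linarith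
  have eMd: "1 < eM * \<delta>" using eM eg1 by (simp add: \<delta>_def)
  have eML: "eM * (L / l - 1) < 1"
    using less_eps_limit_imp[of T eM] l0 lleL eM(2) by (simp add: l_def L_def)

  obtain N where N: "finite_measure N" "sets N = sets borel"
    and Nem: "\<And>X. X \<in> sets borel \<Longrightarrow> emeasure N X = (\<integral>\<^sup>+v. ennreal (g v) * indicator X v \<partial>\<sigma>)"
    and Nmu: "\<And>X V. X \<in> sets borel \<Longrightarrow> V \<in> sets sphere_measure \<Longrightarrow>
           (AE v in \<sigma>. v \<in> V \<longleftrightarrow> v \<in> X) \<Longrightarrow> mu g V = measure N X"
    and Ninv: "\<And>A X. \<forall>v\<in>sphere 0 1. g (A *v v) = g v \<Longrightarrow> orthogonal_matrix A \<Longrightarrow> X \<in> sets borel \<Longrightarrow>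
           emeasure N {v. A *v v \<in> X} = emeasure N X"
  proof (rule mass_distribution[OF g(1,2), folded \<sigma>_def], goal_cases)
    case (1 N)
    show ?case by (rule 1(1)[OF 1(2-)])
  qed
  interpret N: finite_measure N by (rule N(1))
  have spN: "space N = UNIV" using sets_eq_imp_space_eq[OF N(2)] by simp
  obtain \<eta> where \<eta>: "finite_borel_measure \<eta>" "measure \<eta> (- Q) = 0"
    and \<eta>F: "\<And>\<omega>. \<omega> \<in> sets borel \<Longrightarrow> \<omega> \<subseteq> T \<Longrightarrow> ennreal (2 * pi) * ennreal (F \<omega>) = (\<integral>\<^sup>+d. circle_mass \<omega> d \<partial>\<eta>)"
    unfolding T_def F_def
  proof (rule cone_distribution[OF Qc Qpos f(1) f(2)[unfolded T_def] f(3)], goal_cases)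
    case (1 \<eta>)
    show ?case by (rule 1(1)[OF 1(2-)])
  qed
  interpret \<eta>: finite_borel_measure \<eta> by (rule \<eta>(1))
  note ap = aperture_bounds[OF Qpos Qne, of \<delta>, folded T_def]

  have Slev: "{v \<in> sphere 0 1. S v = t} \<in> null_sets \<sigma>" if "t > 0" for t
    unfolding \<sigma>_def by (rule S_level_null[OF that])
  have Nnull: "emeasure N X = 0" if X: "X \<in> sets borel" "X \<inter> {v \<in> sphere 0 1. \<delta> \<le> S v} \<subseteq> Z" "Z \<in> null_sets \<sigma>" for X Z
  proof -
    have "emeasure N X = (\<integral>\<^sup>+v. 0 \<partial>\<sigma>)"
      unfolding Nem[OF X(1)]
    proof (rule nn_integral_cong_AE)
      have "AE v in \<sigma>. v \<notin> Z" by (rule AE_not_in[OF X(3)])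
      thus "AE v in \<sigma>. ennreal (g v) * indicator X v = 0"
        using AE_space
      proof eventually_elim
        fix v assume v: "v \<notin> Z" "v \<in> space \<sigma>"
        hence vs: "v \<in> sphere 0 1" by (simp add: \<sigma>_def)
        show "ennreal (g v) * indicator X v = 0"
        proof (cases "v \<in> aperture \<delta> T")
          case True
          hence "v \<notin> X" using ap(1) X(2) v by blast
          thus ?thesis by simp
        next
          case False
          hence "g v = 0" using g(4) vs by blast
          thus ?thesis by simp
        qed
      qed
    qed
    thus ?thesis by simp
  qed
  have Sm[measurable]: "S \<in> borel_measurable borel" by (rule S_measurable)
  have SmN: "S \<in> borel_measurable N" using Sm N(2) by (simp cong: measurable_cong_sets)
  define \<nu> where "\<nu> = distr N borel S"
  have \<nu>f: "finite_borel_measure \<nu>"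
    unfolding finite_borel_measure_def finite_borel_measure_axioms_def \<nu>_def
    using N.finite_measure_distr[OF SmN] by simp
  have Slevel: "{v. S v = t} \<in> sets borel" for t
    using measurable_sets[OF Sm, of "{t}"] by (simp add: vimage_def)
  have atomless: "measure \<nu> {t} = 0" for t
  proof -
    have "emeasure N {v. S v = t} = 0"
    proof (cases "t > 0")
      case True
      show ?thesis by (rule Nnull[OF Slevel _ Slev[OF True]]) auto
    next
      case False
      show ?thesis by (rule Nnull[OF Slevel, of t "{}"]) (use False \<delta> in auto)
    qed
    moreover have "emeasure \<nu> {t} = emeasure N {v. S v = t}"
      unfolding \<nu>_def by (subst emeasure_distr[OF SmN]) (auto simp: vimage_def spN)
    ultimately show ?thesis by (simp add: measure_def)
  qed
  have total: "measure \<nu> UNIV = measure \<eta> UNIV"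
  proof -
    have "aperture \<delta> T \<in> sets sphere_measure"
    proof -
      have "openin (top_of_set (sphere 0 1)) (aperture \<delta> T)"
        unfolding aperture_def by (rule openin_interior_of)
      then obtain U where "open U" "aperture \<delta> T = sphere 0 1 \<inter> U" unfolding openin_open by blast
      hence "aperture \<delta> T \<in> sets \<sigma>" by (auto simp: \<sigma>_def sets_sphere_borel_measure_iff)
      thus ?thesis by (simp add: sphere_measure_completion \<sigma>_def)
    qed
    moreover have "mu g (aperture \<delta> T) = mu g (sphere 0 1)"
      unfolding mu_def set_lebesgue_integral_def
      by (rule Bochner_Integration.integral_cong)
        (use g(4) ap(1) in \<open>auto simp: sphere_measure_completion indicator_def\<close>)
    moreover have "mu g (sphere 0 1) = measure N UNIV"
    proof (rule Nmu)
      have "sphere 0 1 \<in> sets \<sigma>" by (simp add: \<sigma>_def sets_sphere_borel_measure_iff)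
      thus "sphere 0 1 \<in> sets sphere_measure" by (simp add: sphere_measure_completion \<sigma>_def)
    qed (auto intro!: AE_I2 simp: \<sigma>_def)
    ultimately have FT: "F T = measure N UNIV" using balance by simp
    have "AE d in \<eta>. d \<notin> - Q"
    proof (rule AE_not_in)
      have "- Q \<in> sets \<eta>"
        by (rule \<eta>.sets_M[OF borel_comp[OF borel_closed[OF compact_imp_closed[OF Qc]]]])
      thus "- Q \<in> null_sets \<eta>" using \<eta>(2) by (simp add: null_sets_def \<eta>.emeasure_eq_measure)
    qed
    hence "AE d in \<eta>. circle_mass T d = ennreal (2 * pi)"
    proof eventually_elim
      fix d assume "d \<notin> - Q"
      thus "circle_mass T d = ennreal (2 * pi)"
        by (intro circle_mass_full) (auto simp: T_def cone_target_def cone_point_u[symmetric])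
    qed
    hence "(\<integral>\<^sup>+d. circle_mass T d \<partial>\<eta>) = (\<integral>\<^sup>+d. ennreal (2 * pi) \<partial>\<eta>)" by (rule nn_integral_cong_AE)
    also have "\<dots> = ennreal (2 * pi) * ennreal (measure \<eta> UNIV)"
      using \<eta>.borel_UNIV by (simp add: \<eta>.emeasure_eq_measure)
    finally have "ennreal (2 * pi) * ennreal (measure N UNIV) = ennreal (2 * pi) * ennreal (measure \<eta> UNIV)"
      using \<eta>F[OF Ts] FT by simp
    hence "measure N UNIV = measure \<eta> UNIV"
      by (simp flip: ennreal_mult)
    moreover have "measure \<nu> UNIV = measure N UNIV"
      unfolding \<nu>_def by (subst measure_distr[OF SmN]) (auto simp: spN)
    ultimately show ?thesis by simp
  qed
  obtain D where Dt: "mono D" "\<And>s. D s \<in> Q" "distr \<nu> borel D = \<eta>"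
  proof (rule monotone_transport[OF \<nu>f atomless \<eta>(1) Qc Qne \<eta>(2) total], goal_cases)
    case (1 D)
    show ?case by (rule 1(1)[OF 1(2-)])
  qed
  have Dm[measurable]: "D \<in> borel_measurable borel" by (rule borel_measurable_mono[OF Dt(1)])

  obtain p e where e_ge: "\<And>d. l \<le> d \<Longrightarrow> d \<le> L \<Longrightarrow> eM \<le> e d"
    and p_env: "\<And>s. s \<in> {\<delta>..\<xi>} \<Longrightarrow> p s > 0"
      "\<And>d s. l \<le> d \<Longrightarrow> d \<le> L \<Longrightarrow> s \<in> {\<delta>..\<xi>} \<Longrightarrow> p s \<le> recip_radius (e d) d s"
      "\<And>s. s \<in> {\<delta>..\<xi>} \<Longrightarrow> p s = recip_radius (e (D s)) (D s) s"
      "\<And>s d c. s \<in> {\<delta><..<\<xi>} \<Longrightarrow> isCont D s \<Longrightarrow> 0 < d \<Longrightarrow> 1 < c \<Longrightarrow>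
           (\<And>t. t \<in> {\<delta>..\<xi>} \<Longrightarrow> p t \<le> recip_radius c d t) \<Longrightarrow> p s = recip_radius c d s \<Longrightarrow> d = D s"
  proof (rule envelope_exists[OF \<delta> xi(2) l0 Dt(1) Ql(1)[OF Dt(2)] Ql(2)[OF Dt(2)] eM1 eMd eML], goal_cases)
    case (1 p e)
    show ?case by (rule 1(1)[OF 1(2-)])
  qed
  interpret cone_refractor m m' \<xi> Q D p e \<delta>
  proof
    fix d assume d: "d \<in> Q"
    show "0 < d" using Qpos d by auto
    show "1 < e d" using e_ge[OF Ql[OF d]] eM1 by linarith
  next
    fix d s assume "d \<in> Q" "s \<in> {\<delta>..\<xi>}"
    thus "p s \<le> recip_radius (e d) d s" by (intro p_env(2) Ql)
  qed (use \<delta> Dt p_env in auto)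
  define R where "R = frontier C"

  have Rref: "R \<in> convex_refractors eM T"
  proof -
    have "eM \<le> e (norm x)" if "x \<in> T" for x
    proof -
      have "norm x \<in> Q" using that nT by blast
      thus ?thesis using e_ge[OF Ql] by simp
    qed
    thus ?thesis unfolding convex_refractors_def R_def C_def T_def
      by (intro CollectI exI[of _ "\<lambda>x. e (norm x)"]) simp
  qed
  have Rsym: "\<forall>A. axial_rotation m A \<longrightarrow> (*v) A ` R = R"
    unfolding R_def by (intro allI impI refractor_symmetric)

  define \<Phi> where "\<Phi> = (\<lambda>v. D (S v) *\<^sub>R far_ray m \<xi> v)"
  have \<Phi>m: "\<Phi> \<in> borel_measurable borel"
    unfolding \<Phi>_def using far_ray_measurable by measurable
  \<comment> \<open>The levels of \<open>S\<close> at which visibility is not controlled: the rim, the axis, and the jumps of \<open>D\<close>. Only positive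
    levels are needed, and only those are known to be null.\<close>
  define B where "B = insert \<delta> (insert \<xi> ({s. \<not> isCont D s} \<inter> {\<delta><..}))"
  define Z where "Z = (\<Union>t\<in>B. {v \<in> sphere 0 1. S v = t})"
  have Zn: "Z \<in> null_sets \<sigma>"
    unfolding Z_def
  proof (rule null_sets_UN')
    show "countable B" unfolding B_def using mono_ctble_discont[OF Dt(1)] by simp
    fix t assume "t \<in> B"
    thus "{v \<in> sphere 0 1. S v = t} \<in> null_sets \<sigma>" using \<delta> by (intro Slev) (auto simp: B_def)
  qed
  have ws: "visibility \<delta> T R \<omega> \<in> sets sphere_measure \<and> F \<omega> = energy g \<delta> T R \<omega>"
    if \<omega>: "\<omega> \<in> sets borel" "\<omega> \<subseteq> T" for \<omega>
  proof
    define V where "V = visibility \<delta> T R \<omega>"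
    define W where "W = {v. norm v = 1 \<and> \<delta> < S v \<and> \<Phi> v \<in> \<omega>}"
    define Y where "Y = {v. \<Phi> v \<in> \<omega>}"
    have Y: "Y \<in> sets borel" using measurable_sets[OF \<Phi>m \<omega>(1)] by (simp add: Y_def vimage_def)
    have W: "W \<in> sets borel"
    proof -
      have "W = sphere 0 1 \<inter> (S -` {\<delta><..} \<inter> space borel) \<inter> Y" by (auto simp: W_def Y_def)
      thus ?thesis using Y measurable_sets[OF Sm, of "{\<delta><..}"] by auto
    qed
    have clos: "closure (aperture \<delta> T) \<subseteq> {v \<in> sphere 0 1. \<delta> \<le> S v}"
    proof (rule closure_minimal[OF ap(1)])
      have "closed (sphere 0 1 \<inter> {v. \<delta> \<le> S v})"
        by (intro closed_Int closed_sphere closed_Collect_le continuous_on_const continuous_on_S)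
      moreover have "sphere 0 1 \<inter> {v. \<delta> \<le> S v} = {v \<in> sphere 0 1. \<delta> \<le> S v}" by auto
      ultimately show "closed {v \<in> sphere 0 1. \<delta> \<le> S v}" by simp
    qed
    have VW: "v \<in> V \<longleftrightarrow> v \<in> W" if v: "v \<in> sphere 0 1" "v \<notin> Z" for v
    proof (cases "\<delta> \<le> S v")
      case False
      thus ?thesis using clos by (auto simp: V_def W_def visibility_def)
    next
      case True
      have nv: "norm v = 1" using v(1) by simp
      have "S v \<notin> B" using v by (auto simp: Z_def)
      hence s: "S v \<in> {\<delta><..<\<xi>}" "isCont D (S v)" using True S_le_xi[OF nv] by (auto simp: B_def)
      have "v \<in> closure (aperture \<delta> T)" using ap(2) s v(1) closure_subset by fastforce
      hence "v \<in> V \<longleftrightarrow> v \<in> sgn ` {z \<in> R. \<exists>x\<in>\<omega>. \<exists>\<epsilon>>1. supporting \<epsilon> x R z}"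
        by (simp add: V_def visibility_def)
      also have "\<dots> \<longleftrightarrow> \<Phi> v \<in> \<omega>"
        unfolding R_def \<Phi>_def by (rule visible_iff[OF nv s \<omega>(2)[unfolded T_def]])
      finally show ?thesis using nv s by (simp add: W_def)
    qed
    have Vsph: "V \<subseteq> sphere 0 1" using clos by (auto simp: V_def visibility_def)
    have "V = (W - Z) \<union> (V \<inter> Z)" using VW Vsph by (auto simp: W_def)
    moreover have "W - Z \<in> sets \<sigma>"
    proof -
      have "W \<in> sets \<sigma>" using W by (auto simp: \<sigma>_def sets_sphere_borel_measure_iff W_def)
      thus ?thesis using Zn by auto
    qed
    ultimately have "V \<in> sets (completion \<sigma>)"
      using Zn by (intro sets_completionI[of V "W - Z" "V \<inter> Z" Z]) auto
    hence Vs: "V \<in> sets sphere_measure" by (simp add: sphere_measure_completion \<sigma>_def)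
    thus "visibility \<delta> T R \<omega> \<in> sets sphere_measure" by (simp add: V_def)
    have "AE v in \<sigma>. v \<notin> Z" by (rule AE_not_in[OF Zn])
    hence "AE v in \<sigma>. v \<in> V \<longleftrightarrow> v \<in> W"
      using AE_space by eventually_elim (use VW in \<open>simp add: \<sigma>_def\<close>)
    from Nmu[OF W Vs this] have en: "energy g \<delta> T R \<omega> = measure N W" by (simp add: energy_def V_def)
    have WY: "measure N W = measure N Y"
    proof -
      have sub: "W \<subseteq> Y" unfolding W_def Y_def by blast
      have "(Y - W) \<inter> {v \<in> sphere 0 1. \<delta> \<le> S v} \<subseteq> {v \<in> sphere 0 1. S v = \<delta>}"
        by (auto simp: W_def Y_def not_less)
      hence "emeasure N (Y - W) = 0" by (rule Nnull[OF sets.Diff[OF Y W] _ Slev[OF \<delta>(1)]])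
      moreover have "emeasure N W + emeasure N (Y - W) = emeasure N (W \<union> (Y - W))"
        by (rule plus_emeasure) (use W Y N(2) in auto)
      moreover have "W \<union> (Y - W) = Y" using sub by (rule Diff_partition)
      ultimately show ?thesis by (simp add: measure_def)
    qed
    have "ennreal (2 * pi) * emeasure N Y = (\<integral>\<^sup>+v. circle_mass \<omega> (D (S v)) \<partial>N)"
      unfolding Y_def \<Phi>_def
    proof (rule rotation_average[OF N _ _ Dm \<omega>(1)])
      fix \<psi> X assume X: "X \<in> sets (borel :: (real^3) measure)"
      show "emeasure N {v. axial_rot \<psi> v \<in> X} = emeasure N X"
        using Ninv[OF mp[OF spec[OF g(3)] axial_rot_matrix(3)] axial_rot_matrix(2) X, of \<psi>]
        by (simp only: axial_rot_matrix(1))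
    next
      show "emeasure N {v. axis_dist m v = 0} = 0"
      proof (rule Nnull[OF _ _ Slev[OF xi(1)]])
        show "{v. axis_dist m v = 0} \<in> sets borel"
          using measurable_sets[OF axis_dist_measurable, of "{0}"] by (simp add: vimage_def)
        show "{v. axis_dist m v = 0} \<inter> {v \<in> sphere 0 1. \<delta> \<le> S v} \<subseteq> {v \<in> sphere 0 1. S v = \<xi>}"
        proof
          fix v assume v: "v \<in> {v. axis_dist m v = 0} \<inter> {v \<in> sphere 0 1. \<delta> \<le> S v}"
          hence "\<not> S v < \<xi>" using axis_dist_pos[of v] \<delta> by auto
          thus "v \<in> {v \<in> sphere 0 1. S v = \<xi>}" using v S_le_xi[of v] by auto
        qed
      qed
    qed
    also have "\<dots> = (\<integral>\<^sup>+s. circle_mass \<omega> (D s) \<partial>\<nu>)"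
      unfolding \<nu>_def
      by (rule nn_integral_distr[symmetric, OF SmN])
        (use measurable_compose[OF Dm circle_mass_measurable[OF \<omega>(1)]] in simp)
    also have "\<dots> = (\<integral>\<^sup>+d. circle_mass \<omega> d \<partial>\<eta>)"
      unfolding Dt(3)[symmetric]
      by (rule nn_integral_distr[symmetric])
        (use Dm circle_mass_measurable[OF \<omega>(1)] in \<open>simp_all add: \<nu>_def\<close>)
    also have "\<dots> = ennreal (2 * pi) * ennreal (F \<omega>)" by (rule \<eta>F[OF \<omega>, symmetric])
    finally have "ennreal (2 * pi) * ennreal (measure N Y) = ennreal (2 * pi) * ennreal (F \<omega>)"
      by (simp add: N.emeasure_eq_measure)
    moreover have "F \<omega> \<ge> 0"
      unfolding F_def set_lebesgue_integral_def
    proof (rule integral_nonneg_AE, rule AE_I2)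
      fix x assume "x \<in> space (cone_measure m m' \<xi> Q)"
      hence "x \<in> T"
        by (simp add: cone_measure_def surface_measure_def space_restrict_space T_def cone_target_def)
      thus "0 \<le> indicator \<omega> x *\<^sub>R f x" using f(2) by simp
    qed
    ultimately have "measure N Y = F \<omega>" by (simp flip: ennreal_mult)
    thus "F \<omega> = energy g \<delta> T R \<omega>" using en WY by simp
  qed
  show ?thesis
    by (rule exI[of _ eM], rule exI[of _ R]) (use eM Rref Rsym ws in \<open>simp add: weak_solution_def\<close>)
qed

end

theorem theorem7p1:
  fixes m_star m' :: "real^3" and \<xi> \<gamma> \<delta> :: real and Q :: "real set"
    and T :: "(real^3) set" and f g :: "real^3 \<Rightarrow> real" and F :: "(real^3) set \<Rightarrow> real"
  assumes "m_star \<in> sphere 0 1" and "m' \<in> sphere 0 1" and "m_star \<bullet> m' = 0"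
    and "0 < \<xi>" and "\<xi> < 1"
    and "closed Q" and "Q \<subseteq> {0<..}"
    and "T = cone_target m_star m' \<xi> Q"
    and "H1 T"
    and "ereal (eps0 T) < eps_limit T"
    and "\<gamma> > 0" and "ereal (eps0 T + \<gamma>) < eps_limit T"
    and "\<delta> = 1 / (eps0 T + \<gamma>)"
    and "integrable sphere_measure g"
    and "\<forall>m\<in>sphere 0 1. g m \<ge> 0"
    and "\<forall>A. axial_rotation m_star A \<longrightarrow> (\<forall>m\<in>sphere 0 1. g (A *v m) = g m)"
    and "\<forall>m\<in>sphere 0 1 - aperture \<delta> T. g m = 0"
    and "integrable (cone_measure m_star m' \<xi> Q) f"
    and "\<forall>x\<in>T. f x \<ge> 0"
    and "\<forall>d\<in>Q. \<exists>v. \<forall>\<theta>\<in>{0..<2 * pi}. f (cone_point m_star m' \<xi> (d, \<theta>)) = v"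
    and "F = (\<lambda>\<omega>. LINT x:\<omega>|cone_measure m_star m' \<xi> Q. f x)"
    and "F T = mu g (aperture \<delta> T)"
  shows "\<exists>\<epsilon>\<^sub>M R. eps0 T + \<gamma> < \<epsilon>\<^sub>M \<and> ereal \<epsilon>\<^sub>M < eps_limit T \<and>
           R \<in> convex_refractors \<epsilon>\<^sub>M T \<and>
           (\<forall>A. axial_rotation m_star A \<longrightarrow> (*v) A ` R = R) \<and>
           weak_solution F g \<delta> T R"
proof -
  interpret cone_frame m_star m' \<xi>
    by standard (use assms(1-5) in auto)
  show ?thesis
    using assms(7,9,11,12,14-20,22) unfolding assms(8,13,21)
    by (rule refractor_problem_solvable)
qed

end
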